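(* Assume that there is a constant $\alpha>2$ with $\mathbb E(|a|^{\alpha})<1$ and $\mathbb E(|b|^{\alpha})<+\infty$, and that $\mathbb P(b\neq 0)>0$ and $\mathbb E(b)=0$. Assume moreover that at least one of the following holds: (i) $\mathbb E(a)\geq 0$ and, for all $x\in\mathbb R$ and $y>0$, $\mathbb P_x(\tau_y>1)=\mathbb P(ax+b>-y)>0$; (ii) for any $x\in\mathbb R$ and $y>0$ there exists $p_0\in(2,\alpha)$ such that for any constant $c>0$ there exists $n_0\geq 1$ with $\mathbb P_x\big((X_{n_0},y+S_{n_0})\in K_{p_0,c},\ \tau_y>n_0\big)>0$, where $K_{p_0,c}=\{(x',y')\in\mathbb R\times(0,+\infty):\ y'\geq c(1+|x'|^{p_0})\}$. Then: 1. For any $p\in(2,\alpha)$ there is a constant $c_p>0$ such that for all $x\in\mathbb R$, $y>0$ and $n\geq 1$, $$\sqrt n\,\mathbb P_x(\tau_y>n)\leq c_p(1+y+|x|)^p.$$ 2. For any $x\in\mathbb R$ and $y>0$, $$\mathbb P_x(\tau_y>n)\underset{n\to+\infty}{\sim}\frac{2V(x,y)}{\sqrt{2\pi n}\,\sigma}.$$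
   Context: Let $(a_i,b_i)_{i\geq1}$ be i.i.d. real random pairs on a probability space with probability $\mathbb P$ and expectation $\mathbb E$, with the same law as a generic pair $(a,b)$. For $x\in\mathbb R$, define $X_0=x$ and $X_{n+1}=a_{n+1}X_n+b_{n+1}$, $n\geq0$; $\mathbb P_x$ and $\mathbb E_x$ denote probability and expectation for the chain started at $X_0=x$. Set $S_0=0$, $S_n=\sum_{i=1}^nX_i$. For $y\in\mathbb R$, $\tau_y=\min\{k\geq1:\ y+S_k\leq0\}$ (this is $\mathbb P_x$-a.s. finite under the moment assumptions made). Set $M_n=S_n+\frac{\mathbb E(a)}{1-\mathbb E(a)}(X_n-x)$, $n\geq0$. Under the stated assumptions $M_{\tau_y}$ is $\mathbb P_x$-integrable for $y>0$, and $V(x,y)=-\mathbb E_x(M_{\tau_y})$ is well defined and positive for $x\in\mathbb R$, $y>0$. The constant $\sigma>0$ is given by $$\sigma^2=\frac{\mathbb E(b^2)}{1-\mathbb E(a^2)}\cdot\frac{1+\mathbb E(a)}{1-\mathbb E(a)}.$$ Constants $c_p$ depend only on $p$ (and on the law of $(a,b)$ and $\alpha$). *)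

theory Defs
  imports "HOL-Probability.Probability"
begin

text \<open>The i.i.d. coefficients are sequences \<open>as\<close>, \<open>bs\<close> whose entries with index
  \<open>i \<ge> 1\<close> are used; \<open>as 0\<close> and \<open>bs 0\<close> never enter. The starting point \<open>x\<close> is an explicit
  argument of the chain, so the law \<open>P\<^sub>x\<close> is the law of the quantities below under the one
  underlying measure.\<close>

primrec affine_chain :: "(nat \<Rightarrow> 'w \<Rightarrow> real) \<Rightarrow> (nat \<Rightarrow> 'w \<Rightarrow> real) \<Rightarrow> real \<Rightarrow> nat \<Rightarrow> 'w \<Rightarrow> real" where
  "affine_chain as bs x 0 \<omega> = x"
| "affine_chain as bs x (Suc n) \<omega> = as (Suc n) \<omega> * affine_chain as bs x n \<omega> + bs (Suc n) \<omega>"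

definition walk :: "(nat \<Rightarrow> 'w \<Rightarrow> real) \<Rightarrow> (nat \<Rightarrow> 'w \<Rightarrow> real) \<Rightarrow> real \<Rightarrow> nat \<Rightarrow> 'w \<Rightarrow> real" where
  "walk as bs x n \<omega> = (\<Sum>i=1..n. affine_chain as bs x i \<omega>)"

text \<open>The infimum of the empty set is \<open>\<infinity>\<close> in \<^typ>\<open>enat\<close>: the walk never exits.\<close>

definition exit_time ::
  "(nat \<Rightarrow> 'w \<Rightarrow> real) \<Rightarrow> (nat \<Rightarrow> 'w \<Rightarrow> real) \<Rightarrow> real \<Rightarrow> real \<Rightarrow> 'w \<Rightarrow> enat" where
  "exit_time as bs x y \<omega> = (INF k\<in>{k. 1 \<le> k \<and> y + walk as bs x k \<omega> \<le> 0}. enat k)"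

text \<open>The argument \<open>m\<close> stands for the expectation of the generic multiplier.\<close>

definition corrected_walk ::
  "real \<Rightarrow> (nat \<Rightarrow> 'w \<Rightarrow> real) \<Rightarrow> (nat \<Rightarrow> 'w \<Rightarrow> real) \<Rightarrow> real \<Rightarrow> nat \<Rightarrow> 'w \<Rightarrow> real" where
  "corrected_walk m as bs x n \<omega> = walk as bs x n \<omega> + m / (1 - m) * (affine_chain as bs x n \<omega> - x)"

text \<open>The value 0 on the event of no exit is immaterial, the exit time being almost surely
  finite in the setting considered.\<close>

definition V_fun ::
  "'w measure \<Rightarrow> real \<Rightarrow> (nat \<Rightarrow> 'w \<Rightarrow> real) \<Rightarrow> (nat \<Rightarrow> 'w \<Rightarrow> real) \<Rightarrow> real \<Rightarrow> real \<Rightarrow> real" where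
  "V_fun M m as bs x y =
     - (\<integral>\<omega>. (case exit_time as bs x y \<omega> of
               enat k \<Rightarrow> corrected_walk m as bs x k \<omega>
             | \<infinity> \<Rightarrow> 0) \<partial>M)"

definition sigma_const :: "'w measure \<Rightarrow> ('w \<Rightarrow> real) \<Rightarrow> ('w \<Rightarrow> real) \<Rightarrow> real" where
  "sigma_const M a b =
     sqrt ((\<integral>\<omega>. (b \<omega>)\<^sup>2 \<partial>M) / (1 - (\<integral>\<omega>. (a \<omega>)\<^sup>2 \<partial>M))
           * ((1 + (\<integral>\<omega>. a \<omega> \<partial>M)) / (1 - (\<integral>\<omega>. a \<omega> \<partial>M))))"

definition K_set :: "real \<Rightarrow> real \<Rightarrow> (real \<times> real) set" where
  "K_set p c = {(x, y). 0 < y \<and> c * (1 + \<bar>x\<bar> powr p) \<le> y}"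

end

theory Submission
  imports Defs
begin

text \<open>
  Let \<open>Q\<close> be the one-step operator of the pair \<open>(X, y + S)\<close> killed when its second component leaves
  \<open>(0, \<infinity>)\<close>. Then the probability of survival is \<open>Q^n 1\<close>, and everything is an estimate on the iterates
  of \<open>Q\<close>. With \<open>m\<close> the mean of \<open>a\<close> and \<open>\<rho> = m / (1 - m)\<close> the quantity \<open>z = y + S + \<rho> X\<close> is a martingale,
  and the conditional variance of its increments is \<open>v = \<sigma>\<^sup>2\<close> up to the coboundary of a quadratic function \<open>kap\<close>
  of \<open>X\<close>. Let \<open>u\<close> be the solution of the heat equation that vanishes at \<open>z = 0\<close>; by Taylor's formula
  \<open>u + u'' kap / 2\<close>, evaluated at the remaining time, solves the killed equation up to errors that a moment of
  order \<open>p > 2\<close> makes summable. Comparison with sub- and supersolutions shows that \<open>Q^n 1\<close> is within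
  \<open>\<delta> + C (1 + |x|) / sqrt n\<close> of the probability \<open>nerf (y / sqrt (v n))\<close> that a centred Gaussian variable of
  variance \<open>v n\<close> has modulus at most \<open>y\<close>. No invariance principle with a rate is needed.

  At the exit time the walk overshoots by at most \<open>|X|\<close>, whose maximum over \<open>k\<close> steps is of order \<open>k^(1/p)\<close>,
  much smaller than \<open>sqrt k\<close>. Hence along doubling times \<open>sqrt n Q^n 1\<close> and \<open>Q^n z\<close> control each other with
  summable errors: the former is bounded and the latter converges to \<open>V\<close>. Restarting the walk at a small
  fraction of the time \<open>n\<close>, where \<open>nerf\<close> is almost linear, gives the asymptotics. Finally \<open>V\<close> is positive since
  \<open>Q^n z\<close> is bounded below by \<open>y + \<rho> x\<close> if \<open>\<rho> \<ge> 0\<close>, and by \<open>y / 2 - C (1 + |x|)\<close> in general.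
\<close>

section \<open>Moments, and the law of the coefficients\<close>

text \<open>The Gaussian comparison has a fixed error \<delta>, far larger than the survival
  probability itself, which is of order 1 / sqrt n. It becomes useful because it is applied only
  after a first stretch of time: by then its error is multiplied by the survival probability already
  reached. Over a doubling of time this yields a contraction and not an accumulating error. The loop
  closes because the overshoot scale n^(1/p) is negligible beside sqrt n exactly when p > 2. As
  every estimate is applied again at a random later state, its constants must be uniform in the
  starting point and its dependence on that point must be controlled: only terms linear in |x| and y
  appear, and their means on the survival event are themselves among the quantities of the
  recursion. The working exponent is at most 3, since second derivatives are used with Hoelder
  exponent p - 2; the resulting bound is linear in the starting point and so covers every exponent
  of the claim.\<close>

lemma young_powr:
  fixes u c \<theta> :: real
  assumes "0 \<le> u" "0 < c" "0 < \<theta>" "\<theta> \<le> 1"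
  shows "u powr \<theta> \<le> c powr (\<theta> - 1) * (\<theta> * u + (1 - \<theta>) * c)"
proof (cases "u = 0")
  case True
  then show ?thesis using assms by simp
next
  case False
  with assms have u: "u > 0" by simp
  have "\<theta> * ln u + (1-\<theta>) * ln c \<le> ln (\<theta> * u + (1-\<theta>) * c)"
    using concave_onD[OF ln_concave, of "1-\<theta>" u c] assms u by (simp add: algebra_simps)
  then have "exp (\<theta> * ln u + (1-\<theta>) * ln c) \<le> exp (ln (\<theta> * u + (1-\<theta>) * c))"
    by simp
  also have "\<dots> = \<theta> * u + (1-\<theta>) * c"
    using assms u by (simp add: add_pos_nonneg)
  finally have "u powr \<theta> * c powr (1-\<theta>) \<le> \<theta> * u + (1-\<theta>) * c"
    using assms u by (simp add: powr_def exp_add)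
  then have "c powr (\<theta>-1) * (u powr \<theta> * c powr (1-\<theta>)) \<le> c powr (\<theta>-1) * (\<theta> * u + (1-\<theta>) * c)"
    by (intro mult_left_mono) auto
  moreover have "c powr (\<theta>-1) * (u powr \<theta> * c powr (1-\<theta>)) = u powr \<theta>"
    using assms by (simp add: powr_add[symmetric] mult.left_commute)
  ultimately show ?thesis by simp
qed

text \<open>In place of Jensen: \<open>young_powr\<close> bounds the concave power by its tangent at
  an arbitrary point \<open>c\<close>. Tangency at 1 gives integrability. Tangency at a point
  strictly between the moment of order \<open>q\<close> and 1 bounds the moment of order
  \<open>r\<close> by \<open>c powr (r/q)\<close>, hence strictly below 1.\<close>

lemma (in prob_space) lower_moment:
  fixes f :: "'a \<Rightarrow> real"
  assumes f: "f \<in> borel_measurable M" and int: "integrable M (\<lambda>x. \<bar>f x\<bar> powr q)"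
    and r: "0 < r" "r \<le> q"
  shows "integrable M (\<lambda>x. \<bar>f x\<bar> powr r)"
    and "(\<integral>x. \<bar>f x\<bar> powr q \<partial>M) < 1 \<Longrightarrow> (\<integral>x. \<bar>f x\<bar> powr r \<partial>M) < 1"
proof -
  have q: "q > 0" using r by simp
  have bnd: "\<bar>f x\<bar> powr r \<le> c powr (r/q-1) * (r/q * \<bar>f x\<bar> powr q + (1-r/q) * c)" if "c > 0" for c x
  proof -
    have "(\<bar>f x\<bar> powr q) powr (r/q) \<le> c powr (r/q-1) * (r/q * \<bar>f x\<bar> powr q + (1-r/q) * c)"
      by (rule young_powr) (use r that in \<open>auto simp: field_simps\<close>)
    then show ?thesis using q by (simp add: powr_powr)
  qed
  show I: "integrable M (\<lambda>x. \<bar>f x\<bar> powr r)"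
  proof (rule Bochner_Integration.integrable_bound)
    show "integrable M (\<lambda>x. r/q * \<bar>f x\<bar> powr q + (1-r/q))" using int by simp
  next
    show "AE x in M. norm (\<bar>f x\<bar> powr r) \<le> norm (r/q * \<bar>f x\<bar> powr q + (1-r/q))"
    proof (rule AE_I2)
      fix x have "\<bar>f x\<bar> powr r \<le> r/q * \<bar>f x\<bar> powr q + (1-r/q)" using bnd[of 1 x] by simp
      moreover have "0 \<le> \<bar>f x\<bar> powr r" by simp
      ultimately show "norm (\<bar>f x\<bar> powr r) \<le> norm (r/q * \<bar>f x\<bar> powr q + (1-r/q))"
        unfolding real_norm_def by linarith
    qed
  next
    show "(\<lambda>x. \<bar>f x\<bar> powr r) \<in> borel_measurable M" using f by measurable
  qed
  assume l: "(\<integral>x. \<bar>f x\<bar> powr q \<partial>M) < 1"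
  then obtain c where c: "(\<integral>x. \<bar>f x\<bar> powr q \<partial>M) < c" "c < 1" using dense by blast
  have c0: "c > 0" using c(1) by (smt (verit, best) Bochner_Integration.integral_nonneg powr_ge_zero)
  have "(\<integral>x. \<bar>f x\<bar> powr r \<partial>M) \<le> (\<integral>x. c powr (r/q-1) * (r/q * \<bar>f x\<bar> powr q + (1-r/q) * c) \<partial>M)"
    by (intro integral_mono I bnd c0) (use int in simp)
  also have "\<dots> = c powr (r/q-1) * (r/q * (\<integral>x. \<bar>f x\<bar> powr q \<partial>M) + (1-r/q) * c)"
    using int by (simp add: prob_space)
  also have "\<dots> \<le> c powr (r/q-1) * (r/q * c + (1-r/q) * c)"
    using c r q by (intro mult_left_mono add_right_mono) auto
  also have "\<dots> = c powr (r/q)"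
    using c0 by (simp add: powr_diff algebra_simps)
  also have "\<dots> < 1" using c c0 r q powr_less_mono2[of "r/q" c 1] by simp
  finally show "(\<integral>x. \<bar>f x\<bar> powr r \<partial>M) < 1" .
qed

text \<open>Convexity of the power at the mixture of \<open>s / (1 - \<epsilon>)\<close> and
  \<open>t / \<epsilon>\<close>. As \<epsilon> tends to 0 the factor of \<open>s powr p\<close>
  tends to 1, which preserves the contraction in \<open>w_drift\<close>.\<close>

lemma powr_add_convex:
  fixes s t \<epsilon> p :: real
  assumes "0 \<le> s" "0 \<le> t" "0 < \<epsilon>" "\<epsilon> < 1" "1 \<le> p"
  shows "(s + t) powr p \<le> (1 - \<epsilon>) powr (1 - p) * s powr p + \<epsilon> powr (1 - p) * t powr p"
proof (cases "s = 0 \<or> t = 0")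
  case True
  have "1 \<le> c powr (1 - p)" if "0 < c" "c \<le> 1" for c
    using that assms powr_mono'[of "1 - p" 0 c] by simp
  then have "s powr p \<le> (1-\<epsilon>) powr (1-p) * s powr p" "t powr p \<le> \<epsilon> powr (1-p) * t powr p"
    using assms by (simp_all add: mult_le_cancel_right1)
  with True show ?thesis using assms by auto
next
  case False
  have "((1-\<epsilon>) * (s/(1-\<epsilon>)) + \<epsilon> * (t/\<epsilon>)) powr p \<le> (1-\<epsilon>) * (s/(1-\<epsilon>)) powr p + \<epsilon> * (t/\<epsilon>) powr p"
    using convex_onD[OF powr_convex, of p \<epsilon> "s/(1-\<epsilon>)" "t/\<epsilon>"] assms False by simp
  then show ?thesis using assms by (simp add: powr_divide powr_diff)
qed

definition killed :: "(real \<Rightarrow> real \<Rightarrow> real) \<Rightarrow> real \<Rightarrow> real \<Rightarrow> real" where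
  "killed f = (\<lambda>x y. if 0 < y then f x y else 0)"

text \<open>The law of one pair with a working exponent. The cap at 3 makes \<open>p - 2\<close> an
  admissible Hoelder exponent for second derivatives; a larger moment reduces to this case by
  \<open>lower_moment\<close>.\<close>

locale affine_law = prob_space \<mu> for \<mu> :: "(real \<times> real) measure" +
  fixes p :: real
  assumes sets_mu [measurable_cong, simp]: "sets \<mu> = sets borel"
    and p_gt: "2 < p" and p_le: "p \<le> 3"
    and int_a: "integrable \<mu> (\<lambda>w. \<bar>fst w\<bar> powr p)"
    and a_lt: "(\<integral>w. \<bar>fst w\<bar> powr p \<partial>\<mu>) < 1"
    and int_b: "integrable \<mu> (\<lambda>w. \<bar>snd w\<bar> powr p)"
    and mean_b: "(\<integral>w. snd w \<partial>\<mu>) = 0"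
    and var_b: "0 < (\<integral>w. (snd w)\<^sup>2 \<partial>\<mu>)"
begin

text \<open>The class of functions on which the operators act without further integrability
  questions: growth of order \<open>p\<close> is what the moments of the pair allow, and the class
  is stable under sums, killing and transition.\<close>

definition tame :: "(real \<Rightarrow> real \<Rightarrow> real) \<Rightarrow> bool" where
  "tame f \<longleftrightarrow> (\<lambda>z. f (fst z) (snd z)) \<in> borel_measurable borel \<and>
     (\<exists>C\<ge>0. \<forall>x y. \<bar>f x y\<bar> \<le> C * (1 + \<bar>x\<bar> + \<bar>y\<bar>) powr p)"

definition trans_op :: "(real \<Rightarrow> real \<Rightarrow> real) \<Rightarrow> real \<Rightarrow> real \<Rightarrow> real" where
  "trans_op f x y = (\<integral>w. f (fst w * x + snd w) (y + (fst w * x + snd w)) \<partial>\<mu>)"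

text \<open>Killing tests the landing point and not the starting point. This is why comparisons of
  iterates below are stated from \<open>0 < y\<close>: the zeroth iterate is the function
  itself.\<close>

definition kill_op :: "(real \<Rightarrow> real \<Rightarrow> real) \<Rightarrow> real \<Rightarrow> real \<Rightarrow> real" where
  "kill_op f = trans_op (killed f)"

lemma space_mu [simp]: "space \<mu> = UNIV"
  using sets_eq_imp_space_eq[OF sets_mu] by simp

lemma meas_fst [measurable]: "fst \<in> borel_measurable \<mu>" and meas_snd [measurable]: "snd \<in> borel_measurable \<mu>"
  by (simp_all add: measurable_cong_sets[OF sets_mu refl] borel_prod[symmetric])

end

section \<open>The killed transition operator\<close>

lemma powr_sum3_le:
  fixes s t p :: real
  assumes "0 \<le> s" "0 \<le> t" "0 \<le> p"
  shows "(1 + s + t) powr p \<le> 3 powr p * (1 + s powr p + t powr p)"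
proof -
  define u where "u = max 1 (max s t)"
  have "(1 + s + t) powr p \<le> (3 * u) powr p"
    using assms by (intro powr_mono2) (auto simp: u_def)
  also have "\<dots> = 3 powr p * u powr p"
    by (simp add: powr_mult u_def)
  also have "u powr p \<le> 1 + s powr p + t powr p"
    using assms by (auto simp: u_def max_def)
  finally show ?thesis by simp
qed

lemma killed_add: "killed (\<lambda>x y. f x y + g x y) = (\<lambda>x y. killed f x y + killed g x y)"
  and killed_cmult: "killed (\<lambda>x y. c * f x y) = (\<lambda>x y. c * killed f x y)"
  by (intro ext; simp add: killed_def)+

text \<open>Submultiplicativity of the weight: state and coefficients separate into two factors.
  This propagates moments of order \<open>p\<close>, for the operator in \<open>next_bound\<close>
  and, by independence, for the walk in \<open>weight_integrable\<close>.\<close>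

lemma next_weight_le:
  "1 + \<bar>a * x + b\<bar> + \<bar>y + (a * x + b)\<bar> \<le> 2 * (1 + \<bar>x\<bar> + \<bar>y\<bar>) * (1 + \<bar>a\<bar> + \<bar>b\<bar>)" for a b x y :: real
proof -
  have "\<bar>a * x + b\<bar> \<le> \<bar>a\<bar> * \<bar>x\<bar> + \<bar>b\<bar>" by (metis abs_mult abs_triangle_ineq)
  moreover have "\<bar>y + (a * x + b)\<bar> \<le> \<bar>y\<bar> + \<bar>a * x + b\<bar>" by simp
  moreover have "0 \<le> \<bar>a\<bar> * \<bar>y\<bar>" "0 \<le> \<bar>b\<bar> * \<bar>y\<bar>" "0 \<le> \<bar>b\<bar> * \<bar>x\<bar>" by simp_all
  moreover have "2 * (1 + \<bar>x\<bar> + \<bar>y\<bar>) * (1 + \<bar>a\<bar> + \<bar>b\<bar>) = 2 + 2 * \<bar>a\<bar> + 2 * \<bar>b\<bar> + 2 * \<bar>x\<bar> + 2 * \<bar>y\<bar>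
      + 2 * (\<bar>a\<bar> * \<bar>x\<bar>) + 2 * (\<bar>a\<bar> * \<bar>y\<bar>) + 2 * (\<bar>b\<bar> * \<bar>x\<bar>) + 2 * (\<bar>b\<bar> * \<bar>y\<bar>)"
    by (simp add: algebra_simps)
  moreover have "0 \<le> \<bar>a\<bar> * \<bar>x\<bar>" by simp
  ultimately show ?thesis by linarith
qed

lemma borel_fst [measurable]: "(fst :: real \<times> real \<Rightarrow> real) \<in> borel_measurable borel"
  and borel_snd [measurable]: "(snd :: real \<times> real \<Rightarrow> real) \<in> borel_measurable borel"
  by (simp_all add: borel_prod[symmetric])

context affine_law begin

lemma prob_UNIV [simp]: "prob UNIV = 1"
  using prob_space by simp

definition K0 :: real where "K0 = (\<integral>w. (1 + \<bar>fst w\<bar> + \<bar>snd w\<bar>) powr p \<partial>\<mu>)"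

lemma integrable_weight: "integrable \<mu> (\<lambda>w. (1 + \<bar>fst w\<bar> + \<bar>snd w\<bar>) powr p)"
proof (rule Bochner_Integration.integrable_bound)
  show "integrable \<mu> (\<lambda>w. 3 powr p * (1 + \<bar>fst w\<bar> powr p + \<bar>snd w\<bar> powr p))"
    using int_a int_b by simp
  show "AE w in \<mu>. norm ((1 + \<bar>fst w\<bar> + \<bar>snd w\<bar>) powr p)
     \<le> norm (3 powr p * (1 + \<bar>fst w\<bar> powr p + \<bar>snd w\<bar> powr p))"
    using powr_sum3_le[of "\<bar>fst _\<bar>" "\<bar>snd _\<bar>" p] p_gt by (intro AE_I2) (auto simp: add_nonneg_nonneg)
qed measurable

lemma K0_ge: "1 \<le> K0"
proof -
  have "(\<integral>w. 1 \<partial>\<mu>) \<le> K0"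
    unfolding K0_def by (intro integral_mono integrable_weight)
      (use p_gt in \<open>auto intro!: ge_one_powr_ge_zero\<close>)
  then show ?thesis by simp
qed

lemma tame_comp:
  assumes "tame f" "u \<in> borel_measurable N" "v \<in> borel_measurable N"
  shows "(\<lambda>z. f (u z) (v z)) \<in> borel_measurable N"
proof -
  have "(\<lambda>z. f (fst z) (snd z)) \<in> borel_measurable (borel \<Otimes>\<^sub>M borel)"
    using assms(1) by (simp add: tame_def borel_prod)
  from measurable_compose[OF measurable_Pair[OF assms(2,3)] this] show ?thesis by simp
qed

lemma tameE:
  assumes "tame f"
  obtains C where "C \<ge> 0" "\<And>x y. \<bar>f x y\<bar> \<le> C * (1 + \<bar>x\<bar> + \<bar>y\<bar>) powr p"
  using assms by (auto simp: tame_def)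

lemma tameI:
  assumes "(\<lambda>z. f (fst z) (snd z)) \<in> borel_measurable borel"
    and "\<And>x y. \<bar>f x y\<bar> \<le> C * (1 + \<bar>x\<bar> + \<bar>y\<bar>) powr p"
  shows "tame f"
proof -
  have "\<bar>f x y\<bar> \<le> \<bar>C\<bar> * (1 + \<bar>x\<bar> + \<bar>y\<bar>) powr p" for x y
    using assms(2)[of x y] mult_right_mono[of C "\<bar>C\<bar>" "(1 + \<bar>x\<bar> + \<bar>y\<bar>) powr p"]
    by (meson abs_ge_self order_trans powr_ge_zero)
  then show ?thesis using assms(1) unfolding tame_def by (intro conjI exI[of _ "\<bar>C\<bar>"]) auto
qed

lemma tame_quadratic:
  assumes "(\<lambda>z. f (fst z) (snd z)) \<in> borel_measurable borel"
    and "\<And>x y. \<bar>f x y\<bar> \<le> C * (1 + \<bar>x\<bar> + \<bar>y\<bar>)\<^sup>2"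
  shows "tame f"
proof (rule tameI[where C = "\<bar>C\<bar>"])
  fix x y :: real
  have "(1 + \<bar>x\<bar> + \<bar>y\<bar>)\<^sup>2 = (1 + \<bar>x\<bar> + \<bar>y\<bar>) powr 2" by (rule powr_numeral[symmetric]) simp
  also have "\<dots> \<le> (1 + \<bar>x\<bar> + \<bar>y\<bar>) powr p" using p_gt by (intro powr_mono) auto
  finally have "\<bar>C\<bar> * (1 + \<bar>x\<bar> + \<bar>y\<bar>)\<^sup>2 \<le> \<bar>C\<bar> * (1 + \<bar>x\<bar> + \<bar>y\<bar>) powr p"
    by (intro mult_left_mono) auto
  moreover have "C * (1 + \<bar>x\<bar> + \<bar>y\<bar>)\<^sup>2 \<le> \<bar>C\<bar> * (1 + \<bar>x\<bar> + \<bar>y\<bar>)\<^sup>2" by (intro mult_right_mono) auto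
  ultimately show "\<bar>f x y\<bar> \<le> \<bar>C\<bar> * (1 + \<bar>x\<bar> + \<bar>y\<bar>) powr p"
    using assms(2)[of x y] by linarith
qed (rule assms(1))

lemma tame_linear:
  assumes "(\<lambda>z. f (fst z) (snd z)) \<in> borel_measurable borel"
    and "\<And>x y. \<bar>f x y\<bar> \<le> C * (1 + \<bar>x\<bar> + \<bar>y\<bar>)"
  shows "tame f"
proof (rule tame_quadratic[where C = "\<bar>C\<bar>"])
  fix x y :: real
  have "(1 + \<bar>x\<bar> + \<bar>y\<bar>) * 1 \<le> (1 + \<bar>x\<bar> + \<bar>y\<bar>) * (1 + \<bar>x\<bar> + \<bar>y\<bar>)" by (intro mult_left_mono) auto
  then have "\<bar>C\<bar> * (1 + \<bar>x\<bar> + \<bar>y\<bar>) \<le> \<bar>C\<bar> * (1 + \<bar>x\<bar> + \<bar>y\<bar>)\<^sup>2"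
    by (intro mult_left_mono) (auto simp: power2_eq_square)
  moreover have "C * (1 + \<bar>x\<bar> + \<bar>y\<bar>) \<le> \<bar>C\<bar> * (1 + \<bar>x\<bar> + \<bar>y\<bar>)" by (intro mult_right_mono) auto
  ultimately show "\<bar>f x y\<bar> \<le> \<bar>C\<bar> * (1 + \<bar>x\<bar> + \<bar>y\<bar>)\<^sup>2"
    using assms(2)[of x y] by linarith
qed (rule assms(1))

lemma tame_add [intro]: assumes "tame f" "tame g" shows "tame (\<lambda>x y. f x y + g x y)"
proof -
  obtain C where C: "C \<ge> 0" "\<And>x y. \<bar>f x y\<bar> \<le> C * (1 + \<bar>x\<bar> + \<bar>y\<bar>) powr p" using tameE[OF assms(1)] by metis
  obtain D where D: "D \<ge> 0" "\<And>x y. \<bar>g x y\<bar> \<le> D * (1 + \<bar>x\<bar> + \<bar>y\<bar>) powr p" using tameE[OF assms(2)] by metis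
  show ?thesis
  proof (rule tameI)
    show "(\<lambda>z. f (fst z) (snd z) + g (fst z) (snd z)) \<in> borel_measurable borel"
      using assms by (auto simp: tame_def)
    show "\<bar>f x y + g x y\<bar> \<le> (C + D) * (1 + \<bar>x\<bar> + \<bar>y\<bar>) powr p" for x y
      using C(2)[of x y] D(2)[of x y] unfolding distrib_right by linarith
  qed
qed

lemma tame_cmult [intro]: assumes "tame f" shows "tame (\<lambda>x y. c * f x y)"
proof -
  obtain C where C: "C \<ge> 0" "\<And>x y. \<bar>f x y\<bar> \<le> C * (1 + \<bar>x\<bar> + \<bar>y\<bar>) powr p" using tameE[OF assms(1)] by metis
  show ?thesis
  proof (rule tameI)
    show "(\<lambda>z. c * f (fst z) (snd z)) \<in> borel_measurable borel"
      using assms by (auto simp: tame_def)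
    show "\<bar>c * f x y\<bar> \<le> (\<bar>c\<bar> * C) * (1 + \<bar>x\<bar> + \<bar>y\<bar>) powr p" for x y
      using mult_left_mono[OF C(2)[of x y], of "\<bar>c\<bar>"] by (simp add: abs_mult mult.assoc)
  qed
qed

lemma tame_diff [intro]: assumes "tame f" "tame g" shows "tame (\<lambda>x y. f x y - g x y)"
  using tame_add[OF assms(1) tame_cmult[OF assms(2), of "-1"]] by simp

lemma tame_const [intro]: "tame (\<lambda>x y. c)"
  by (rule tame_linear[where C = "\<bar>c\<bar>"]) (auto simp: mult_le_cancel_left1)

lemma tame_sum: "(\<And>i. i \<in> I \<Longrightarrow> tame (f i)) \<Longrightarrow> tame (\<lambda>x y. \<Sum>i\<in>I. f i x y)"
  by (induction I rule: infinite_finite_induct) auto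

lemma tame_killed [intro]: assumes "tame f" shows "tame (killed f)"
proof -
  obtain C where C: "C \<ge> 0" "\<And>x y. \<bar>f x y\<bar> \<le> C * (1 + \<bar>x\<bar> + \<bar>y\<bar>) powr p" using tameE[OF assms(1)] by metis
  show ?thesis
  proof (rule tameI)
    have [measurable]: "(\<lambda>z. f (fst z) (snd z)) \<in> borel_measurable borel" using assms by (simp add: tame_def)
    show "(\<lambda>z. killed f (fst z) (snd z)) \<in> borel_measurable borel"
      unfolding killed_def by measurable
    show "\<bar>killed f x y\<bar> \<le> C * (1 + \<bar>x\<bar> + \<bar>y\<bar>) powr p" for x y
      by (rule order_trans[OF _ C(2)]) (simp add: killed_def)
  qed
qed

lemma next_bound:
  assumes "\<And>x y. \<bar>f x y\<bar> \<le> C * (1 + \<bar>x\<bar> + \<bar>y\<bar>) powr p" "C \<ge> 0"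
  shows "\<bar>f (a * x + b) (y + (a * x + b))\<bar>
     \<le> C * 2 powr p * (1 + \<bar>x\<bar> + \<bar>y\<bar>) powr p * (1 + \<bar>a\<bar> + \<bar>b\<bar>) powr p"
proof -
  have "\<bar>f (a * x + b) (y + (a * x + b))\<bar> \<le> C * (1 + \<bar>a * x + b\<bar> + \<bar>y + (a * x + b)\<bar>) powr p" by fact
  also have "\<dots> \<le> C * (2 * (1 + \<bar>x\<bar> + \<bar>y\<bar>) * (1 + \<bar>a\<bar> + \<bar>b\<bar>)) powr p"
    using next_weight_le[of a x b y] p_gt assms(2) by (intro mult_left_mono powr_mono2) auto
  also have "\<dots> = C * 2 powr p * (1 + \<bar>x\<bar> + \<bar>y\<bar>) powr p * (1 + \<bar>a\<bar> + \<bar>b\<bar>) powr p"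
    by (simp only: powr_mult mult.assoc)
  finally show ?thesis .
qed

lemma tame_integrable:
  assumes "tame f"
  shows "integrable \<mu> (\<lambda>w. f (fst w * x + snd w) (y + (fst w * x + snd w)))"
proof -
  obtain C where C: "C \<ge> 0" "\<And>x y. \<bar>f x y\<bar> \<le> C * (1 + \<bar>x\<bar> + \<bar>y\<bar>) powr p" using tameE[OF assms(1)] by metis
  show ?thesis
  proof (rule Bochner_Integration.integrable_bound)
    show "integrable \<mu> (\<lambda>w. C * 2 powr p * (1 + \<bar>x\<bar> + \<bar>y\<bar>) powr p * (1 + \<bar>fst w\<bar> + \<bar>snd w\<bar>) powr p)"
      by (intro integrable_mult_right integrable_weight)
    show "(\<lambda>w. f (fst w * x + snd w) (y + (fst w * x + snd w))) \<in> borel_measurable \<mu>"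
      by (rule tame_comp[OF assms]) measurable
    show "AE w in \<mu>. norm (f (fst w * x + snd w) (y + (fst w * x + snd w)))
      \<le> norm (C * 2 powr p * (1 + \<bar>x\<bar> + \<bar>y\<bar>) powr p * (1 + \<bar>fst w\<bar> + \<bar>snd w\<bar>) powr p)"
      using next_bound[of f C, OF C(2,1)] C(1) by (intro AE_I2) (simp add: abs_mult)
  qed
qed

lemma tame_trans [intro]: assumes "tame f" shows "tame (trans_op f)"
proof -
  obtain C where C: "C \<ge> 0" "\<And>x y. \<bar>f x y\<bar> \<le> C * (1 + \<bar>x\<bar> + \<bar>y\<bar>) powr p" using tameE[OF assms(1)] by metis
  show ?thesis
  proof (rule tameI)
    have [measurable]: "(\<lambda>q. f (fst (snd q) * fst (fst q) + snd (snd q))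
         (snd (fst q) + (fst (snd q) * fst (fst q) + snd (snd q)))) \<in> borel_measurable (borel \<Otimes>\<^sub>M \<mu>)"
      by (rule tame_comp[OF assms]) measurable
    show "(\<lambda>z. trans_op f (fst z) (snd z)) \<in> borel_measurable borel"
      unfolding trans_op_def
      by (rule borel_measurable_lebesgue_integral) (simp add: case_prod_beta)
    fix x y
    have "\<bar>trans_op f x y\<bar> \<le> (\<integral>w. \<bar>f (fst w * x + snd w) (y + (fst w * x + snd w))\<bar> \<partial>\<mu>)"
      unfolding trans_op_def by (rule integral_abs_bound)
    also have "\<dots> \<le> (\<integral>w. C * 2 powr p * (1 + \<bar>x\<bar> + \<bar>y\<bar>) powr p * (1 + \<bar>fst w\<bar> + \<bar>snd w\<bar>) powr p \<partial>\<mu>)"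
      by (intro integral_mono integrable_abs tame_integrable assms integrable_mult_right integrable_weight
           next_bound C)
    also have "\<dots> = C * 2 powr p * K0 * (1 + \<bar>x\<bar> + \<bar>y\<bar>) powr p"
      by (simp add: K0_def)
    finally show "\<bar>trans_op f x y\<bar> \<le> C * 2 powr p * K0 * (1 + \<bar>x\<bar> + \<bar>y\<bar>) powr p" .
  qed
qed

lemma tame_kill [intro]: "tame f \<Longrightarrow> tame (kill_op f)"
  unfolding kill_op_def by blast

lemma tame_kill_pow [intro]: "tame f \<Longrightarrow> tame ((kill_op ^^ n) f)"
  by (induction n) auto

lemma trans_add: "tame f \<Longrightarrow> tame g \<Longrightarrow> trans_op (\<lambda>x y. f x y + g x y) = (\<lambda>x y. trans_op f x y + trans_op g x y)"
  unfolding trans_op_def by (intro ext Bochner_Integration.integral_add tame_integrable)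

lemma trans_diff: "tame f \<Longrightarrow> tame g \<Longrightarrow> trans_op (\<lambda>x y. f x y - g x y) = (\<lambda>x y. trans_op f x y - trans_op g x y)"
  unfolding trans_op_def by (intro ext Bochner_Integration.integral_diff tame_integrable)

lemma trans_cmult: "trans_op (\<lambda>x y. c * f x y) = (\<lambda>x y. c * trans_op f x y)"
  unfolding trans_op_def by simp

lemma trans_const: "trans_op (\<lambda>x y. c) = (\<lambda>x y. c)"
  unfolding trans_op_def by simp

lemma trans_mono:
  assumes "tame f" "tame g" "\<And>x1. f x1 (y + x1) \<le> g x1 (y + x1)"
  shows "trans_op f x y \<le> trans_op g x y"
  unfolding trans_op_def by (intro integral_mono tame_integrable assms)

lemma kill_add: "tame f \<Longrightarrow> tame g \<Longrightarrow> kill_op (\<lambda>x y. f x y + g x y) = (\<lambda>x y. kill_op f x y + kill_op g x y)"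
  unfolding kill_op_def killed_add by (intro trans_add tame_killed)

lemma kill_cmult: "kill_op (\<lambda>x y. c * f x y) = (\<lambda>x y. c * kill_op f x y)"
  unfolding kill_op_def killed_cmult by (rule trans_cmult)

lemma kill_mono:
  assumes "tame f" "tame g" "\<And>x y. 0 < y \<Longrightarrow> f x y \<le> g x y"
  shows "kill_op f x y \<le> kill_op g x y"
  unfolding kill_op_def by (intro trans_mono tame_killed assms) (auto simp: killed_def assms)

lemma kill_pow_add:
  assumes "tame f" "tame g"
  shows "(kill_op ^^ n) (\<lambda>x y. f x y + g x y) = (\<lambda>x y. (kill_op ^^ n) f x y + (kill_op ^^ n) g x y)"
  by (induction n) (simp_all add: kill_add tame_kill_pow assms)

lemma kill_pow_cmult: "(kill_op ^^ n) (\<lambda>x y. c * f x y) = (\<lambda>x y. c * (kill_op ^^ n) f x y)"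
  by (induction n) (simp_all add: kill_cmult)

lemma kill_pow_diff:
  assumes "tame f" "tame g"
  shows "(kill_op ^^ n) (\<lambda>x y. f x y - g x y) = (\<lambda>x y. (kill_op ^^ n) f x y - (kill_op ^^ n) g x y)"
  using kill_pow_add[OF assms(1) tame_cmult[OF assms(2), of "-1"]] kill_pow_cmult[of n "-1" g] by simp

lemma kill_pow_mono:
  assumes "tame f" "tame g" "\<And>x y. 0 < y \<Longrightarrow> f x y \<le> g x y" "0 < y"
  shows "(kill_op ^^ n) f x y \<le> (kill_op ^^ n) g x y"
  using assms(4)
proof (induction n arbitrary: x y)
  case (Suc n)
  then show ?case using assms by (simp add: kill_mono tame_kill_pow)
qed (use assms in auto)

lemma kill_pow_pow: "(kill_op ^^ (m + n)) f = (kill_op ^^ m) ((kill_op ^^ n) f)"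
  by (simp add: funpow_add)

lemma kill_pow_Suc: "(kill_op ^^ Suc n) f = (kill_op ^^ n) (kill_op f)"
  by (simp add: funpow_swap1)

lemma kill_pow_zero: "(kill_op ^^ n) (\<lambda>x y. 0) = (\<lambda>x y. 0)"
  using kill_pow_cmult[of n 0 "\<lambda>x y. 0"] by simp

lemma kill_pow_nonneg:
  assumes "tame f" "\<And>x y. 0 < y \<Longrightarrow> 0 \<le> f x y" "0 < y"
  shows "0 \<le> (kill_op ^^ n) f x y"
  using kill_pow_mono[of "\<lambda>x y. 0" f y n x] assms by (simp add: kill_pow_zero tame_const)

lemma kill_pow_abs_le:
  assumes "tame f" "tame g" "\<And>x y. 0 < y \<Longrightarrow> \<bar>f x y\<bar> \<le> g x y" "0 < y"
  shows "\<bar>(kill_op ^^ n) f x y\<bar> \<le> (kill_op ^^ n) g x y"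
proof -
  have "(kill_op ^^ n) f x y \<le> (kill_op ^^ n) g x y"
    using assms(3) by (intro kill_pow_mono[OF assms(1,2) _ assms(4)]) (metis abs_le_D1)
  moreover have "(kill_op ^^ n) (\<lambda>x y. -1 * f x y) x y \<le> (kill_op ^^ n) g x y"
    using assms(3) by (intro kill_pow_mono[OF tame_cmult[OF assms(1)] assms(2) _ assms(4)]) (simp add: abs_le_iff)
  ultimately show ?thesis unfolding kill_pow_cmult by linarith
qed

lemma kill_pow_const: "(kill_op ^^ n) (\<lambda>x y. c) = (\<lambda>x y. c * (kill_op ^^ n) (\<lambda>x y. 1) x y)"
  using kill_pow_cmult[of n c "\<lambda>x y. 1"] by simp

lemma kill_one_le: "kill_op (\<lambda>x y. 1) x y \<le> 1"
proof -
  have "kill_op (\<lambda>x y. 1) x y \<le> trans_op (\<lambda>x y. 1) x y"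
    unfolding kill_op_def by (intro trans_mono tame_killed tame_const) (auto simp: killed_def)
  then show ?thesis by (simp add: trans_const)
qed

lemma kill_le_trans:
  assumes "tame f" "\<And>x y. 0 \<le> f x y" shows "kill_op f x y \<le> trans_op f x y"
  unfolding kill_op_def by (intro trans_mono tame_killed assms) (auto simp: killed_def assms)

lemma kill_eq_trans_diff:
  assumes "tame f"
  shows "kill_op f x y = trans_op f x y - trans_op (\<lambda>x y. if 0 < y then 0 else f x y) x y"
proof -
  have *: "(\<lambda>x y. if 0 < y then 0 else f x y) = (\<lambda>x y. f x y - killed f x y)"
    by (intro ext) (simp add: killed_def)
  show ?thesis unfolding * kill_op_def using trans_diff[OF assms tame_killed[OF assms]] by simp
qed

section \<open>Drift and overshoot estimates\<close>

lemma dominated_by_weight: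
  assumes "f \<in> borel_measurable \<mu>" "\<And>w. \<bar>f w\<bar> \<le> C * (1 + \<bar>fst w\<bar> + \<bar>snd w\<bar>) powr p"
  shows "integrable \<mu> f"
proof (rule Bochner_Integration.integrable_bound)
  show "integrable \<mu> (\<lambda>w. C * (1 + \<bar>fst w\<bar> + \<bar>snd w\<bar>) powr p)"
    by (intro integrable_mult_right integrable_weight)
  show "AE w in \<mu>. norm (f w) \<le> norm (C * (1 + \<bar>fst w\<bar> + \<bar>snd w\<bar>) powr p)"
  proof (rule AE_I2)
    fix w show "norm (f w) \<le> norm (C * (1 + \<bar>fst w\<bar> + \<bar>snd w\<bar>) powr p)"
      using assms(2)[of w] by (metis abs_ge_self order_trans real_norm_def)
  qed
qed (rule assms(1))

lemma weight_ge:
  "1 \<le> (1 + \<bar>s\<bar> + \<bar>t\<bar>) powr p" "\<bar>s\<bar> \<le> (1 + \<bar>s\<bar> + \<bar>t\<bar>) powr p" "\<bar>t\<bar> \<le> (1 + \<bar>s\<bar> + \<bar>t\<bar>) powr p"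
  "s\<^sup>2 \<le> (1 + \<bar>s\<bar> + \<bar>t\<bar>) powr p" "t\<^sup>2 \<le> (1 + \<bar>s\<bar> + \<bar>t\<bar>) powr p" "\<bar>s * t\<bar> \<le> (1 + \<bar>s\<bar> + \<bar>t\<bar>) powr p" for s t :: real
proof -
  define u where "u = 1 + \<bar>s\<bar> + \<bar>t\<bar>"
  have u: "1 \<le> u" "\<bar>s\<bar> \<le> u" "\<bar>t\<bar> \<le> u" by (auto simp: u_def)
  have "u\<^sup>2 = u powr 2" using u by (intro powr_numeral[symmetric]) simp
  also have "\<dots> \<le> u powr p" using p_gt u by (intro powr_mono) auto
  finally have heat: "u\<^sup>2 \<le> u powr p" .
  have "u * 1 \<le> u * u" "1 * 1 \<le> u * u" "\<bar>s\<bar> * \<bar>t\<bar> \<le> u * u" "\<bar>s\<bar> * \<bar>s\<bar> \<le> u * u" "\<bar>t\<bar> * \<bar>t\<bar> \<le> u * u"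
    using u by (intro mult_mono; simp)+
  then have "1 \<le> u powr p \<and> \<bar>s\<bar> \<le> u powr p \<and> \<bar>t\<bar> \<le> u powr p \<and> s\<^sup>2 \<le> u powr p \<and> t\<^sup>2 \<le> u powr p \<and> \<bar>s * t\<bar> \<le> u powr p"
    using heat u abs_mult_self_eq[of s] abs_mult_self_eq[of t] unfolding power2_eq_square abs_mult
    by (intro conjI; linarith)
  then show "1 \<le> (1 + \<bar>s\<bar> + \<bar>t\<bar>) powr p" "\<bar>s\<bar> \<le> (1 + \<bar>s\<bar> + \<bar>t\<bar>) powr p" "\<bar>t\<bar> \<le> (1 + \<bar>s\<bar> + \<bar>t\<bar>) powr p"
  "s\<^sup>2 \<le> (1 + \<bar>s\<bar> + \<bar>t\<bar>) powr p" "t\<^sup>2 \<le> (1 + \<bar>s\<bar> + \<bar>t\<bar>) powr p" "\<bar>s * t\<bar> \<le> (1 + \<bar>s\<bar> + \<bar>t\<bar>) powr p"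
    by (simp_all add: u_def)
qed

lemma integrable_moments [simp]:
  "integrable \<mu> (\<lambda>w. fst w)" "integrable \<mu> (\<lambda>w. snd w)"
  "integrable \<mu> (\<lambda>w. (fst w)\<^sup>2)" "integrable \<mu> (\<lambda>w. (snd w)\<^sup>2)" "integrable \<mu> (\<lambda>w. fst w * snd w)"
  by (rule dominated_by_weight[where C = 1]; use weight_ge in simp)+

definition m :: real where "m = (\<integral>w. fst w \<partial>\<mu>)"
definition a1 :: real where "a1 = (\<integral>w. \<bar>fst w\<bar> \<partial>\<mu>)"
definition m2 :: real where "m2 = (\<integral>w. (fst w)\<^sup>2 \<partial>\<mu>)"
definition cab :: real where "cab = (\<integral>w. fst w * snd w \<partial>\<mu>)"
definition b2 :: real where "b2 = (\<integral>w. (snd w)\<^sup>2 \<partial>\<mu>)"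
definition \<rho> :: real where "\<rho> = m / (1 - m)"
definition v :: real where "v = b2 / (1 - m2) * ((1 + m) / (1 - m))"

lemma l1_lt: "a1 < 1" and m2_lt: "m2 < 1"
proof -
  show "a1 < 1" "m2 < 1"
    using lower_moment(2)[OF meas_fst int_a _ _ a_lt, of 1] lower_moment(2)[OF meas_fst int_a _ _ a_lt, of 2] p_gt
    by (simp_all add: a1_def m2_def)
qed

lemma l1_nonneg: "0 \<le> a1" by (simp add: a1_def)

lemma m_bounds: "-1 < m" "m < 1"
proof -
  have "\<bar>m\<bar> \<le> a1" unfolding m_def a1_def by (rule integral_abs_bound)
  with l1_lt show "-1 < m" "m < 1" by linarith+
qed

lemma b2_pos: "0 < b2" using var_b by (simp add: b2_def)

lemma v_pos: "0 < v"
  using m_bounds m2_lt b2_pos by (simp add: v_def)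

lemma quadratic_integral:
  "(\<integral>w. c * (fst w * x + snd w)\<^sup>2 + d * (fst w * x + snd w) + e \<partial>\<mu>)
    = c * (m2 * x\<^sup>2 + 2 * cab * x + b2) + d * (m * x) + e"
proof -
  have "(\<integral>w. c * (fst w * x + snd w)\<^sup>2 + d * (fst w * x + snd w) + e \<partial>\<mu>)
    = (\<integral>w. (c * x\<^sup>2) * (fst w)\<^sup>2 + (2 * c * x) * (fst w * snd w) + c * (snd w)\<^sup>2
         + (d * x) * fst w + d * snd w + e \<partial>\<mu>)"
    by (intro Bochner_Integration.integral_cong refl) (simp add: power2_eq_square algebra_simps)
  also have "\<dots> = (c * x\<^sup>2) * m2 + (2 * c * x) * cab + c * b2 + (d * x) * m + d * 0 + e"
    by (simp add: m_def m2_def cab_def b2_def mean_b)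
  finally show ?thesis by (simp add: algebra_simps)
qed

lemma quadratic_integrable [simp]:
  "integrable \<mu> (\<lambda>w. (fst w * x + snd w)\<^sup>2)" "integrable \<mu> (\<lambda>w. fst w * x + snd w)"
proof -
  have *: "(\<lambda>w. (fst w * x + snd w)\<^sup>2) = (\<lambda>w. x\<^sup>2 * (fst w)\<^sup>2 + (2 * x) * (fst w * snd w) + (snd w)\<^sup>2)"
    by (auto simp: fun_eq_iff power2_eq_square algebra_simps)
  show "integrable \<mu> (\<lambda>w. (fst w * x + snd w)\<^sup>2)" unfolding * by simp
qed simp

text \<open>Foster-Lyapunov iteration: the additive constants form a geometric series, since the
  total mass never exceeds 1.\<close>

lemma kill_pow_drift:
  assumes V: "tame V" and l: "0 \<le> l" "l < 1" and C: "0 \<le> C"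
    and d: "\<And>x y. 0 < y \<Longrightarrow> kill_op V x y \<le> l * V x y + C" and y: "0 < y"
  shows "(kill_op ^^ n) V x y \<le> l ^ n * V x y + C / (1 - l)"
proof (induction n)
  case 0 then show ?case using l C by simp
next
  case (Suc n)
  \<comment> \<open>Proved here because \<open>kill_pow_one_le\<close> is itself derived from this
    lemma.\<close>
  have D1: "(kill_op ^^ n) (\<lambda>x y. 1) x y \<le> 1"
  proof (induction n)
    case (Suc n)
    have "(kill_op ^^ Suc n) (\<lambda>x y. 1) x y \<le> (kill_op ^^ n) (\<lambda>x y. 1) x y"
      unfolding kill_pow_Suc by (intro kill_pow_mono tame_kill tame_const kill_one_le y)
    with Suc show ?case by linarith
  qed simp
  have "(kill_op ^^ Suc n) V x y \<le> (kill_op ^^ n) (\<lambda>x y. l * V x y + C) x y"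
    unfolding kill_pow_Suc by (intro kill_pow_mono tame_kill tame_add tame_cmult tame_const V d y)
  also have "\<dots> = l * (kill_op ^^ n) V x y + C * (kill_op ^^ n) (\<lambda>x y. 1) x y"
    by (subst kill_pow_add) (auto simp: V kill_pow_cmult kill_pow_const[of _ C])
  also have "\<dots> \<le> l * (l ^ n * V x y + C / (1 - l)) + C * 1"
    using Suc l C D1 by (intro add_mono mult_left_mono) auto
  also have "\<dots> = l ^ Suc n * V x y + C / (1 - l)"
    using l by (simp add: field_simps)
  finally show ?case .
qed

lemma kill_pow_one_le: "0 < y \<Longrightarrow> (kill_op ^^ n) (\<lambda>x y. 1) x y \<le> 1"
  using kill_pow_drift[of "\<lambda>x y. 1" 0 1 y n x] kill_one_le by (cases n) (auto simp: tame_const)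

lemma kill_pow_one_nonneg: "0 < y \<Longrightarrow> 0 \<le> (kill_op ^^ n) (\<lambda>x y. 1) x y"
  by (intro kill_pow_nonneg) auto

lemma kill_pow_one_antimono:
  assumes "n \<le> k" "0 < y" shows "(kill_op ^^ k) (\<lambda>x y. 1) x y \<le> (kill_op ^^ n) (\<lambda>x y. 1) x y"
proof -
  obtain j where k: "k = n + j" using assms(1) le_iff_add by auto
  show ?thesis unfolding k kill_pow_pow
    by (intro kill_pow_mono tame_kill_pow tame_const kill_pow_one_le assms)
qed

text \<open>The drift estimate is applied only from time \<open>n\<close> on, so its constant is
  multiplied by the survival probability at time \<open>n\<close>. In this way decay of survival
  passes to moments on the survival event.\<close>

lemma kill_pow_drift_pow:
  assumes V: "tame V" and l: "0 \<le> l" "l < 1" and C: "0 \<le> C"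
    and d: "\<And>x y. 0 < y \<Longrightarrow> kill_op V x y \<le> l * V x y + C" and y: "0 < y"
  shows "(kill_op ^^ (n + k)) V x y \<le> l ^ k * (kill_op ^^ n) V x y + C / (1 - l) * (kill_op ^^ n) (\<lambda>x y. 1) x y"
proof -
  have "(kill_op ^^ (n + k)) V x y \<le> (kill_op ^^ n) (\<lambda>x y. l ^ k * V x y + C / (1 - l)) x y"
    unfolding kill_pow_pow
    by (intro kill_pow_mono tame_kill_pow tame_add tame_cmult tame_const V y kill_pow_drift[OF V l C d])
  also have "\<dots> = l ^ k * (kill_op ^^ n) V x y + C / (1 - l) * (kill_op ^^ n) (\<lambda>x y. 1) x y"
    by (subst kill_pow_add) (auto simp: V kill_pow_cmult kill_pow_const[of _ "C / (1-l)"])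
  finally show ?thesis .
qed

lemma tame_x: "tame (\<lambda>x y. x)" and tame_absx: "tame (\<lambda>x y. \<bar>x\<bar>)" and tame_y: "tame (\<lambda>x y. y)"
  and tame_x2: "tame (\<lambda>x y. x\<^sup>2)" and tame_y2: "tame (\<lambda>x y. y\<^sup>2)"
  and tame_z: "tame (\<lambda>x y. y + \<rho> * x)" and tame_z2: "tame (\<lambda>x y. (y + \<rho> * x)\<^sup>2)"
proof -
  show a: "tame (\<lambda>x y. x)" "tame (\<lambda>x y. \<bar>x\<bar>)" "tame (\<lambda>x y. y)"
    by (rule tame_linear[where C = 1]; simp)+
  then show "tame (\<lambda>x y. y + \<rho> * x)" by auto
  show "tame (\<lambda>x y. x\<^sup>2)" "tame (\<lambda>x y. y\<^sup>2)"
    by (rule tame_quadratic[where C = 1]; auto simp: abs_le_square_iff[symmetric])+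
  show "tame (\<lambda>x y. (y + \<rho> * x)\<^sup>2)"
  proof (rule tame_quadratic[where C = "(1 + \<bar>\<rho>\<bar>)\<^sup>2"])
    fix x y :: real
    have "\<bar>y + \<rho> * x\<bar> \<le> \<bar>y\<bar> + \<bar>\<rho>\<bar> * \<bar>x\<bar>" by (metis abs_mult abs_triangle_ineq)
    also have "\<dots> \<le> (1 + \<bar>\<rho>\<bar>) * (1 + \<bar>x\<bar> + \<bar>y\<bar>)" by (simp add: algebra_simps)
    finally have "\<bar>y + \<rho> * x\<bar>\<^sup>2 \<le> ((1 + \<bar>\<rho>\<bar>) * (1 + \<bar>x\<bar> + \<bar>y\<bar>))\<^sup>2" by (intro power_mono) auto
    then show "\<bar>(y + \<rho> * x)\<^sup>2\<bar> \<le> (1 + \<bar>\<rho>\<bar>)\<^sup>2 * (1 + \<bar>x\<bar> + \<bar>y\<bar>)\<^sup>2"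
      by (simp add: power_mult_distrib)
  qed measurable
qed

lemma tame_w: "tame (\<lambda>x y. (1 + \<bar>x\<bar>) powr p)"
proof (rule tameI[where C = 1])
  show "\<bar>(1 + \<bar>x\<bar>) powr p\<bar> \<le> 1 * (1 + \<bar>x\<bar> + \<bar>y\<bar>) powr p" for x y
    using p_gt by (simp add: powr_mono2)
qed measurable

lemma absx_drift:
  obtains C where "0 \<le> C" "\<And>x y. kill_op (\<lambda>x y. \<bar>x\<bar>) x y \<le> a1 * \<bar>x\<bar> + C"
proof
  show "0 \<le> (\<integral>w. \<bar>snd w\<bar> \<partial>\<mu>)" by simp
  fix x y
  have "kill_op (\<lambda>x y. \<bar>x\<bar>) x y \<le> trans_op (\<lambda>x y. \<bar>x\<bar>) x y" by (intro kill_le_trans tame_absx) simp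
  also have "\<dots> \<le> (\<integral>w. \<bar>x\<bar> * \<bar>fst w\<bar> + \<bar>snd w\<bar> \<partial>\<mu>)"
    unfolding trans_op_def
  proof (intro integral_mono)
    show "\<bar>fst w * x + snd w\<bar> \<le> \<bar>x\<bar> * \<bar>fst w\<bar> + \<bar>snd w\<bar>" for w :: "real \<times> real"
      by (metis abs_mult abs_triangle_ineq mult.commute)
  qed (auto intro!: integrable_abs)
  also have "\<dots> = a1 * \<bar>x\<bar> + (\<integral>w. \<bar>snd w\<bar> \<partial>\<mu>)"
    by (simp add: a1_def integrable_abs)
  finally show "kill_op (\<lambda>x y. \<bar>x\<bar>) x y \<le> a1 * \<bar>x\<bar> + (\<integral>w. \<bar>snd w\<bar> \<partial>\<mu>)" .
qed

lemma x2_drift: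
  obtains l C where "0 \<le> l" "l < 1" "0 \<le> C" "\<And>x y. kill_op (\<lambda>x y. x\<^sup>2) x y \<le> l * x\<^sup>2 + C"
proof
  have m20: "0 \<le> m2" by (simp add: m2_def)
  \<comment> \<open>Half of the gap \<open>1 - m2\<close> is spent on absorbing the cross term
    \<open>2 * cab * x\<close>, which is present because the two coefficients of a pair may be
    correlated.\<close>
  define e where "e = (1 - m2) / 2"
  have e: "e > 0" using m2_lt by (simp add: e_def)
  show "0 \<le> (1 + m2) / 2" "(1 + m2) / 2 < 1" using m20 m2_lt by auto
  show "0 \<le> cab\<^sup>2 / e + b2" using e b2_pos by simp
  fix x y
  have "kill_op (\<lambda>x y. x\<^sup>2) x y \<le> trans_op (\<lambda>x y. x\<^sup>2) x y" by (intro kill_le_trans tame_x2) simp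
  also have "\<dots> = m2 * x\<^sup>2 + 2 * cab * x + b2"
    using quadratic_integral[of 1 x 0 0] by (simp add: trans_op_def)
  also have "2 * cab * x \<le> e * x\<^sup>2 + cab\<^sup>2 / e"
  proof -
    have "0 \<le> (e * x - cab)\<^sup>2 / e" using e by simp
    also have "\<dots> = e * x\<^sup>2 - 2 * cab * x + cab\<^sup>2 / e"
      using e by (simp add: power2_eq_square field_simps)
    finally show ?thesis by simp
  qed
  also have "m2 * x\<^sup>2 + (e * x\<^sup>2 + cab\<^sup>2 / e) + b2 = (1 + m2) / 2 * x\<^sup>2 + (cab\<^sup>2 / e + b2)"
    by (simp add: e_def field_simps)
  finally show "kill_op (\<lambda>x y. x\<^sup>2) x y \<le> (1 + m2) / 2 * x\<^sup>2 + (cab\<^sup>2 / e + b2)" by simp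
qed

text \<open>Stated for \<open>trans_op\<close> because overshoots are measured at the steps that
  leave the half line, where \<open>kill_op\<close> sees nothing. The contraction survives the
  additive coefficient by taking \<open>e\<close> so small that \<open>(1 - e) powr (1 - p)\<close>
  does not undo the moment condition on the multiplier.\<close>

lemma w_drift:
  obtains l C where "0 \<le> l" "l < 1" "0 \<le> C"
    "\<And>x y. trans_op (\<lambda>x y. (1 + \<bar>x\<bar>) powr p) x y \<le> l * (1 + \<bar>x\<bar>) powr p + C"
proof -
  define E where "E = (\<integral>w. \<bar>fst w\<bar> powr p \<partial>\<mu>)"
  have E: "0 \<le> E" "E < 1" using a_lt by (auto simp: E_def)
  have "((\<lambda>e. (1 - e) powr (1 - p) * E) \<longlongrightarrow> (1 - 0) powr (1 - p) * E) (at_right 0)"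
    by (intro tendsto_intros) auto
  then have "\<forall>\<^sub>F e in at_right 0. (1 - e) powr (1 - p) * E < 1"
    by (rule order_tendstoD(2)) (use E in simp)
  moreover have "\<forall>\<^sub>F e in at_right (0::real). 0 < e \<and> e < 1"
    using eventually_at_right_real[of 0 1] by auto
  ultimately have "\<forall>\<^sub>F e in at_right (0::real). 0 < e \<and> e < 1 \<and> (1 - e) powr (1 - p) * E < 1"
    by eventually_elim auto
  then obtain e where e: "0 < e" "e < 1" "(1 - e) powr (1 - p) * E < 1"
    using eventually_happens[of _ "at_right (0::real)"] trivial_limit_at_right_real[of "0::real"] by blast
  have ib: "integrable \<mu> (\<lambda>w. (1 + \<bar>snd w\<bar>) powr p)"
    by (rule dominated_by_weight[where C = 1]) (use p_gt in \<open>auto intro!: powr_mono2\<close>)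
  define B where "B = (\<integral>w. (1 + \<bar>snd w\<bar>) powr p \<partial>\<mu>)"
  show thesis
  proof
    show "0 \<le> (1 - e) powr (1 - p) * E" "(1 - e) powr (1 - p) * E < 1" using e E by auto
    show "0 \<le> e powr (1 - p) * B" by (simp add: B_def)
    fix x y
    have "trans_op (\<lambda>x y. (1 + \<bar>x\<bar>) powr p) x y \<le>
       (\<integral>w. ((1 - e) powr (1 - p) * (1 + \<bar>x\<bar>) powr p) * \<bar>fst w\<bar> powr p + e powr (1 - p) * (1 + \<bar>snd w\<bar>) powr p \<partial>\<mu>)"
      unfolding trans_op_def
    proof (intro integral_mono)
      show "integrable \<mu> (\<lambda>w. (1 + \<bar>fst w * x + snd w\<bar>) powr p)" using tame_integrable[OF tame_w] .
      fix w :: "real \<times> real"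
      have "\<bar>fst w * x + snd w\<bar> \<le> \<bar>fst w\<bar> * \<bar>x\<bar> + \<bar>snd w\<bar>"
        by (metis abs_mult abs_triangle_ineq)
      then have "1 + \<bar>fst w * x + snd w\<bar> \<le> \<bar>fst w\<bar> * (1 + \<bar>x\<bar>) + (1 + \<bar>snd w\<bar>)"
        by (simp add: algebra_simps)
      then have "(1 + \<bar>fst w * x + snd w\<bar>) powr p \<le> (\<bar>fst w\<bar> * (1 + \<bar>x\<bar>) + (1 + \<bar>snd w\<bar>)) powr p"
        using p_gt by (intro powr_mono2) auto
      also have "\<dots> \<le> (1 - e) powr (1 - p) * (\<bar>fst w\<bar> * (1 + \<bar>x\<bar>)) powr p + e powr (1 - p) * (1 + \<bar>snd w\<bar>) powr p"
        using p_gt e by (intro powr_add_convex) auto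
      also have "\<dots> = ((1 - e) powr (1 - p) * (1 + \<bar>x\<bar>) powr p) * \<bar>fst w\<bar> powr p + e powr (1 - p) * (1 + \<bar>snd w\<bar>) powr p"
        by (simp add: powr_mult)
      finally show "(1 + \<bar>fst w * x + snd w\<bar>) powr p \<le>
         ((1 - e) powr (1 - p) * (1 + \<bar>x\<bar>) powr p) * \<bar>fst w\<bar> powr p + e powr (1 - p) * (1 + \<bar>snd w\<bar>) powr p" .
    qed (auto intro!: Bochner_Integration.integrable_add integrable_mult_right int_a ib)
    also have "\<dots> = (1 - e) powr (1 - p) * E * (1 + \<bar>x\<bar>) powr p + e powr (1 - p) * B"
      using int_a ib by (simp add: E_def B_def)
    finally show "trans_op (\<lambda>x y. (1 + \<bar>x\<bar>) powr p) x y \<le> (1 - e) powr (1 - p) * E * (1 + \<bar>x\<bar>) powr p + e powr (1 - p) * B" .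
  qed
qed

text \<open>Mean modulus of the chain at the landing point when the step leaves the half line. The
  chain value is the increment of the walk, so this also controls the mean overshoot from a positive
  height.\<close>

definition exit_abs :: "real \<Rightarrow> real \<Rightarrow> real" where
  "exit_abs = trans_op (\<lambda>x y. if 0 < y then 0 else \<bar>x\<bar>)"

lemma tame_exit_fun: assumes "tame f" shows "tame (\<lambda>x y. if 0 < y then 0 else f x y)"
proof -
  have "(\<lambda>x y. if 0 < y then 0 else f x y) = (\<lambda>x y. f x y - killed f x y)"
    by (intro ext) (simp add: killed_def)
  then show ?thesis using assms by auto
qed

lemma tame_exit_abs: "tame exit_abs"
  unfolding exit_abs_def by (intro tame_trans tame_exit_fun tame_absx)

lemma exit_abs_nonneg: "0 \<le> exit_abs x y"
proof -
  have "trans_op (\<lambda>x y. 0) x y \<le> exit_abs x y"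
    unfolding exit_abs_def by (intro trans_mono tame_exit_fun tame_absx tame_const) auto
  then show ?thesis by (simp add: trans_const)
qed

text \<open>Truncation at \<open>R\<close>: landing values of modulus at most \<open>R\<close> cost
  \<open>R\<close> times the exit probability of the step, larger ones at most
  \<open>R powr (1 - p)\<close> times their power of order \<open>p\<close>. The exit probabilities
  telescope when summed over time.\<close>

lemma exit_abs_split:
  assumes R: "0 < R"
  shows "exit_abs x y \<le> R * (1 - kill_op (\<lambda>x y. 1) x y) + R powr (1 - p) * trans_op (\<lambda>x y. (1 + \<bar>x\<bar>) powr p) x y"
proof -
  have "exit_abs x y \<le> trans_op (\<lambda>x y. (R * 1 - R * killed (\<lambda>x y. 1) x y) + R powr (1 - p) * (1 + \<bar>x\<bar>) powr p) x y"
    unfolding exit_abs_def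
  proof (intro trans_mono tame_exit_fun tame_absx tame_add tame_diff tame_cmult tame_killed tame_const tame_w)
    fix x1
    have "\<bar>x1\<bar> \<le> R + R powr (1 - p) * (1 + \<bar>x1\<bar>) powr p"
    proof (cases "\<bar>x1\<bar> \<le> R")
      case True then show ?thesis by (simp add: add_increasing2)
    next
      case False
      then have x: "0 < \<bar>x1\<bar>" using R by simp
      have "\<bar>x1\<bar> = \<bar>x1\<bar> powr (1 - p) * \<bar>x1\<bar> powr p" using x by (simp flip: powr_add)
      also have "\<dots> \<le> R powr (1 - p) * (1 + \<bar>x1\<bar>) powr p"
        using False R p_gt x by (intro mult_mono powr_mono2 powr_mono2') auto
      finally show ?thesis using R by simp
    qed
    then show "(if 0 < y + x1 then 0 else \<bar>x1\<bar>) \<le> R * 1 - R * killed (\<lambda>x y. 1) x1 (y + x1) + R powr (1 - p) * (1 + \<bar>x1\<bar>) powr p"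
      by (simp add: killed_def)
  qed
  also have "\<dots> = R * (1 - kill_op (\<lambda>x y. 1) x y) + R powr (1 - p) * trans_op (\<lambda>x y. (1 + \<bar>x\<bar>) powr p) x y"
    by (subst trans_add trans_diff; (intro tame_diff tame_cmult tame_killed tame_const tame_w)?)+
       (simp only: trans_cmult trans_const kill_op_def, simp add: algebra_simps)
  finally show ?thesis .
qed

text \<open>Since the walk leaves at most once, truncation at one level \<open>R\<close> costs
  \<open>R\<close> in total and not \<open>R\<close> per step; only the tail term is multiplied by
  the number of steps. The bound does not involve \<open>y\<close>, and \<open>Ez_lower\<close>
  depends on this.\<close>

lemma exit_sum_bound:
  obtains C where "0 \<le> C" "\<And>k x y. 0 < y \<Longrightarrow> (\<Sum>j<k. (kill_op ^^ j) exit_abs x y) \<le> C * (real k powr (1/p) + 1 + \<bar>x\<bar>)"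
proof -
  obtain l C where l: "0 \<le> l" "l < 1" and C: "0 \<le> C"
    and d: "\<And>x y. trans_op (\<lambda>x y. (1 + \<bar>x\<bar>) powr p) x y \<le> l * (1 + \<bar>x\<bar>) powr p + C"
    using w_drift by metis
  define D where "D = C / (1 - l) + C"
  have D: "0 \<le> D" using C l by (simp add: D_def)
  define c1 where "c1 = 1 / (1 - l)"
  have c1: "0 \<le> c1" using l by (simp add: c1_def)
  let ?w = "\<lambda>x y::real. (1 + \<bar>x\<bar>) powr p"
  have kd: "kill_op ?w x y \<le> l * ?w x y + C" for x y
    by (rule order_trans[OF kill_le_trans[OF tame_w] d]) simp
  have step: "(kill_op ^^ j) exit_abs x y \<le>
      R * ((kill_op ^^ j) (\<lambda>x y. 1) x y - (kill_op ^^ Suc j) (\<lambda>x y. 1) x y) + R powr (1 - p) * (l ^ j * ?w x y + D)"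
    if R: "0 < R" and y: "0 < y" for R x y j
  proof -
    have "(kill_op ^^ j) exit_abs x y \<le>
      (kill_op ^^ j) (\<lambda>x y. R * (1 - kill_op (\<lambda>x y. 1) x y) + R powr (1 - p) * (?w x y + C)) x y"
    proof (rule kill_pow_mono[OF tame_exit_abs _ _ y])
      show "tame (\<lambda>x y. R * (1 - kill_op (\<lambda>x y. 1) x y) + R powr (1 - p) * (?w x y + C))"
        by (intro tame_add tame_cmult tame_diff tame_kill tame_const tame_w)
      fix x y :: real
      have "l * ?w x y \<le> 1 * ?w x y" using l by (intro mult_right_mono) auto
      then have "trans_op ?w x y \<le> ?w x y + C" using d[of x y] by simp
      then show "exit_abs x y \<le> R * (1 - kill_op (\<lambda>x y. 1) x y) + R powr (1 - p) * (?w x y + C)"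
        using exit_abs_split[OF R, of x y] mult_left_mono[of "trans_op ?w x y" "?w x y + C" "R powr (1 - p)"] by simp
    qed
    also have "\<dots> = R * ((kill_op ^^ j) (\<lambda>x y. 1) x y - (kill_op ^^ Suc j) (\<lambda>x y. 1) x y)
        + R powr (1 - p) * ((kill_op ^^ j) ?w x y + C * (kill_op ^^ j) (\<lambda>x y. 1) x y)"
      by (simp add: kill_pow_add kill_pow_diff kill_pow_cmult kill_pow_const[of _ C] tame_add tame_cmult tame_diff tame_kill tame_const tame_w
           kill_pow_Suc del: funpow.simps)
    also have "(kill_op ^^ j) ?w x y + C * (kill_op ^^ j) (\<lambda>x y. 1) x y \<le> (l ^ j * ?w x y + C / (1 - l)) + C * 1"
      by (intro add_mono kill_pow_drift[OF tame_w l C] kd y mult_left_mono C kill_pow_one_le)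
    finally show ?thesis by (simp add: D_def add.assoc mult_left_mono)
  qed
  have total: "(\<Sum>j<k. (kill_op ^^ j) exit_abs x y) \<le> R + R powr (1 - p) * (c1 * ?w x y + D * real k)"
    if R: "0 < R" and y: "0 < y" for R x y k
  proof -
    have "(\<Sum>j<k. (kill_op ^^ j) exit_abs x y) \<le> (\<Sum>j<k.
      R * ((kill_op ^^ j) (\<lambda>x y. 1) x y - (kill_op ^^ Suc j) (\<lambda>x y. 1) x y) + R powr (1 - p) * (l ^ j * ?w x y + D))"
      by (intro sum_mono step R y)
    also have "\<dots> = R * (1 - (kill_op ^^ k) (\<lambda>x y. 1) x y) + R powr (1 - p) * ((\<Sum>j<k. l ^ j) * ?w x y + D * real k)"
    proof -
      have "(\<Sum>j<k. (kill_op ^^ j) (\<lambda>x y. 1) x y - (kill_op ^^ Suc j) (\<lambda>x y. 1) x y) = (kill_op ^^ 0) (\<lambda>x y. 1) x y - (kill_op ^^ k) (\<lambda>x y. 1) x y"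
        by (rule sum_lessThan_telescope')
      then show ?thesis
        by (simp only: sum.distrib sum_distrib_left[symmetric] sum_distrib_right[symmetric]) (simp add: mult.commute)
    qed
    also have "\<dots> \<le> R * 1 + R powr (1 - p) * (c1 * ?w x y + D * real k)"
    proof (intro add_mono mult_left_mono mult_right_mono)
      show "1 - (kill_op ^^ k) (\<lambda>x y. 1) x y \<le> 1" using kill_pow_one_nonneg[OF y] by simp
      have "(\<Sum>j<k. l ^ j) = (1 - l ^ k) / (1 - l)" using l by (simp add: sum_gp_strict)
      also have "\<dots> \<le> c1" using l by (simp add: c1_def divide_right_mono)
      finally show "(\<Sum>j<k. l ^ j) \<le> c1" .
    qed (use R D in auto)
    finally show ?thesis by simp
  qed
  show thesis
  proof
    show "0 \<le> 1 + c1 + D" using c1 D by simp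
    fix k :: nat and x y :: real assume y: "0 < y"
    \<comment> \<open>The level balances both contributions: the part \<open>k powr (1/p)\<close>
      makes \<open>R powr (1 - p) * k\<close> at most \<open>R\<close>, and the part depending on
      \<open>x\<close> does the same for the initial weight.\<close>
    define R where "R = real k powr (1/p) + 1 + \<bar>x\<bar>"
    have "0 \<le> real k powr (1/p)" by simp
    then have R: "0 < R" "1 + \<bar>x\<bar> \<le> R" unfolding R_def by linarith+
    have "R powr (1 - p) * ?w x y \<le> (1 + \<bar>x\<bar>) powr (1 - p) * ?w x y"
      using R p_gt by (intro mult_right_mono powr_mono2') auto
    also have "\<dots> = 1 + \<bar>x\<bar>" by (simp flip: powr_add)
    finally have 1: "R powr (1 - p) * ?w x y \<le> R" using R by simp
    have 2: "R powr (1 - p) * real k \<le> R"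
    proof (cases "k = 0")
      case False
      then have k: "0 < real k" by simp
      have "R powr (1 - p) * real k \<le> (real k powr (1/p)) powr (1 - p) * real k"
        using R p_gt k by (intro mult_right_mono powr_mono2') (auto simp: R_def)
      also have "\<dots> = real k powr ((1/p) * (1 - p) + 1)" using k p_gt by (simp add: powr_powr powr_add)
      also have "(1/p) * (1 - p) + 1 = 1/p" using p_gt by (simp add: field_simps)
      finally show ?thesis by (simp add: R_def)
    qed (use R in simp)
    have "(\<Sum>j<k. (kill_op ^^ j) exit_abs x y) \<le> R + (c1 * (R powr (1 - p) * ?w x y) + D * (R powr (1 - p) * real k))"
      using total[OF R(1) y, of x k] by (simp add: algebra_simps)
    also have "\<dots> \<le> R + (c1 * R + D * R)" using 1 2 c1 D by (intro add_mono mult_left_mono) auto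
    finally show "(\<Sum>j<k. (kill_op ^^ j) exit_abs x y) \<le> (1 + c1 + D) * (real k powr (1/p) + 1 + \<bar>x\<bar>)"
      by (simp add: R_def algebra_simps)
  qed
qed

section \<open>The martingale and its Poisson equation\<close>

lemma one_minus_m: "0 < 1 - m" "1 - m \<noteq> 0" using m_bounds by auto

text \<open>Increment of the martingale when the chain moves from \<open>x\<close> to
  \<open>x1\<close>; the denominator comes from \<open>1 + \<rho> = 1 / (1 - m)\<close>.\<close>

definition incr :: "real \<Rightarrow> real \<Rightarrow> real" where
  "incr x x1 = (x1 - m * x) / (1 - m)"

lemma z_step: "(y + x1) + \<rho> * x1 = (y + \<rho> * x) + incr x x1"
proof -
  define d where "d = 1 - m"
  have d: "d \<noteq> 0" "m = 1 - d" using one_minus_m by (auto simp: d_def)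
  have "(y + x1) + (1 - d) / d * x1 = (y + (1 - d) / d * x) + (x1 - (1 - d) * x) / d"
    using d(1) by (simp add: field_simps)
  then show ?thesis by (simp add: \<rho>_def incr_def d(2))
qed

text \<open>Quadratic solution, without constant term, of the Poisson equation in
  \<open>kap_mean\<close>. The coefficient of the square is found by matching second powers of
  \<open>x\<close>, the linear one by matching first powers, where the covariance \<open>cab\<close>
  enters twice: through the square term and through \<open>incr_var\<close>.\<close>

definition kap :: "real \<Rightarrow> real" where
  "kap x = ((m2 - m\<^sup>2) / ((1 - m)\<^sup>2 * (1 - m2))) * x\<^sup>2
     + ((2 * ((m2 - m\<^sup>2) / ((1 - m)\<^sup>2 * (1 - m2))) * cab + 2 * cab / (1 - m)\<^sup>2) / (1 - m)) * x"

definition incr_var :: "real \<Rightarrow> real" where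
  "incr_var x = ((m2 - m\<^sup>2) * x\<^sup>2 + 2 * cab * x + b2) / (1 - m)\<^sup>2"

lemma incr_mean: "(\<integral>w. incr x (fst w * x + snd w) \<partial>\<mu>) = 0"
  using quadratic_integral[of 0 x "1 / (1 - m)" "- m * x / (1 - m)"] one_minus_m
  by (simp add: incr_def diff_divide_distrib)

lemma incr_integrable [simp]: "integrable \<mu> (\<lambda>w. incr x (fst w * x + snd w))"
  by (simp add: incr_def)

lemma incr_sq: "(incr x x1)\<^sup>2 = (1 / (1 - m)\<^sup>2) * x1\<^sup>2 + (- 2 * m * x / (1 - m)\<^sup>2) * x1 + (m * x)\<^sup>2 / (1 - m)\<^sup>2"
proof -
  have "((x1 - m * x) / d)\<^sup>2 = (1 / d\<^sup>2) * x1\<^sup>2 + (- 2 * m * x / d\<^sup>2) * x1 + (m * x)\<^sup>2 / d\<^sup>2" for d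
    by (simp add: divide_inverse power2_eq_square algebra_simps)
  then show ?thesis unfolding incr_def .
qed

lemma incr_sq_integrable [simp]: "integrable \<mu> (\<lambda>w. (incr x (fst w * x + snd w))\<^sup>2)"
  unfolding incr_sq by (intro Bochner_Integration.integrable_add integrable_mult_right quadratic_integrable integrable_const)

lemma incr_sq_mean: "(\<integral>w. (incr x (fst w * x + snd w))\<^sup>2 \<partial>\<mu>) = incr_var x"
proof -
  have "(1 / D) * (m2 * x\<^sup>2 + 2 * cab * x + b2) + (- 2 * m * x / D) * (m * x) + (m * x)\<^sup>2 / D
      = ((m2 - m\<^sup>2) * x\<^sup>2 + 2 * cab * x + b2) / D" for D
    by (simp add: divide_inverse algebra_simps power2_eq_square)
  then show ?thesis unfolding incr_sq quadratic_integral incr_var_def .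
qed

lemma kap_integrable [simp]: "integrable \<mu> (\<lambda>w. kap (fst w * x + snd w))"
  unfolding kap_def by (intro Bochner_Integration.integrable_add integrable_mult_right quadratic_integrable)

lemma kap_mean: "(\<integral>w. kap (fst w * x + snd w) \<partial>\<mu>) = kap x + v - incr_var x"
proof -
  define A where "A = (m2 - m\<^sup>2) / ((1 - m)\<^sup>2 * (1 - m2))"
  define B where "B = (2 * A * cab + 2 * cab / (1 - m)\<^sup>2) / (1 - m)"
  have ne: "1 - m \<noteq> 0" "1 - m2 \<noteq> 0" using m_bounds m2_lt by auto
  have k: "kap x = A * x\<^sup>2 + B * x" for x by (simp add: kap_def A_def B_def)
  have "(\<integral>w. kap (fst w * x + snd w) \<partial>\<mu>) = A * (m2 * x\<^sup>2 + 2 * cab * x + b2) + B * (m * x)"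
    using quadratic_integral[of A x B 0] by (simp add: k)
  also have "\<dots> = kap x + (- (A * (1 - m2)) * x\<^sup>2 + (2 * A * cab - B * (1 - m)) * x + A * b2)"
    by (simp add: k algebra_simps)
  also have "A * (1 - m2) = (m2 - m\<^sup>2) / (1 - m)\<^sup>2" using ne by (simp add: A_def)
  also have "2 * A * cab - B * (1 - m) = - (2 * cab / (1 - m)\<^sup>2)" using ne by (simp add: B_def)
  \<comment> \<open>The constant terms: once both coefficients are fixed, this identity determines
    the asymptotic variance \<open>v\<close>.\<close>
  also have "A * b2 = v - b2 / (1 - m)\<^sup>2"
  proof -
    have gen: "b2 * (P + Q) / (D * Q) = P / (D * Q) * b2 + b2 / D" if "Q \<noteq> 0" "D \<noteq> 0" for P Q D
      using that by (simp add: field_simps)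
    have "v = b2 * ((1 + m) * (1 - m)) / ((1 - m)\<^sup>2 * (1 - m2))"
      using ne by (simp add: v_def power2_eq_square)
    also have "(1 + m) * (1 - m) = (m2 - m\<^sup>2) + (1 - m2)" by (simp add: power2_eq_square algebra_simps)
    also have "b2 * ((m2 - m\<^sup>2) + (1 - m2)) / ((1 - m)\<^sup>2 * (1 - m2)) = A * b2 + b2 / (1 - m)\<^sup>2"
      using ne unfolding A_def by (intro gen) auto
    finally show ?thesis by simp
  qed
  finally show ?thesis by (simp add: incr_var_def divide_inverse algebra_simps)
qed

lemma kap_bound: obtains C where "0 \<le> C" "\<And>x. \<bar>kap x\<bar> \<le> C * (1 + \<bar>x\<bar>)\<^sup>2"
proof -
  obtain A B where k: "\<And>x. kap x = A * x\<^sup>2 + B * x" by (metis kap_def)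
  show thesis
  proof
    show "0 \<le> \<bar>A\<bar> + \<bar>B\<bar>" by simp
    fix x
    have "\<bar>kap x\<bar> \<le> \<bar>A\<bar> * x\<^sup>2 + \<bar>B\<bar> * \<bar>x\<bar>"
      unfolding k using abs_triangle_ineq[of "A * x\<^sup>2" "B * x"] by (simp add: abs_mult)
    also have "\<dots> \<le> \<bar>A\<bar> * (1 + \<bar>x\<bar>)\<^sup>2 + \<bar>B\<bar> * (1 + \<bar>x\<bar>)\<^sup>2"
    proof (intro add_mono mult_left_mono)
      show "x\<^sup>2 \<le> (1 + \<bar>x\<bar>)\<^sup>2" by (simp add: power2_sum)
      have "0 \<le> x\<^sup>2" by simp
      then show "\<bar>x\<bar> \<le> (1 + \<bar>x\<bar>)\<^sup>2" by (simp add: power2_sum)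
    qed auto
    finally show "\<bar>kap x\<bar> \<le> (\<bar>A\<bar> + \<bar>B\<bar>) * (1 + \<bar>x\<bar>)\<^sup>2" by (simp add: algebra_simps)
  qed
qed

lemma kap_measurable [measurable]: "kap \<in> borel_measurable borel"
  unfolding kap_def[abs_def] by measurable

lemma trans_z: "trans_op (\<lambda>x y. y + \<rho> * x) x y = y + \<rho> * x"
  unfolding trans_op_def z_step[where x = x] by (simp add: incr_mean)

definition exit_z :: "real \<Rightarrow> real \<Rightarrow> real" where
  "exit_z = trans_op (\<lambda>x y. if 0 < y then 0 else y + \<rho> * x)"

lemma tame_exit_z: "tame exit_z"
  unfolding exit_z_def by (intro tame_trans tame_exit_fun tame_z)

lemma kill_z: "kill_op (\<lambda>x y. y + \<rho> * x) x y = (y + \<rho> * x) - exit_z x y"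
  using kill_eq_trans_diff[OF tame_z] by (simp add: trans_z exit_z_def)

text \<open>Optional stopping at the exit time cut at \<open>k\<close>: the mean of the martingale
  is conserved, so what remains on the survival event is the initial value minus what was carried
  away by the exits.\<close>

lemma kill_pow_z:
  "(kill_op ^^ k) (\<lambda>x y. y + \<rho> * x) x y = (y + \<rho> * x) - (\<Sum>j<k. (kill_op ^^ j) exit_z x y)"
proof (induction k)
  case (Suc k)
  have "(kill_op ^^ Suc k) (\<lambda>x y. y + \<rho> * x) = (kill_op ^^ k) (\<lambda>x y. (y + \<rho> * x) - exit_z x y)"
    unfolding kill_pow_Suc kill_z[abs_def] by (simp add: kill_z fun_eq_iff[symmetric] flip: kill_z)
  also have "\<dots> = (\<lambda>x y. (kill_op ^^ k) (\<lambda>x y. y + \<rho> * x) x y - (kill_op ^^ k) exit_z x y)"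
    by (rule kill_pow_diff[OF tame_z tame_exit_z])
  finally show ?case using Suc by simp
qed simp

lemma abs_z_le: "\<bar>y + \<rho> * x\<bar> \<le> \<bar>y\<bar> + \<bar>\<rho>\<bar> * \<bar>x\<bar>"
  by (metis abs_mult abs_triangle_ineq)

text \<open>From a positive height, the landing height after an exit is nonpositive and at most one
  increment away, so its modulus is at most that of the increment.\<close>

lemma exit_z_abs_le:
  assumes "0 < y" shows "\<bar>exit_z x y\<bar> \<le> (1 + \<bar>\<rho>\<bar>) * exit_abs x y"
proof -
  have le: "\<bar>if 0 < y + x1 then 0 else y + x1 + \<rho> * x1\<bar> \<le> (1 + \<bar>\<rho>\<bar>) * (if 0 < y + x1 then 0 else \<bar>x1\<bar>)" for x1
  proof (cases "0 < y + x1")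
    case False
    then have "\<bar>y + x1\<bar> \<le> \<bar>x1\<bar>" using assms by simp
    then show ?thesis using False abs_z_le[of "y + x1" x1] by (simp add: distrib_right)
  qed simp
  have t: "tame (\<lambda>x y. if 0 < y then 0 else y + \<rho> * x)" "tame (\<lambda>x y. (1 + \<bar>\<rho>\<bar>) * (if 0 < y then 0 else \<bar>x\<bar>))"
    "tame (\<lambda>x y. -1 * (if 0 < y then 0 else y + \<rho> * x))"
    by (intro tame_exit_fun tame_z tame_cmult tame_absx)+
  have "exit_z x y \<le> trans_op (\<lambda>x y. (1 + \<bar>\<rho>\<bar>) * (if 0 < y then 0 else \<bar>x\<bar>)) x y"
    unfolding exit_z_def by (intro trans_mono t) (use le abs_le_D1 in blast)
  moreover have "trans_op (\<lambda>x y. -1 * (if 0 < y then 0 else y + \<rho> * x)) x y \<le> trans_op (\<lambda>x y. (1 + \<bar>\<rho>\<bar>) * (if 0 < y then 0 else \<bar>x\<bar>)) x y"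
  proof (intro trans_mono t)
    fix x1 show "-1 * (if 0 < y + x1 then 0 else y + x1 + \<rho> * x1) \<le> (1 + \<bar>\<rho>\<bar>) * (if 0 < y + x1 then 0 else \<bar>x1\<bar>)"
      using abs_le_D2[OF le[of x1]] by simp
  qed
  ultimately show ?thesis unfolding trans_cmult exit_z_def exit_abs_def by linarith
qed

text \<open>Leaving from a positive height requires a negative increment, so for nonnegative \<rho>
  both parts of the martingale are nonpositive at the exit. This is how the sign of the mean of the
  multiplier enters alternative (i).\<close>

lemma exit_z_nonpos:
  assumes "0 < y" "0 \<le> \<rho>" shows "exit_z x y \<le> 0"
proof -
  have "exit_z x y \<le> trans_op (\<lambda>x y. 0) x y"
    unfolding exit_z_def
  proof (intro trans_mono tame_exit_fun tame_z tame_const)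
    fix x1
    have "\<rho> * x1 \<le> 0" if "x1 \<le> 0" using assms(2) that by (rule mult_nonneg_nonpos)
    then show "(if 0 < y + x1 then 0 else y + x1 + \<rho> * x1) \<le> 0" using assms(1) by auto
  qed
  then show ?thesis by (simp add: trans_const)
qed

lemma exit_z_pow_le:
  assumes "0 < y"
  shows "\<bar>\<Sum>j<k. (kill_op ^^ j) exit_z x y\<bar> \<le> (1 + \<bar>\<rho>\<bar>) * (\<Sum>j<k. (kill_op ^^ j) exit_abs x y)"
proof -
  have "\<bar>\<Sum>j<k. (kill_op ^^ j) exit_z x y\<bar> \<le> (\<Sum>j<k. \<bar>(kill_op ^^ j) exit_z x y\<bar>)" by (rule sum_abs)
  also have "\<dots> \<le> (\<Sum>j<k. (kill_op ^^ j) (\<lambda>x y. (1 + \<bar>\<rho>\<bar>) * exit_abs x y) x y)"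
    by (intro sum_mono kill_pow_abs_le tame_exit_z tame_cmult tame_exit_abs exit_z_abs_le assms)
  finally show ?thesis by (simp add: kill_pow_cmult sum_distrib_left)
qed

lemma kill_pow_z_ge: "0 < y \<Longrightarrow> 0 \<le> \<rho> \<Longrightarrow> y + \<rho> * x \<le> (kill_op ^^ k) (\<lambda>x y. y + \<rho> * x) x y"
proof -
  assume y: "0 < y" "0 \<le> \<rho>"
  have "(kill_op ^^ j) exit_z x y \<le> 0" for j
    using kill_pow_mono[OF tame_exit_z tame_const[of 0] exit_z_nonpos[OF _ y(2)] y(1), of j x] by (simp add: kill_pow_zero)
  then have "(\<Sum>j<k. (kill_op ^^ j) exit_z x y) \<le> 0" by (intro sum_nonpos) auto
  then show ?thesis by (simp add: kill_pow_z)
qed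

text \<open>The cross term averages to zero by the martingale property. What is added is the
  conditional variance \<open>incr_var\<close>, of at most quadratic growth in
  \<open>x\<close>.\<close>

lemma kill_z2: obtains C where "0 \<le> C"
  "\<And>x y. kill_op (\<lambda>x y. (y + \<rho> * x)\<^sup>2) x y \<le> (y + \<rho> * x)\<^sup>2 + C * (1 + x\<^sup>2)"
proof -
  define C where "C = (\<bar>m2 - m\<^sup>2\<bar> + \<bar>cab\<bar> + \<bar>cab\<bar> + b2) / (1 - m)\<^sup>2"
  have v: "incr_var x \<le> C * (1 + x\<^sup>2)" for x
  proof -
    have "0 \<le> (x - 1)\<^sup>2" "0 \<le> (x + 1)\<^sup>2" by simp_all
    then have "2 * \<bar>x\<bar> \<le> 1 + x\<^sup>2" unfolding power2_diff power2_sum by (simp add: abs_if)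
    then have "\<bar>cab\<bar> * (2 * \<bar>x\<bar>) \<le> \<bar>cab\<bar> * (1 + x\<^sup>2)" by (intro mult_left_mono) auto
    moreover have "2 * cab * x \<le> \<bar>cab\<bar> * (2 * \<bar>x\<bar>)" using abs_ge_self[of "2 * cab * x"] by (simp add: abs_mult)
    moreover have "(m2 - m\<^sup>2) * x\<^sup>2 \<le> \<bar>m2 - m\<^sup>2\<bar> * x\<^sup>2" by (intro mult_right_mono) auto
    moreover have "\<bar>m2 - m\<^sup>2\<bar> * x\<^sup>2 \<le> \<bar>m2 - m\<^sup>2\<bar> * (1 + x\<^sup>2)" by (intro mult_left_mono) auto
    moreover have "b2 * 1 \<le> b2 * (1 + x\<^sup>2)" using b2_pos by (intro mult_left_mono) auto
    moreover have "0 \<le> \<bar>cab\<bar> * (1 + x\<^sup>2)" by simp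
    ultimately have "(m2 - m\<^sup>2) * x\<^sup>2 + 2 * cab * x + b2 \<le> (\<bar>m2 - m\<^sup>2\<bar> + \<bar>cab\<bar> + \<bar>cab\<bar> + b2) * (1 + x\<^sup>2)"
      unfolding distrib_right by linarith
    then show ?thesis by (simp add: incr_var_def C_def divide_right_mono)
  qed
  show thesis
  proof
    show "0 \<le> C" using b2_pos by (simp add: C_def)
    fix x y
    have "kill_op (\<lambda>x y. (y + \<rho> * x)\<^sup>2) x y \<le> trans_op (\<lambda>x y. (y + \<rho> * x)\<^sup>2) x y"
      by (intro kill_le_trans tame_z2) simp
    also have "\<dots> = (\<integral>w. (y + \<rho> * x)\<^sup>2 + (incr x (fst w * x + snd w))\<^sup>2 + 2 * (y + \<rho> * x) * incr x (fst w * x + snd w) \<partial>\<mu>)"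
      unfolding trans_op_def z_step[where x = x] power2_sum[of "y + \<rho> * x"] ..
    also have "\<dots> = (y + \<rho> * x)\<^sup>2 + incr_var x"
      by (simp add: incr_mean incr_sq_mean)
    also have "\<dots> \<le> (y + \<rho> * x)\<^sup>2 + C * (1 + x\<^sup>2)" using v by simp
    finally show "kill_op (\<lambda>x y. (y + \<rho> * x)\<^sup>2) x y \<le> (y + \<rho> * x)\<^sup>2 + C * (1 + x\<^sup>2)" .
  qed
qed

end

section \<open>The half-normal distribution function as a heat solution\<close>

text \<open>The error function, written as an interval integral so that the fundamental theorem of
  calculus yields its derivative.\<close>

definition gerf :: "real \<Rightarrow> real" where
  "gerf r = (2 / sqrt pi) * (LBINT t=0..r. exp (- t\<^sup>2))"

lemma gerf_deriv: "(gerf has_real_derivative (2 / sqrt pi) * exp (- r\<^sup>2)) (at r)"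
proof -
  let ?a = "- \<bar>r\<bar> - 1" and ?b = "\<bar>r\<bar> + 1"
  have "((\<lambda>u. LBINT y=(0::real)..u. exp (- y\<^sup>2)) has_vector_derivative exp (- r\<^sup>2)) (at r within {?a..?b})"
    by (intro interval_integral_FTC2 continuous_intros) auto
  then have "((\<lambda>u. LBINT y=(0::real)..u. exp (- y\<^sup>2)) has_real_derivative exp (- r\<^sup>2)) (at r within {?a..?b})"
    by (simp add: has_real_derivative_iff_has_vector_derivative)
  moreover have "at r within {?a..?b} = at r"
    by (intro at_within_interior) (auto simp: interior_atLeastAtMost_real)
  ultimately have "((\<lambda>u. LBINT y=(0::real)..u. exp (- y\<^sup>2)) has_real_derivative exp (- r\<^sup>2)) (at r)" by simp
  from DERIV_cmult[OF this, of "2 / sqrt pi"] show ?thesis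
    by (simp add: gerf_def[abs_def] zero_ereal_def)
qed

lemma gerf_0: "gerf 0 = 0"
  by (simp add: gerf_def zero_ereal_def)

lemma gerf_lim: "(gerf \<longlongrightarrow> 1) at_top"
proof -
  let ?f = "\<lambda>x::real. indicator {0..} x *\<^sub>R exp (- x\<^sup>2)"
  have i: "integrable lborel ?f" and v: "(\<integral>x. ?f x \<partial>lborel) = sqrt pi / 2"
    using gaussian_moment_0 by (auto simp: has_bochner_integral_iff)
  have "((\<lambda>y. \<integral> x. indicator {.. y} x *\<^sub>R ?f x \<partial>lborel) \<longlongrightarrow> \<integral> x. ?f x \<partial>lborel) at_top"
    by (rule tendsto_integral_at_top) (use i in auto)
  then have "((\<lambda>y. \<integral> x. indicator {.. y} x *\<^sub>R ?f x \<partial>lborel) \<longlongrightarrow> sqrt pi / 2) at_top"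
    unfolding v .
  then have "((\<lambda>y. (2 / sqrt pi) * (\<integral> x. indicator {.. y} x *\<^sub>R ?f x \<partial>lborel)) \<longlongrightarrow> (2 / sqrt pi) * (sqrt pi / 2)) at_top"
    by (intro tendsto_intros)
  moreover have "\<forall>\<^sub>F y in at_top. (2 / sqrt pi) * (\<integral> x. indicator {.. y} x *\<^sub>R ?f x \<partial>lborel) = gerf y"
    using eventually_ge_at_top[of 0]
  proof eventually_elim
    case (elim y)
    have "(LBINT t=ereal 0..ereal y. exp (- t\<^sup>2)) = (\<integral> x. indicator {0..y} x *\<^sub>R exp (- x\<^sup>2) \<partial>lborel)"
      using elim by (subst interval_integral_Icc) (auto simp: set_lebesgue_integral_def)
    also have "\<dots> = (\<integral> x. indicator {.. y} x *\<^sub>R ?f x \<partial>lborel)"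
      by (intro Bochner_Integration.integral_cong) (auto split: split_indicator)
    finally show ?case by (simp add: gerf_def zero_ereal_def)
  qed
  ultimately show ?thesis using tendsto_cong by fastforce
qed

text \<open>For \<open>0 \<le> r\<close> this is the probability that a standard Gaussian variable
  has modulus at most \<open>r\<close>; for negative \<open>r\<close> it is negative, as the
  comparison beyond the boundary requires. \<open>nerf1\<close>, \<open>nerf2\<close> and
  \<open>nerf3\<close> are its first three derivatives.\<close>

definition nerf :: "real \<Rightarrow> real" where "nerf r = gerf (r / sqrt 2)"
definition nerf1 :: "real \<Rightarrow> real" where "nerf1 r = sqrt (2 / pi) * exp (- r\<^sup>2 / 2)"
definition nerf2 :: "real \<Rightarrow> real" where "nerf2 r = - r * nerf1 r"
definition nerf3 :: "real \<Rightarrow> real" where "nerf3 r = (r\<^sup>2 - 1) * nerf1 r"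

lemma nerf_deriv: "(nerf has_real_derivative nerf1 r) (at r)"
proof -
  have "((\<lambda>r. gerf (r / sqrt 2)) has_real_derivative ((2 / sqrt pi) * exp (- (r / sqrt 2)\<^sup>2)) * (1 / sqrt 2)) (at r)"
    by (rule DERIV_chain2[OF gerf_deriv DERIV_cdivide[OF DERIV_ident]])
  moreover have "((2 / sqrt pi) * exp (- (r / sqrt 2)\<^sup>2)) * (1 / sqrt 2) = nerf1 r"
  proof -
    have "((2 / sqrt pi) * E) * (1 / sqrt 2) = (2 / sqrt 2) / sqrt pi * E" for E :: real by (simp only: times_divide_eq_left times_divide_eq_right divide_divide_eq_left mult_1_right mult.commute)
    moreover have "2 / sqrt 2 = sqrt (2::real)" by (rule real_div_sqrt) simp
    moreover have "- (r / sqrt 2)\<^sup>2 = - r\<^sup>2 / 2" by (simp add: power_divide)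
    ultimately show ?thesis unfolding nerf1_def real_sqrt_divide by metis
  qed
  ultimately show ?thesis by (simp add: nerf_def[abs_def])
qed

lemma nerf1_deriv: "(nerf1 has_real_derivative nerf2 r) (at r)"
  unfolding nerf1_def[abs_def] nerf2_def by (auto intro!: derivative_eq_intros simp: nerf1_def)

lemma nerf2_deriv: "(nerf2 has_real_derivative nerf3 r) (at r)"
  unfolding nerf2_def[abs_def] nerf3_def
  by (auto intro!: derivative_eq_intros nerf1_deriv simp: nerf2_def power2_eq_square algebra_simps)

lemma nerf1_pos: "0 < nerf1 r" by (simp add: nerf1_def)

lemma exp_le_inverse: "exp (- r\<^sup>2 / 2) * (1 + r\<^sup>2 / 2 + r^4 / 8) \<le> 1" for r :: real
proof -
  have "1 + r\<^sup>2 / 2 + (r\<^sup>2 / 2)\<^sup>2 / 2 \<le> exp (r\<^sup>2 / 2)" by (intro exp_lower_Taylor_quadratic) simp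
  then have "1 + r\<^sup>2 / 2 + r^4 / 8 \<le> exp (r\<^sup>2 / 2)" by (simp add: power_divide)
  then have "exp (- (r\<^sup>2 / 2)) * (1 + r\<^sup>2 / 2 + r^4 / 8) \<le> exp (- (r\<^sup>2 / 2)) * exp (r\<^sup>2 / 2)"
    by (intro mult_left_mono) auto
  then show ?thesis by (simp flip: exp_add)
qed

text \<open>Gaussian decay is replaced by the quadratic Taylor polynomial of \<open>exp\<close>,
  evaluated at half the square of \<open>r\<close>. Being of degree 4 in \<open>r\<close>, it
  dominates the powers up to the third that multiply \<open>nerf1\<close> below.\<close>

lemma nerf1_bound:
  assumes "0 \<le> c" "c \<le> k * (1 + r\<^sup>2 / 2 + r^4 / 8)" "0 \<le> k"
  shows "c * nerf1 r \<le> k"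
proof -
  have s: "sqrt (2 / pi) \<le> 1" using pi_gt3 by (simp add: divide_le_eq)
  have "c * exp (- r\<^sup>2 / 2) \<le> k * (1 + r\<^sup>2 / 2 + r^4 / 8) * exp (- r\<^sup>2 / 2)"
    using assms by (intro mult_right_mono) auto
  also have "\<dots> = k * (exp (- r\<^sup>2 / 2) * (1 + r\<^sup>2 / 2 + r^4 / 8))" by (simp only: mult_ac)
  also have "\<dots> \<le> k * 1" by (intro mult_left_mono exp_le_inverse assms)
  finally have "sqrt (2 / pi) * (c * exp (- r\<^sup>2 / 2)) \<le> 1 * k"
    using s assms by (intro mult_mono) auto
  then show ?thesis by (simp add: nerf1_def mult.left_commute)
qed

lemma nerf1_le: "nerf1 r \<le> 1"
  using nerf1_bound[of 1 1 r] by simp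

lemma abs_nerf1_le: "\<bar>r\<bar> * nerf1 r \<le> 1"
proof (rule nerf1_bound)
  have "0 \<le> (\<bar>r\<bar> - 1)\<^sup>2" by simp
  then have "\<bar>r\<bar> \<le> 1 / 2 + r\<^sup>2 / 2" unfolding power2_diff by simp
  also have "\<dots> \<le> 1 * (1 + r\<^sup>2 / 2 + r ^ 4 / 8)" by simp
  finally show "\<bar>r\<bar> \<le> 1 * (1 + r\<^sup>2 / 2 + r ^ 4 / 8)" .
qed auto

lemma nerf2_le: "\<bar>nerf2 r\<bar> \<le> 1"
  using abs_nerf1_le[of r] nerf1_pos[of r] by (simp add: nerf2_def abs_mult)

lemma sq_nerf1_le: "r\<^sup>2 * nerf1 r \<le> 2"
  by (rule nerf1_bound) auto

lemma cube_nerf1_le: "\<bar>r\<bar> ^ 3 * nerf1 r \<le> 2"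
proof (rule nerf1_bound)
  have "0 \<le> (r\<^sup>2 - 2 * \<bar>r\<bar>)\<^sup>2" by simp
  also have "\<dots> = r ^ 4 + 4 * r\<^sup>2 - 4 * \<bar>r\<bar> ^ 3"
    unfolding power2_diff by (simp add: power_mult_distrib eval_nat_numeral abs_mult)
  finally have "4 * \<bar>r\<bar> ^ 3 \<le> r ^ 4 + 4 * r\<^sup>2" by simp
  moreover have "0 \<le> r ^ 4" by simp
  ultimately show "\<bar>r\<bar> ^ 3 \<le> 2 * (1 + r\<^sup>2 / 2 + r ^ 4 / 8)" by (simp add: algebra_simps)
qed auto

lemma nerf3_le: "\<bar>nerf3 r\<bar> \<le> 3"
proof -
  have "\<bar>nerf3 r\<bar> \<le> (r\<^sup>2 + 1) * nerf1 r"
    using nerf1_pos[of r] unfolding nerf3_def abs_mult by (intro mult_mono) (auto simp: abs_le_iff)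
  then show ?thesis using sq_nerf1_le[of r] nerf1_le[of r] by (simp add: algebra_simps)
qed

lemma nerf3_r_le: "\<bar>nerf3 r * r\<bar> \<le> 3"
proof -
  have "\<bar>nerf3 r * r\<bar> \<le> ((r\<^sup>2 + 1) * nerf1 r) * \<bar>r\<bar>"
    using nerf1_pos[of r] unfolding nerf3_def abs_mult by (intro mult_mono) (auto simp: abs_le_iff)
  also have "\<dots> = \<bar>r\<bar> ^ 3 * nerf1 r + \<bar>r\<bar> * nerf1 r"
    by (simp add: algebra_simps eval_nat_numeral)
  finally show ?thesis using cube_nerf1_le[of r] abs_nerf1_le[of r] by linarith
qed

lemma nerf_0: "nerf 0 = 0" by (simp add: nerf_def gerf_0)

lemma nerf_mvt:
  assumes "a < b" obtains z where "a < z" "z < b" "nerf b - nerf a = (b - a) * nerf1 z"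
  using MVT2[OF assms, of nerf nerf1] nerf_deriv by metis

lemma nerf_mono: assumes "a \<le> b" shows "nerf a \<le> nerf b"
proof (cases "a = b")
  case False
  with assms obtain z where "nerf b - nerf a = (b - a) * nerf1 z" using nerf_mvt[of a b] by auto
  moreover have "0 \<le> (b - a) * nerf1 z" using assms nerf1_pos[of z] by simp
  ultimately show ?thesis by linarith
qed simp

lemma nerf_lim: "(nerf \<longlongrightarrow> 1) at_top"
proof -
  have "filterlim (\<lambda>r::real. (1 / sqrt 2) * r) at_top at_top"
    by (rule filterlim_tendsto_pos_mult_at_top[OF tendsto_const _ filterlim_ident]) simp
  from filterlim_compose[OF gerf_lim this] show ?thesis by (simp add: nerf_def[abs_def])
qed

lemma nerf_le_1: "nerf r \<le> 1"
proof (rule tendsto_lowerbound[OF nerf_lim])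
  show "\<forall>\<^sub>F x in at_top. nerf r \<le> nerf x"
    using eventually_ge_at_top[of r] by eventually_elim (rule nerf_mono)
qed simp

lemma nerf_lip: "\<bar>nerf a - nerf b\<bar> \<le> \<bar>a - b\<bar>"
proof -
  have *: "\<bar>nerf b - nerf a\<bar> \<le> \<bar>b - a\<bar>" if ab: "a < b" for a b
  proof -
    obtain z where z: "nerf b - nerf a = (b - a) * nerf1 z" using nerf_mvt[OF ab] by metis
    have "\<bar>b - a\<bar> * \<bar>nerf1 z\<bar> \<le> \<bar>b - a\<bar> * 1" using nerf1_le[of z] nerf1_pos[of z] by (intro mult_left_mono) auto
    then show ?thesis unfolding z abs_mult by simp
  qed
  show ?thesis using *[of a b] *[of b a] by (cases a b rule: linorder_cases) (auto simp: abs_minus_commute)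
qed

lemma nerf_abs_le: "\<bar>nerf r\<bar> \<le> \<bar>r\<bar>"
  using nerf_lip[of r 0] by (simp add: nerf_0)

lemma nerf_nonneg: "0 \<le> r \<Longrightarrow> 0 \<le> nerf r"
  using nerf_mono[of 0 r] by (simp add: nerf_0)

text \<open>The slope at 0 becomes the constant of the asymptotics. The remainder is quadratic, so a
  second moment of the height is enough to use the linearisation on average.\<close>

lemma nerf_linear:
  assumes "0 \<le> r" shows "\<bar>nerf r - sqrt (2/pi) * r\<bar> \<le> r\<^sup>2"
proof (cases "r = 0")
  case False
  with assms have r: "0 < r" by simp
  obtain z where z: "0 < z" "z < r" "nerf r - nerf 0 = (r - 0) * nerf1 z" using nerf_mvt[OF r] by metis
  obtain w where w: "0 < w" "w < z" "nerf1 z - nerf1 0 = (z - 0) * nerf2 w"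
    using MVT2[OF z(1), of nerf1 nerf2] nerf1_deriv by metis
  have "nerf r - sqrt (2/pi) * r = r * (nerf1 z - nerf1 0)" using z by (simp add: nerf_0 nerf1_def algebra_simps)
  also have "\<bar>\<dots>\<bar> = r * (z * \<bar>nerf2 w\<bar>)" using w z r by (simp add: abs_mult)
  also have "\<dots> \<le> r * (r * 1)" using z r nerf2_le[of w] by (intro mult_mono) auto
  finally show ?thesis by (simp add: power2_eq_square)
qed (simp add: nerf_0)

lemma nerf_le_linear: assumes "0 \<le> r" shows "nerf r \<le> r"
  using nerf_abs_le[of r] assms by simp

text \<open>The loss is uniform in \<open>r\<close>, whereas the Lipschitz bound would give
  \<open>(1 - c) * r\<close>. By the mean value theorem a derivative at some \<open>z\<close>
  comparable to \<open>r\<close> appears, and \<open>\<bar>z\<bar> * nerf1 z\<close> is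
  bounded.\<close>

lemma nerf_scale:
  assumes "0 \<le> r" "0 < c" "c \<le> 1" shows "nerf r - (1 - c) / c \<le> nerf (c * r)"
proof (cases "c * r < r")
  case True
  then obtain z where z: "c * r < z" "z < r" "nerf r - nerf (c * r) = (r - c * r) * nerf1 z" using nerf_mvt by metis
  have "r \<le> z / c" using z assms by (simp add: field_simps)
  then have "(1 - c) * r \<le> (1 - c) * (z / c)" using assms by (intro mult_left_mono) auto
  then have "(r - c * r) * nerf1 z \<le> ((1 - c) * (z / c)) * nerf1 z"
    using nerf1_pos[of z] by (intro mult_right_mono) (auto simp: algebra_simps)
  also have "\<dots> = (1 - c) / c * (\<bar>z\<bar> * nerf1 z)"
    using z assms by (subst abs_of_nonneg) (auto intro: order_trans[of 0 "c * r"])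
  also have "\<dots> \<le> (1 - c) / c * 1" using assms abs_nerf1_le by (intro mult_left_mono) auto
  finally show ?thesis using z by simp
next
  case False
  then have "nerf r \<le> nerf (c * r)" by (intro nerf_mono) simp
  moreover have "0 \<le> (1 - c) / c" using assms by simp
  ultimately show ?thesis by linarith
qed

lemma nerf2_lip: "\<bar>nerf2 a - nerf2 b\<bar> \<le> 3 * \<bar>a - b\<bar>"
proof -
  have *: "\<bar>nerf2 b - nerf2 a\<bar> \<le> 3 * \<bar>b - a\<bar>" if ab: "a < b" for a b
  proof -
    obtain z where z: "nerf2 b - nerf2 a = (b - a) * nerf3 z" using MVT2[OF ab, of nerf2 nerf3] nerf2_deriv by metis
    have "\<bar>b - a\<bar> * \<bar>nerf3 z\<bar> \<le> \<bar>b - a\<bar> * 3" using nerf3_le[of z] by (intro mult_left_mono) auto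
    then show ?thesis unfolding z abs_mult by simp
  qed
  show ?thesis using *[of a b] *[of b a] by (cases a b rule: linorder_cases) (auto simp: abs_minus_commute)
qed

text \<open>Lipschitz continuity handles distances up to 1 and boundedness the larger ones.\<close>

lemma nerf2_holder:
  assumes "0 < \<beta>" "\<beta> \<le> 1" shows "\<bar>nerf2 a - nerf2 b\<bar> \<le> 3 * \<bar>a - b\<bar> powr \<beta>"
proof (cases "\<bar>a - b\<bar> \<le> 1")
  case True
  show ?thesis
  proof (cases "a = b")
    case False
    have "\<bar>a - b\<bar> powr 1 \<le> \<bar>a - b\<bar> powr \<beta>" using assms True False by (intro powr_mono') auto
    then show ?thesis using nerf2_lip[of a b] False by simp
  qed simp
next
  case False
  then have "1 \<le> \<bar>a - b\<bar> powr \<beta>" using assms by (intro ge_one_powr_ge_zero) auto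
  then show ?thesis using nerf2_le[of a] nerf2_le[of b] by linarith
qed

text \<open>The parameter \<open>s\<close> is the variance still to be run. \<open>heat\<close>
  solves the heat equation with diffusion coefficient 1/2, value 0 at \<open>z = 0\<close> and
  initial value 1 on the positive half line; \<open>heat2\<close> is its second space derivative,
  hence twice its time derivative by \<open>heat_time_deriv\<close>.\<close>

definition heat :: "real \<Rightarrow> real \<Rightarrow> real" where "heat s z = nerf (z / sqrt s)"
definition heat2 :: "real \<Rightarrow> real \<Rightarrow> real" where "heat2 s z = nerf2 (z / sqrt s) / s"

lemma heat2_holder:
  assumes "0 < s" "2 < p" "p \<le> 3"
  shows "\<bar>heat2 s a - heat2 s b\<bar> \<le> 3 * s powr (- p/2) * \<bar>a - b\<bar> powr (p - 2)"
proof -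
  have "\<bar>heat2 s a - heat2 s b\<bar> = \<bar>nerf2 (a / sqrt s) - nerf2 (b / sqrt s)\<bar> / s"
    using assms by (simp add: heat2_def flip: diff_divide_distrib)
  also have "\<dots> \<le> 3 * \<bar>a / sqrt s - b / sqrt s\<bar> powr (p - 2) / s"
    using assms by (intro divide_right_mono nerf2_holder) auto
  also have "\<bar>a / sqrt s - b / sqrt s\<bar> = \<bar>a - b\<bar> / sqrt s"
    using assms by (simp flip: diff_divide_distrib)
  also have "(\<bar>a - b\<bar> / sqrt s) powr (p - 2) = \<bar>a - b\<bar> powr (p - 2) / s powr ((p - 2)/2)"
    using assms by (simp add: powr_divide powr_half_sqrt[symmetric] powr_powr)
  also have "3 * (\<bar>a - b\<bar> powr (p - 2) / s powr ((p - 2)/2)) / s = 3 * \<bar>a - b\<bar> powr (p - 2) / (s powr ((p - 2)/2) * s powr 1)"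
    using assms by simp
  also have "s powr ((p - 2)/2) * s powr 1 = s powr (p/2)"
    using assms by (simp only: powr_add[symmetric]) (simp add: field_simps)
  also have "3 * \<bar>a - b\<bar> powr (p - 2) / s powr (p/2) = 3 * s powr (- p/2) * \<bar>a - b\<bar> powr (p - 2)"
    by (simp add: powr_minus field_simps)
  finally show ?thesis .
qed

lemma taylor_holder:
  fixes f f1 f2 :: "real \<Rightarrow> real"
  assumes d1: "\<And>x. (f has_real_derivative f1 x) (at x)" and d2: "\<And>x. (f1 has_real_derivative f2 x) (at x)"
    and hol: "\<And>a. \<bar>f2 a - f2 z\<bar> \<le> L * \<bar>a - z\<bar> powr \<beta>" and b: "0 < \<beta>"
  shows "\<bar>f (z + t) - f z - f1 z * t - f2 z / 2 * t\<^sup>2\<bar> \<le> L / 2 * \<bar>t\<bar> powr (2 + \<beta>)"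
proof (cases "t = 0")
  case False
  have L: "0 \<le> L" using hol[of "z + 1"] by (simp add: order_trans[of 0])
  define F where "F = (\<lambda>k::nat. if k = 0 then f else if k = 1 then f1 else f2)"
  have "\<exists>w. (if z + t < z then z + t < w \<and> w < z else z < w \<and> w < z + t) \<and>
      f (z + t) = (\<Sum>k<2. F k z / fact k * (z + t - z) ^ k) + F 2 w / fact 2 * (z + t - z) ^ 2"
    by (rule Taylor[where a = "z - \<bar>t\<bar>" and b = "z + \<bar>t\<bar>"])
       (use False d1 d2 in \<open>auto simp: F_def less_Suc_eq numeral_2_eq_2\<close>)
  then obtain w where w: "if z + t < z then z + t < w \<and> w < z else z < w \<and> w < z + t"
    and e: "f (z + t) = f z + f1 z * t + f2 w / 2 * t\<^sup>2"
    by (auto simp: F_def numeral_2_eq_2)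
  have wz: "\<bar>w - z\<bar> \<le> \<bar>t\<bar>" using w by (auto split: if_splits)
  have "f (z + t) - f z - f1 z * t - f2 z / 2 * t\<^sup>2 = (f2 w - f2 z) / 2 * t\<^sup>2"
    unfolding e by (simp add: algebra_simps diff_divide_distrib)
  also have "\<bar>\<dots>\<bar> = \<bar>f2 w - f2 z\<bar> / 2 * t\<^sup>2" by (simp add: abs_mult)
  also have "\<dots> \<le> (L * \<bar>w - z\<bar> powr \<beta>) / 2 * t\<^sup>2"
    by (intro mult_right_mono divide_right_mono hol) auto
  also have "\<dots> \<le> (L * \<bar>t\<bar> powr \<beta>) / 2 * t\<^sup>2"
    using wz b L by (intro mult_right_mono divide_right_mono mult_left_mono powr_mono2) auto
  also have "\<dots> = L / 2 * (\<bar>t\<bar> powr 2 * \<bar>t\<bar> powr \<beta>)"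
    using False by simp
  also have "\<dots> = L / 2 * \<bar>t\<bar> powr (2 + \<beta>)" by (simp add: powr_add)
  finally show ?thesis .
qed simp

lemma heat_taylor:
  assumes s: "0 < s" and p: "2 < p" "p \<le> 3"
  shows "\<bar>heat s (z + t) - heat s z - nerf1 (z / sqrt s) / sqrt s * t - heat2 s z / 2 * t\<^sup>2\<bar>
     \<le> 3 / 2 * s powr (- p/2) * \<bar>t\<bar> powr p"
proof -
  have "\<bar>heat s (z + t) - heat s z - nerf1 (z / sqrt s) / sqrt s * t - heat2 s z / 2 * t\<^sup>2\<bar>
     \<le> (3 * s powr (- p/2)) / 2 * \<bar>t\<bar> powr (2 + (p - 2))"
  proof (rule taylor_holder[where ?f1.0 = "\<lambda>z. nerf1 (z / sqrt s) / sqrt s" and ?f2.0 = "heat2 s"])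
    fix x
    show "(heat s has_real_derivative nerf1 (x / sqrt s) / sqrt s) (at x)"
      using DERIV_chain2[OF nerf_deriv DERIV_cdivide[OF DERIV_ident, of "sqrt s"]] by (simp add: heat_def[abs_def])
    have "((\<lambda>z. nerf1 (z / sqrt s) / sqrt s) has_real_derivative (nerf2 (x / sqrt s) * (1 / sqrt s)) / sqrt s) (at x)"
      by (intro DERIV_cdivide DERIV_chain2[OF nerf1_deriv]) (auto intro!: derivative_eq_intros)
    then show "((\<lambda>z. nerf1 (z / sqrt s) / sqrt s) has_real_derivative heat2 s x) (at x)"
      using s by (simp add: heat2_def)
    show "\<bar>heat2 s x - heat2 s z\<bar> \<le> 3 * s powr (- p/2) * \<bar>x - z\<bar> powr (p - 2)" by (rule heat2_holder[OF s p])
  qed (use p in simp)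
  then show ?thesis by simp
qed

lemma scale_deriv:
  assumes "0 < s" shows "((\<lambda>s. z / sqrt s) has_real_derivative - (z / sqrt s) / (2 * s)) (at s)"
proof -
  have "((\<lambda>s. z / sqrt s) has_real_derivative (0 * sqrt s - z * (inverse (sqrt s) / 2)) / (sqrt s * sqrt s)) (at s)"
    by (rule DERIV_divide[OF DERIV_const DERIV_real_sqrt[OF assms]]) (use assms in simp)
  moreover have "(0 * sqrt s - z * (inverse (sqrt s) / 2)) / (sqrt s * sqrt s) = - (z / sqrt s) / (2 * s)"
  proof -
    have q: "sqrt s * sqrt s = s" using assms by simp
    show ?thesis unfolding q divide_inverse inverse_mult_distrib
      by (simp only: mult_zero_left diff_0 mult_minus_left mult_minus_right mult_ac)
  qed
  ultimately show ?thesis by simp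
qed

lemma heat_time_deriv:
  assumes "0 < s" shows "((\<lambda>s. heat s z) has_real_derivative heat2 s z / 2) (at s)"
proof -
  have "((\<lambda>s. heat s z) has_real_derivative nerf1 (z / sqrt s) * (- (z / sqrt s) / (2 * s))) (at s)"
    unfolding heat_def by (rule DERIV_chain2[OF nerf_deriv scale_deriv[OF assms]])
  then show ?thesis by (simp add: heat2_def nerf2_def algebra_simps)
qed

lemma heat2_time_deriv:
  assumes "0 < s"
  shows "((\<lambda>s. heat2 s z) has_real_derivative (- (nerf3 (z / sqrt s) * (z / sqrt s)) / 2 - nerf2 (z / sqrt s)) / s\<^sup>2) (at s)"
proof -
  have eq: "(A * (- q / (2 * s)) * s - B * 1) / (s * s) = (- (A * q) / 2 - B) / s\<^sup>2" for A B q
    using assms by (simp add: power2_eq_square)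
  have "((\<lambda>s. nerf2 (z / sqrt s) / s) has_real_derivative
     (nerf3 (z / sqrt s) * (- (z / sqrt s) / (2 * s)) * s - nerf2 (z / sqrt s) * 1) / (s * s)) (at s)"
    by (rule DERIV_divide[OF DERIV_chain2[OF nerf2_deriv scale_deriv[OF assms]] DERIV_ident]) (use assms in blast)
  then show ?thesis unfolding heat2_def eq .
qed

lemma heat2_time_lip:
  assumes s: "0 < s" "s < t" shows "\<bar>heat2 t z - heat2 s z\<bar> \<le> 3 * (t - s) / s\<^sup>2"
proof -
  let ?d = "\<lambda>s. (- (nerf3 (z / sqrt s) * (z / sqrt s)) / 2 - nerf2 (z / sqrt s)) / s\<^sup>2"
  have "\<exists>w>s. w < t \<and> heat2 t z - heat2 s z = (t - s) * ?d w"
  proof (rule MVT2[OF s(2)])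
    fix r assume "s \<le> r" "r \<le> t"
    then show "((\<lambda>s. heat2 s z) has_real_derivative ?d r) (at r)" using s by (intro heat2_time_deriv) linarith
  qed
  then obtain w where w: "s < w" "w < t" "heat2 t z - heat2 s z = (t - s) * ?d w" by blast
  have "\<bar>- (nerf3 (z / sqrt w) * (z / sqrt w)) / 2 - nerf2 (z / sqrt w)\<bar> \<le> 3"
  proof -
    have "\<bar>- A / 2 - B\<bar> \<le> 3" if "\<bar>A\<bar> \<le> 3" "\<bar>B\<bar> \<le> 1" for A B :: real using that by linarith
    then show ?thesis using nerf3_r_le nerf2_le by blast
  qed
  then have "\<bar>?d w\<bar> \<le> 3 / w\<^sup>2" by (simp add: divide_right_mono)
  also have "\<dots> \<le> 3 / s\<^sup>2" using w s by (intro divide_left_mono power_mono) auto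
  finally have "(t - s) * \<bar>?d w\<bar> \<le> (t - s) * (3 / s\<^sup>2)" using s by (intro mult_left_mono) auto
  moreover have "\<bar>t - s\<bar> = t - s" using s by simp
  moreover have "(t - s) * (3 / s\<^sup>2) = 3 * (t - s) / s\<^sup>2" by simp
  ultimately show ?thesis by (simp only: w(3) abs_mult)
qed

text \<open>By the heat equation, half of \<open>heat2\<close> is the rate of change in
  \<open>s\<close>, so an extra variance \<open>d\<close> is accounted for up to an error of second
  order in \<open>d / s\<close>.\<close>

lemma heat_time_taylor:
  assumes s: "0 < s" "0 < d" shows "\<bar>heat s z + d / 2 * heat2 s z - heat (s + d) z\<bar> \<le> 3 / 2 * d\<^sup>2 / s\<^sup>2"
proof -
  have "\<exists>w>s. w < s + d \<and> heat (s + d) z - heat s z = (s + d - s) * (heat2 w z / 2)"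
  proof (rule MVT2)
    fix r assume "s \<le> r" "r \<le> s + d"
    then show "((\<lambda>s. heat s z) has_real_derivative heat2 r z / 2) (at r)" using s by (intro heat_time_deriv) linarith
  qed (use s in simp)
  then obtain w where w: "s < w" "w < s + d" "heat (s + d) z - heat s z = (s + d - s) * (heat2 w z / 2)" by blast
  have "heat s z + d / 2 * heat2 s z - heat (s + d) z = - (d / 2 * (heat2 w z - heat2 s z))"
    using w(3) by (simp add: algebra_simps)
  also have "\<bar>\<dots>\<bar> = d / 2 * \<bar>heat2 w z - heat2 s z\<bar>" using s by (simp add: abs_mult)
  also have "\<dots> \<le> d / 2 * (3 * (w - s) / s\<^sup>2)"
    using s w by (intro mult_left_mono heat2_time_lip) auto
  also have "\<dots> \<le> d / 2 * (3 * d / s\<^sup>2)"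
    using s w by (intro mult_left_mono divide_right_mono) auto
  finally show ?thesis by (simp add: power2_eq_square)
qed

lemma heat2_le: assumes "0 < s" shows "\<bar>heat2 s z\<bar> \<le> 1 / s"
  using nerf2_le[of "z / sqrt s"] assms by (simp add: heat2_def divide_right_mono)

text \<open>Errors of order \<open>t\<close> and \<open>t\<^sup>2\<close> are too large for the
  penalty, which tolerates only powers of order \<open>p\<close>. Below a threshold they are at most
  \<delta>, above it they are dominated by \<open>t powr p\<close>. So a fixed \<delta> is paid,
  once, in comparisons at the boundary and at the two ends of the time interval.\<close>

lemma small_powers:
  fixes p \<delta> :: real
  assumes "0 < \<delta>" "2 < p"
  obtains C where "0 \<le> C" "\<And>t. 0 \<le> t \<Longrightarrow> t + t\<^sup>2 \<le> \<delta> + C * t powr p"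
proof -
  define \<eta> where "\<eta> = min 1 (\<delta> / 2)"
  have e: "0 < \<eta>" "\<eta> \<le> 1" "2 * \<eta> \<le> \<delta>" using assms by (auto simp: \<eta>_def)
  show thesis
  proof
    show "0 \<le> \<eta> powr (1 - p) + \<eta> powr (2 - p)" by simp
    fix t :: real assume t: "0 \<le> t"
    show "t + t\<^sup>2 \<le> \<delta> + (\<eta> powr (1 - p) + \<eta> powr (2 - p)) * t powr p"
    proof (cases "t \<le> \<eta>")
      case True
      have "t\<^sup>2 \<le> t * 1" unfolding power2_eq_square using t True e by (intro mult_left_mono) auto
      moreover have "0 \<le> (\<eta> powr (1 - p) + \<eta> powr (2 - p)) * t powr p" by simp
      ultimately show ?thesis using True e by linarith
    next
      case False
      then have t0: "0 < t" using e by simp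
      have 1: "t = t powr (1 - p) * t powr p" using t0 by (simp flip: powr_add)
      have 2: "t\<^sup>2 = t powr (2 - p) * t powr p" using t0 by (simp flip: powr_add)
      have "t \<le> \<eta> powr (1 - p) * t powr p"
        by (subst 1) (use False e assms in \<open>intro mult_right_mono powr_mono2'; auto\<close>)
      moreover have "t\<^sup>2 \<le> \<eta> powr (2 - p) * t powr p"
        by (subst 2) (use False e assms in \<open>intro mult_right_mono powr_mono2'; auto\<close>)
      ultimately show ?thesis using assms unfolding distrib_right by linarith
    qed
  qed
qed

lemma nerf_measurable [measurable]: "nerf \<in> borel_measurable borel"
  using nerf_deriv by (intro borel_measurable_continuous_onI continuous_at_imp_continuous_on ballI DERIV_isCont)

lemma nerf2_measurable [measurable]: "nerf2 \<in> borel_measurable borel"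
  using nerf2_deriv by (intro borel_measurable_continuous_onI continuous_at_imp_continuous_on ballI DERIV_isCont)

lemma heat_measurable [measurable]: "heat s \<in> borel_measurable borel" "heat2 s \<in> borel_measurable borel"
  unfolding heat_def[abs_def] heat2_def[abs_def] by measurable

section \<open>An approximate solution of the killed equation\<close>

context affine_law begin

text \<open>The second term is a corrector: the mean change of \<open>kap\<close> along the chain
  cancels the dependence of the conditional variance on \<open>x\<close>. The shift \<open>q\<close>
  moves the zero of \<open>heat\<close> below the boundary; the lower barrier uses
  \<open>q = 0\<close>, the upper one a positive shift.\<close>

definition psi :: "real \<Rightarrow> real \<Rightarrow> real \<Rightarrow> real \<Rightarrow> real" where
  "psi s q x y = heat s (y + \<rho> * x + q) + heat2 s (y + \<rho> * x + q) / 2 * kap x"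

lemma heat_abs_le: "\<bar>heat s z\<bar> \<le> \<bar>z\<bar> / sqrt s" if "0 < s"
  using nerf_abs_le[of "z / sqrt s"] that by (simp add: heat_def abs_divide)

lemma tame_psi: assumes s: "0 < s" shows "tame (psi s q)"
proof -
  obtain C where C: "0 \<le> C" "\<And>x. \<bar>kap x\<bar> \<le> C * (1 + \<bar>x\<bar>)\<^sup>2" by (metis kap_bound)
  have "tame (\<lambda>x y. heat s (y + \<rho> * x + q))"
  proof (rule tame_linear[where C = "(1 + \<bar>\<rho>\<bar> + \<bar>q\<bar>) / sqrt s"])
    fix x y
    have "0 \<le> \<bar>\<rho>\<bar> * \<bar>y\<bar>" "0 \<le> \<bar>q\<bar> * \<bar>x\<bar>" "0 \<le> \<bar>q\<bar> * \<bar>y\<bar>" by simp_all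
    then have "\<bar>y + \<rho> * x + q\<bar> \<le> (1 + \<bar>\<rho>\<bar> + \<bar>q\<bar>) * (1 + \<bar>x\<bar> + \<bar>y\<bar>)"
      using abs_z_le[of y x] abs_triangle_ineq[of "y + \<rho> * x" q] unfolding distrib_left distrib_right by linarith
    then show "\<bar>heat s (y + \<rho> * x + q)\<bar> \<le> (1 + \<bar>\<rho>\<bar> + \<bar>q\<bar>) / sqrt s * (1 + \<bar>x\<bar> + \<bar>y\<bar>)"
      using heat_abs_le[OF s, of "y + \<rho> * x + q"] divide_right_mono[of "\<bar>y + \<rho> * x + q\<bar>" _ "sqrt s"] s by fastforce
  qed measurable
  moreover have "tame (\<lambda>x y. heat2 s (y + \<rho> * x + q) / 2 * kap x)"
  proof (rule tame_quadratic[where C = "1 / s / 2 * C"])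
    fix x y
    have "\<bar>heat2 s (y + \<rho> * x + q) / 2 * kap x\<bar> \<le> 1 / s / 2 * (C * (1 + \<bar>x\<bar>)\<^sup>2)"
      unfolding abs_mult using heat2_le[OF s] C s by (intro mult_mono) (auto simp: abs_divide divide_right_mono)
    also have "\<dots> \<le> 1 / s / 2 * (C * (1 + \<bar>x\<bar> + \<bar>y\<bar>)\<^sup>2)"
      using s C by (intro mult_left_mono power_mono) auto
    finally show "\<bar>heat2 s (y + \<rho> * x + q) / 2 * kap x\<bar> \<le> 1 / s / 2 * C * (1 + \<bar>x\<bar> + \<bar>y\<bar>)\<^sup>2" by simp
  qed measurable
  ultimately show ?thesis unfolding psi_def[abs_def] by (rule tame_add)
qed

text \<open>The quadratic \<open>kap\<close> solves the Poisson equation for the conditional variance of the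
  martingale increments, so the second order term of the Taylor expansion averages to \<open>v\<close>.\<close>

lemma psi_step_space:
  obtains C where "0 \<le> C" "\<And>s q x y. 0 < s \<Longrightarrow>
    \<bar>trans_op (psi s q) x y - (heat s (y + \<rho> * x + q) + heat2 s (y + \<rho> * x + q) / 2 * (kap x + v))\<bar>
      \<le> C * s powr (- p/2) * (1 + \<bar>x\<bar>) powr p"
proof -
  obtain C where C: "0 \<le> C" "\<And>x. \<bar>kap x\<bar> \<le> C * (1 + \<bar>x\<bar>)\<^sup>2" by (metis kap_bound)
  define c where "c = 2 / (1 - m)"
  have c: "0 < c" using one_minus_m by (simp add: c_def)
  define C' where "C' = 3 / 2 * c powr p + 3 / 2 * (c powr (p - 2) * C)"
  have C': "0 \<le> C'" using C by (simp add: C'_def)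
  show thesis
  proof
    show "0 \<le> C' * K0" using C' K0_ge by simp
    fix s q x y :: real assume s: "0 < s"
    define Z where "Z = y + \<rho> * x + q"
    define t where "t = (\<lambda>w::real \<times> real. incr x (fst w * x + snd w))"
    define k where "k = (\<lambda>w::real \<times> real. kap (fst w * x + snd w))"
    define G where "G = (\<lambda>w::real \<times> real. psi s q (fst w * x + snd w) (y + (fst w * x + snd w)))"
    define D where "D = nerf1 (Z / sqrt s) / sqrt s"
    define M where "M = (\<lambda>w. heat s Z + D * t w + heat2 s Z / 2 * (t w)\<^sup>2 + heat2 s Z / 2 * k w)"
    have iG: "integrable \<mu> G" unfolding G_def by (rule tame_integrable[OF tame_psi[OF s]])
    have [simp]: "integrable \<mu> t" "integrable \<mu> (\<lambda>w. (t w)\<^sup>2)" "integrable \<mu> k"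
      by (simp_all add: t_def k_def)
    have iM: "integrable \<mu> M" unfolding M_def by simp
    have "(\<integral>w. M w \<partial>\<mu>) = heat s Z + D * (\<integral>w. t w \<partial>\<mu>) + heat2 s Z / 2 * (\<integral>w. (t w)\<^sup>2 \<partial>\<mu>) + heat2 s Z / 2 * (\<integral>w. k w \<partial>\<mu>)"
      unfolding M_def by simp
    also have "\<dots> = heat s Z + heat2 s Z / 2 * (kap x + v)"
      unfolding t_def k_def incr_mean incr_sq_mean kap_mean by (simp add: algebra_simps)
    finally have M: "(\<integral>w. M w \<partial>\<mu>) = heat s Z + heat2 s Z / 2 * (kap x + v)" .
    have G: "G w = heat s (Z + t w) + heat2 s (Z + t w) / 2 * k w" for w
      unfolding G_def psi_def z_step[where x = x] t_def k_def Z_def by (simp add: add_ac)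
    have bnd: "\<bar>G w - M w\<bar> \<le> C' * s powr (- p/2) * (1 + \<bar>x\<bar>) powr p * (1 + \<bar>fst w\<bar> + \<bar>snd w\<bar>) powr p" for w
    proof -
      \<comment> \<open>This product dominates the old and the new position, so the increment is of
        order \<open>u\<close>, \<open>kap\<close> of order \<open>u\<^sup>2\<close>, and both
        errors become multiples of \<open>u powr p\<close>.\<close>
      define u where "u = (1 + \<bar>x\<bar>) * (1 + \<bar>fst w\<bar> + \<bar>snd w\<bar>)"
      define x1 where "x1 = fst w * x + snd w"
      have u0: "0 < u" by (simp add: u_def add_pos_nonneg)
      have "\<bar>x1\<bar> \<le> \<bar>x\<bar> * \<bar>fst w\<bar> + \<bar>snd w\<bar>" unfolding x1_def by (metis abs_mult abs_triangle_ineq mult.commute)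
      moreover have "0 \<le> \<bar>x\<bar> * \<bar>snd w\<bar>" by simp
      ultimately have x1: "1 + \<bar>x1\<bar> + \<bar>x\<bar> \<le> u" unfolding u_def distrib_left distrib_right by linarith
      have "\<bar>m * x\<bar> \<le> 1 * \<bar>x\<bar>" unfolding abs_mult using m_bounds by (intro mult_right_mono) auto
      then have "\<bar>x1 - m * x\<bar> \<le> 2 * u" using x1 by linarith
      then have "\<bar>x1 - m * x\<bar> / (1 - m) \<le> 2 * u / (1 - m)" using one_minus_m by (intro divide_right_mono) auto
      then have tb: "\<bar>t w\<bar> \<le> c * u"
        using one_minus_m by (simp add: t_def incr_def c_def x1_def abs_divide)
      have kb: "\<bar>k w\<bar> \<le> C * u\<^sup>2"
      proof -
        have "\<bar>k w\<bar> \<le> C * (1 + \<bar>x1\<bar>)\<^sup>2" unfolding k_def x1_def by (rule C(2))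
        also have "\<dots> \<le> C * u\<^sup>2" using x1 C by (intro mult_left_mono power_mono) auto
        finally show ?thesis .
      qed
      \<comment> \<open>Besides the Taylor error there is the error of freezing the factor of the
        corrector at the old point. There the Hoelder exponent \<open>p - 2\<close> of
        \<open>heat2\<close> and the exponent 2 of \<open>kap\<close> add up to \<open>p\<close>
        again.\<close>
      have e: "G w - M w = (heat s (Z + t w) - heat s Z - D * t w - heat2 s Z / 2 * (t w)\<^sup>2) + (heat2 s (Z + t w) - heat2 s Z) / 2 * k w"
        unfolding G M_def by (simp add: algebra_simps diff_divide_distrib)
      have "\<bar>heat s (Z + t w) - heat s Z - D * t w - heat2 s Z / 2 * (t w)\<^sup>2\<bar> \<le> 3 / 2 * s powr (- p/2) * \<bar>t w\<bar> powr p"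
        unfolding D_def by (rule heat_taylor[OF s p_gt p_le])
      also have "\<dots> \<le> 3 / 2 * s powr (- p/2) * (c * u) powr p"
        using tb p_gt by (intro mult_left_mono powr_mono2) auto
      also have "\<dots> = s powr (- p/2) * (3 / 2 * c powr p) * u powr p" by (simp add: powr_mult)
      finally have 1: "\<bar>heat s (Z + t w) - heat s Z - D * t w - heat2 s Z / 2 * (t w)\<^sup>2\<bar> \<le> s powr (- p/2) * (3 / 2 * c powr p) * u powr p" .
      have "\<bar>heat2 s (Z + t w) - heat2 s Z\<bar> \<le> 3 * s powr (- p/2) * \<bar>Z + t w - Z\<bar> powr (p - 2)"
        by (rule heat2_holder[OF s p_gt p_le])
      also have "\<dots> \<le> 3 * s powr (- p/2) * (c * u) powr (p - 2)"
        using tb p_gt by (intro mult_left_mono powr_mono2) auto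
      finally have "\<bar>(heat2 s (Z + t w) - heat2 s Z) / 2 * k w\<bar> \<le> (3 * s powr (- p/2) * (c * u) powr (p - 2)) / 2 * (C * u\<^sup>2)"
        unfolding abs_mult using kb C by (intro mult_mono) auto
      also have "\<dots> = s powr (- p/2) * (3 / 2 * (c powr (p - 2) * C)) * (u powr (p - 2) * u powr 2)"
        using u0 c by (simp add: powr_mult)
      also have "u powr (p - 2) * u powr 2 = u powr p" using u0 by (simp only: powr_add[symmetric]) simp
      finally have 2: "\<bar>(heat2 s (Z + t w) - heat2 s Z) / 2 * k w\<bar> \<le> s powr (- p/2) * (3 / 2 * (c powr (p - 2) * C)) * u powr p" .
      have "\<bar>G w - M w\<bar> \<le> s powr (- p/2) * (3 / 2 * c powr p) * u powr p + s powr (- p/2) * (3 / 2 * (c powr (p - 2) * C)) * u powr p"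
        unfolding e using 1 2 by (rule order_trans[OF abs_triangle_ineq add_mono])
      also have "\<dots> = C' * s powr (- p/2) * u powr p" by (simp add: C'_def algebra_simps)
      finally show ?thesis by (simp add: u_def powr_mult mult_ac)
    qed
    have "trans_op (psi s q) x y - (heat s Z + heat2 s Z / 2 * (kap x + v)) = (\<integral>w. G w - M w \<partial>\<mu>)"
      using iG iM M by (simp add: trans_op_def G_def)
    also have "\<bar>\<dots>\<bar> \<le> (\<integral>w. \<bar>G w - M w\<bar> \<partial>\<mu>)" by (rule integral_abs_bound)
    also have "\<dots> \<le> (\<integral>w. C' * s powr (- p/2) * (1 + \<bar>x\<bar>) powr p * (1 + \<bar>fst w\<bar> + \<bar>snd w\<bar>) powr p \<partial>\<mu>)"
      by (intro integral_mono integrable_abs Bochner_Integration.integrable_diff iG iM integrable_mult_right integrable_weight bnd)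
    also have "\<dots> = C' * K0 * s powr (- p/2) * (1 + \<bar>x\<bar>) powr p" by (simp add: K0_def mult_ac)
    finally show "\<bar>trans_op (psi s q) x y - (heat s (y + \<rho> * x + q) + heat2 s (y + \<rho> * x + q) / 2 * (kap x + v))\<bar>
      \<le> C' * K0 * s powr (- p/2) * (1 + \<bar>x\<bar>) powr p" by (simp add: Z_def)
  qed
qed

text \<open>The term \<open>heat2 * v / 2\<close> left over by the space step is the first order
  effect of raising \<open>s\<close> by \<open>v\<close>: one step of the walk consumes variance
  \<open>v\<close>. The condition \<open>1 \<le> s\<close> lets the time errors, of order
  \<open>1 / s\<^sup>2\<close>, be absorbed by \<open>s powr (- p/2)\<close>.\<close>

lemma psi_step:
  obtains C where "0 \<le> C" "\<And>s q x y. 1 \<le> s \<Longrightarrow>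
    \<bar>trans_op (psi s q) x y - psi (s + v) q x y\<bar> \<le> C * s powr (- p/2) * (1 + \<bar>x\<bar>) powr p"
proof -
  obtain C1 where C1: "0 \<le> C1" "\<And>s q x y. 0 < s \<Longrightarrow>
    \<bar>trans_op (psi s q) x y - (heat s (y + \<rho> * x + q) + heat2 s (y + \<rho> * x + q) / 2 * (kap x + v))\<bar>
      \<le> C1 * s powr (- p/2) * (1 + \<bar>x\<bar>) powr p" by (metis psi_step_space)
  obtain C where C: "0 \<le> C" "\<And>x. \<bar>kap x\<bar> \<le> C * (1 + \<bar>x\<bar>)\<^sup>2" by (metis kap_bound)
  define C2 where "C2 = 3 / 2 * v\<^sup>2 + 3 / 2 * v * C"
  have C2: "0 \<le> C2" using v_pos C by (simp add: C2_def)
  show thesis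
  proof
    show "0 \<le> C1 + C2" using C1 C2 by simp
    fix s q x y :: real assume s: "1 \<le> s"
    define Z where "Z = y + \<rho> * x + q"
    define W where "W = (1 + \<bar>x\<bar>) powr p"
    have W2: "(1 + \<bar>x\<bar>)\<^sup>2 \<le> W"
    proof -
      have "(1 + \<bar>x\<bar>)\<^sup>2 = (1 + \<bar>x\<bar>) powr 2" by (rule powr_numeral[symmetric]) simp
      also have "\<dots> \<le> W" unfolding W_def using p_gt by (intro powr_mono) auto
      finally show ?thesis .
    qed
    have W1: "1 \<le> W" unfolding W_def using p_gt by (intro ge_one_powr_ge_zero) auto
    have s2: "1 / s\<^sup>2 \<le> s powr (- p/2)"
    proof -
      have "1 / s\<^sup>2 = s powr (-2)" using s by (simp add: powr_minus divide_inverse)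
      also have "\<dots> \<le> s powr (- p/2)" using s p_le by (intro powr_mono) auto
      finally show ?thesis .
    qed
    have a: "\<bar>heat s Z + v / 2 * heat2 s Z - heat (s + v) Z\<bar> \<le> 3 / 2 * v\<^sup>2 * (1 / s\<^sup>2) * W"
    proof -
      have "\<bar>heat s Z + v / 2 * heat2 s Z - heat (s + v) Z\<bar> \<le> 3 / 2 * v\<^sup>2 * (1 / s\<^sup>2) * 1"
        using heat_time_taylor[of s v Z] s v_pos by simp
      also have "\<dots> \<le> 3 / 2 * v\<^sup>2 * (1 / s\<^sup>2) * W" using W1 by (intro mult_left_mono) auto
      finally show ?thesis .
    qed
    have b: "\<bar>(heat2 s Z - heat2 (s + v) Z) / 2 * kap x\<bar> \<le> 3 / 2 * v * C * (1 / s\<^sup>2) * W"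
    proof -
      have "\<bar>heat2 (s + v) Z - heat2 s Z\<bar> \<le> 3 * v / s\<^sup>2" using heat2_time_lip[of s "s + v" Z] s v_pos by simp
      then have "\<bar>(heat2 s Z - heat2 (s + v) Z) / 2\<bar> \<le> 3 * v / s\<^sup>2 / 2" by (simp add: abs_minus_commute)
      then have "\<bar>(heat2 s Z - heat2 (s + v) Z) / 2 * kap x\<bar> \<le> 3 * v / s\<^sup>2 / 2 * (C * (1 + \<bar>x\<bar>)\<^sup>2)"
        unfolding abs_mult using C v_pos by (intro mult_mono) auto
      also have "\<dots> \<le> 3 * v / s\<^sup>2 / 2 * (C * W)" using W2 C v_pos by (intro mult_left_mono) auto
      finally show ?thesis by simp
    qed
    have "heat s Z + heat2 s Z / 2 * (kap x + v) - psi (s + v) q x y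
       = (heat s Z + v / 2 * heat2 s Z - heat (s + v) Z) + (heat2 s Z - heat2 (s + v) Z) / 2 * kap x"
      by (simp add: psi_def Z_def algebra_simps diff_divide_distrib)
    also have "\<bar>\<dots>\<bar> \<le> 3 / 2 * v\<^sup>2 * (1 / s\<^sup>2) * W + 3 / 2 * v * C * (1 / s\<^sup>2) * W"
      using a b by (rule order_trans[OF abs_triangle_ineq add_mono])
    also have "\<dots> = C2 * W * (1 / s\<^sup>2)" by (simp add: C2_def algebra_simps add_divide_distrib)
    also have "\<dots> \<le> C2 * W * s powr (- p/2)" using s2 C2 W1 by (intro mult_left_mono) auto
    finally have "\<bar>heat s Z + heat2 s Z / 2 * (kap x + v) - psi (s + v) q x y\<bar> \<le> C2 * s powr (- p/2) * W" by (simp add: mult_ac)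
    moreover have "\<bar>trans_op (psi s q) x y - (heat s Z + heat2 s Z / 2 * (kap x + v))\<bar> \<le> C1 * s powr (- p/2) * W"
      unfolding Z_def W_def using C1(2) s by simp
    ultimately show "\<bar>trans_op (psi s q) x y - psi (s + v) q x y\<bar> \<le> (C1 + C2) * s powr (- p/2) * (1 + \<bar>x\<bar>) powr p"
      unfolding W_def[symmetric] distrib_right by linarith
  qed
qed

text \<open>With \<open>t = (1 + \<bar>x\<bar>) / sqrt n\<close> the left side is of order
  \<open>t + t\<^sup>2\<close>: the linear part comes from the term \<open>\<rho> * x\<close> of the
  martingale, the square from the corrector, and \<open>small_powers\<close> converts both. The
  summand with \<open>\<bar>x\<bar>\<close> is a reserve, used to pay for the overshoot in the upper
  comparison.\<close>

lemma psi_close: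
  assumes d: "0 < \<delta>" and c: "0 < c"
  obtains C where "0 \<le> C" "\<And>n s q x y. 1 \<le> n \<Longrightarrow> c * real n \<le> s \<Longrightarrow>
    \<bar>psi s q x y - nerf ((y + q) / sqrt s)\<bar> + \<bar>x\<bar> / sqrt s \<le> \<delta> + C * real n powr (- p/2) * (1 + \<bar>x\<bar>) powr p"
proof -
  obtain Ck where C: "0 \<le> Ck" "\<And>x. \<bar>kap x\<bar> \<le> Ck * (1 + \<bar>x\<bar>)\<^sup>2" by (metis kap_bound)
  define A where "A = (\<bar>\<rho>\<bar> + 1) / sqrt c + Ck / c"
  have A: "0 < A" using c C by (simp add: A_def add_pos_nonneg)
  obtain B where B: "0 \<le> B" "\<And>t. 0 \<le> t \<Longrightarrow> t + t\<^sup>2 \<le> \<delta> / A + B * t powr p"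
    using small_powers[of "\<delta> / A" p] d A p_gt by auto
  show thesis
  proof
    show "0 \<le> A * B" using A B by simp
    fix n :: nat and s q x y :: real assume n: "1 \<le> n" and s: "c * real n \<le> s"
    have cn: "0 < c * real n" using c n by simp
    then have s0: "0 < s" using s by linarith
    define t where "t = (1 + \<bar>x\<bar>) / sqrt n"
    have t: "0 \<le> t" by (simp add: t_def)
    have ss: "sqrt c * sqrt n \<le> sqrt s" using s by (simp flip: real_sqrt_mult)
    have 1: "(\<bar>\<rho>\<bar> + 1) * \<bar>x\<bar> / sqrt s \<le> (\<bar>\<rho>\<bar> + 1) / sqrt c * t"
    proof -
      have "(\<bar>\<rho>\<bar> + 1) * \<bar>x\<bar> / sqrt s \<le> (\<bar>\<rho>\<bar> + 1) * (1 + \<bar>x\<bar>) / (sqrt c * sqrt n)"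
        using ss c n by (intro frac_le) (auto intro!: mult_nonneg_nonneg mult_left_mono mult_pos_pos)
      then show ?thesis by (simp add: t_def)
    qed
    have 2: "Ck * (1 + \<bar>x\<bar>)\<^sup>2 / s \<le> Ck / c * t\<^sup>2"
    proof -
      have "Ck * (1 + \<bar>x\<bar>)\<^sup>2 / s \<le> Ck * (1 + \<bar>x\<bar>)\<^sup>2 / (c * real n)"
        using s cn C by (intro divide_left_mono) auto
      also have "\<dots> = Ck / c * t\<^sup>2" using n by (simp add: t_def power_divide)
      finally show ?thesis .
    qed
    have "psi s q x y - nerf ((y + q) / sqrt s) = (heat s (y + \<rho> * x + q) - heat s (y + q)) + heat2 s (y + \<rho> * x + q) / 2 * kap x"
      by (simp add: psi_def heat_def)
    also have "\<bar>\<dots>\<bar> \<le> \<bar>\<rho>\<bar> * \<bar>x\<bar> / sqrt s + Ck * (1 + \<bar>x\<bar>)\<^sup>2 / s"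
    proof (rule order_trans[OF abs_triangle_ineq add_mono])
      have "\<bar>heat s (y + \<rho> * x + q) - heat s (y + q)\<bar> \<le> \<bar>(y + \<rho> * x + q) / sqrt s - (y + q) / sqrt s\<bar>"
        unfolding heat_def by (rule nerf_lip)
      also have "\<dots> = \<bar>\<rho> * x\<bar> / sqrt s" using s0 by (simp flip: diff_divide_distrib)
      finally show "\<bar>heat s (y + \<rho> * x + q) - heat s (y + q)\<bar> \<le> \<bar>\<rho>\<bar> * \<bar>x\<bar> / sqrt s" by (simp add: abs_mult)
      have "\<bar>heat2 s (y + \<rho> * x + q) / 2 * kap x\<bar> \<le> (1 / s) * (Ck * (1 + \<bar>x\<bar>)\<^sup>2)"
      proof -
        have "\<bar>heat2 s (y + \<rho> * x + q) / 2\<bar> \<le> \<bar>heat2 s (y + \<rho> * x + q)\<bar>" by simp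
        then show ?thesis
          unfolding abs_mult using heat2_le[OF s0, of "y + \<rho> * x + q"] C s0 by (intro mult_mono) auto
      qed
      then show "\<bar>heat2 s (y + \<rho> * x + q) / 2 * kap x\<bar> \<le> Ck * (1 + \<bar>x\<bar>)\<^sup>2 / s" by simp
    qed
    finally have "\<bar>psi s q x y - nerf ((y + q) / sqrt s)\<bar> + \<bar>x\<bar> / sqrt s \<le> (\<bar>\<rho>\<bar> + 1) * \<bar>x\<bar> / sqrt s + Ck * (1 + \<bar>x\<bar>)\<^sup>2 / s"
      by (simp add: distrib_right add_divide_distrib)
    also have "\<dots> \<le> (\<bar>\<rho>\<bar> + 1) / sqrt c * t + Ck / c * t\<^sup>2" using 1 2 by (rule add_mono)
    also have "\<dots> \<le> A * t + A * t\<^sup>2"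
      using t c C by (intro add_mono mult_right_mono) (auto simp: A_def)
    also have "\<dots> = A * (t + t\<^sup>2)" by (simp add: distrib_left)
    also have "\<dots> \<le> A * (\<delta> / A + B * t powr p)" using A by (intro mult_left_mono B t) auto
    also have "\<dots> = \<delta> + A * B * t powr p" using A by (simp add: distrib_left)
    also have "t powr p = real n powr (- p/2) * (1 + \<bar>x\<bar>) powr p"
    proof -
      have "sqrt (real n) powr p = real n powr (p/2)"
        using n by (simp only: powr_half_sqrt[symmetric] of_nat_0_le_iff powr_powr) simp
      moreover have "t powr p = (1 + \<bar>x\<bar>) powr p / sqrt (real n) powr p"
        unfolding t_def by (rule powr_divide)
      moreover have "real n powr (- p/2) = 1 / real n powr (p/2)"
        using powr_minus_divide[of "real n" "p/2"] by simp
      ultimately show ?thesis by simp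
    qed
    finally show "\<bar>psi s q x y - nerf ((y + q) / sqrt s)\<bar> + \<bar>x\<bar> / sqrt s \<le> \<delta> + A * B * real n powr (- p/2) * (1 + \<bar>x\<bar>) powr p"
      by (simp add: mult_ac)
  qed
qed

text \<open>Discrete comparison principle: as the operator is monotone, a one-step inequality
  propagates to the whole time interval. The index \<open>k\<close> counts elapsed steps, so the
  claim compares time 0 with the terminal function.\<close>

lemma sub_solution:
  assumes "\<And>k. k \<le> n \<Longrightarrow> tame (T k)" "\<And>k x y. k < n \<Longrightarrow> 0 < y \<Longrightarrow> T k x y \<le> kill_op (T (Suc k)) x y" "0 < y"
  shows "T 0 x y \<le> (kill_op ^^ n) (T n) x y"
  using assms
proof (induction n)
  case (Suc n)
  have "T 0 x y \<le> (kill_op ^^ n) (T n) x y" using Suc by simp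
  also have "\<dots> \<le> (kill_op ^^ n) (kill_op (T (Suc n))) x y"
    using Suc.prems by (intro kill_pow_mono tame_kill) auto
  finally show ?case by (simp add: kill_pow_Suc del: funpow.simps)
qed simp

lemma super_solution:
  assumes "\<And>k. k \<le> n \<Longrightarrow> tame (T k)" "\<And>k x y. k < n \<Longrightarrow> 0 < y \<Longrightarrow> kill_op (T (Suc k)) x y \<le> T k x y" "0 < y"
  shows "(kill_op ^^ n) (T n) x y \<le> T 0 x y"
  using assms
proof (induction n)
  case (Suc n)
  have "(kill_op ^^ n) (kill_op (T (Suc n))) x y \<le> (kill_op ^^ n) (T n) x y"
    using Suc.prems by (intro kill_pow_mono tame_kill) auto
  also have "\<dots> \<le> T 0 x y" using Suc by simp
  finally show ?case by (simp add: kill_pow_Suc del: funpow.simps)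
qed simp

section \<open>Survival at the diffusive scale\<close>

definition wt :: "real \<Rightarrow> real" where "wt x = (1 + \<bar>x\<bar>) powr p"

text \<open>The penalty \<open>L\<close> in the proof absorbs the errors of the step and exit estimates of \<open>psi\<close>; with it
  \<open>psi\<close> becomes an exact sub- or supersolution of the killed equation.\<close>

lemma survival_raw:
  assumes d: "0 < \<delta>" "\<delta> < 1" and \<delta>1: "0 < \<delta>1"
  obtains C where "0 \<le> C"
    "\<And>n x y. 1 \<le> n \<Longrightarrow> 1 \<le> v * \<delta>1 * real n \<Longrightarrow> 0 < y \<Longrightarrow>
       nerf (y / sqrt (v * (1 + \<delta>1) * real n)) - 2 * \<delta> - C * (real n powr (- p/2) * (wt x + real n))
         \<le> (kill_op ^^ n) (\<lambda>x y. 1) x y"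
    "\<And>n x y q \<gamma>. 1 \<le> n \<Longrightarrow> 1 \<le> v * \<delta>1 * real n \<Longrightarrow> 0 < y \<Longrightarrow> 0 \<le> q \<Longrightarrow> 0 \<le> \<gamma> \<Longrightarrow>
        1 - \<gamma> \<le> nerf (q / sqrt (v * \<delta>1 * real n)) \<Longrightarrow>
       (kill_op ^^ n) (\<lambda>x y. 1) x y \<le>
       nerf ((y + q) / sqrt (v * (1 + \<delta>1) * real n)) + 2 * \<delta> + \<gamma> + C * (real n powr (- p/2) * (wt x + real n))"
proof -
  define c where "c = v * \<delta>1"
  have c: "0 < c" using v_pos \<delta>1 by (simp add: c_def)
  obtain CE where CE: "0 \<le> CE" and close: "\<And>n s q x y. 1 \<le> n \<Longrightarrow> c * real n \<le> s \<Longrightarrow>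
    \<bar>psi s q x y - nerf ((y + q) / sqrt s)\<bar> + \<bar>x\<bar> / sqrt s \<le> \<delta> + CE * real n powr (- p/2) * (1 + \<bar>x\<bar>) powr p"
    using psi_close[OF d(1) c] by metis
  obtain C1 where C1: "0 \<le> C1" and step: "\<And>s q x y. 1 \<le> s \<Longrightarrow>
    \<bar>trans_op (psi s q) x y - psi (s + v) q x y\<bar> \<le> C1 * s powr (- p/2) * (1 + \<bar>x\<bar>) powr p"
    by (metis psi_step)
  obtain l Cw where l: "0 \<le> l" "l < 1" and Cw: "0 \<le> Cw"
    and drift: "\<And>x y. trans_op (\<lambda>x y. (1 + \<bar>x\<bar>) powr p) x y \<le> l * (1 + \<bar>x\<bar>) powr p + Cw"
    by (metis w_drift)
  define K where "K = C1 * c powr (- p/2) + CE"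
  have K: "0 \<le> K" using C1 CE by (simp add: K_def)
  \<comment> \<open>The solution of \<open>B = B * l + 1\<close>: the expected weight then falls
    short by one unit of \<open>wt x\<close> per step, which pays for the step error. The constant
    \<open>Cw\<close> of the drift is paid by the part of \<open>L\<close> that is linear in the
    remaining time.\<close>
  define B where "B = 1 / (1 - l)"
  have B: "1 \<le> B" "B * l = B - 1" using l by (auto simp: B_def field_simps)
  define e where "e = (\<lambda>n::nat. real n powr (- p/2))"
  have e_eq: "real n powr (- p/2) = e n" for n by (simp add: e_def)
  have e0: "0 \<le> e n" for n by (simp add: e_def)
  define L where "L = (\<lambda>(n::nat) (k::nat) x (y::real). K * e n * (B * wt x + B * Cw * (real n - real k)))"
  have wt0: "0 \<le> wt x" for x by (simp add: wt_def)
  have tw: "tame (\<lambda>x y. wt x)" unfolding wt_def by (rule tame_w)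
  have tL: "tame (L n k)" for n k unfolding L_def by (intro tame_cmult tame_add tame_const tw)
  have L_ge: "CE * e n * wt x \<le> L n k x y" if "k \<le> n" for n k x y
  proof -
    have "CE * e n * wt x \<le> K * e n * (1 * wt x + 0)"
      using C1 e0[of n] wt0[of x] by (simp add: K_def distrib_right)
    also have "\<dots> \<le> L n k x y"
      unfolding L_def using that B Cw K e0[of n] wt0[of x]
      by (intro mult_left_mono add_mono mult_right_mono) auto
    finally show ?thesis .
  qed
  have L_step: "trans_op (L n (Suc k)) x y \<le> L n k x y - K * e n * wt x" for n k x y
  proof -
    have "trans_op (L n (Suc k)) x y = K * e n * (B * trans_op (\<lambda>x y. wt x) x y + B * Cw * (real n - real (Suc k)))"
      unfolding L_def by (subst trans_cmult, subst trans_add) (auto simp: trans_cmult trans_const tw)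
    also have "\<dots> \<le> K * e n * (B * (l * wt x + Cw) + B * Cw * (real n - real (Suc k)))"
      using drift[of x y] K e0[of n] B Cw by (intro mult_left_mono add_mono) (auto simp: wt_def)
    also have "\<dots> = K * e n * ((B * l) * wt x + B * Cw * (real n - real k))"
      by (simp add: algebra_simps)
    also have "\<dots> = L n k x y - K * e n * wt x"
      unfolding B(2) L_def by (simp add: algebra_simps)
    finally show ?thesis .
  qed
  \<comment> \<open>Remaining variance after \<open>k\<close> steps. The surplus
    \<open>\<delta>1 * n\<close> keeps it of order \<open>n\<close> up to the terminal time, away
    from the singularity of the heat solution at 0.\<close>
  define s where "s = (\<lambda>(n::nat) (k::nat). v * ((1 + \<delta>1) * real n - real k))"
  have s_ge: "c * real n \<le> s n k" if "k \<le> n" for n k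
    using that v_pos unfolding c_def s_def by (simp add: algebra_simps)
  have s_Suc: "s n (Suc k) + v = s n k" for n k by (simp add: s_def algebra_simps)
  have step': "\<bar>trans_op (psi (s n (Suc k)) q) x y - psi (s n k) q x y\<bar> \<le> K * e n * wt x"
    if n: "1 \<le> n" "1 \<le> c * real n" "k < n" for n k q x y
  proof -
    have ge: "c * real n \<le> s n (Suc k)" using s_ge n by simp
    have "\<bar>trans_op (psi (s n (Suc k)) q) x y - psi (s n (Suc k) + v) q x y\<bar> \<le> C1 * s n (Suc k) powr (- p/2) * wt x"
      unfolding wt_def by (rule step) (use ge n in linarith)
    also have "\<dots> \<le> C1 * (c * real n) powr (- p/2) * wt x"
      using ge n c C1 p_gt wt0[of x] by (intro mult_right_mono mult_left_mono powr_mono2') auto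
    also have "\<dots> = C1 * c powr (- p/2) * e n * wt x" using c by (simp add: powr_mult e_def)
    also have "\<dots> \<le> K * e n * wt x" using CE e0[of n] wt0[of x] unfolding K_def by (intro mult_right_mono) auto
    finally show ?thesis unfolding s_Suc .
  qed
  have close': "\<bar>psi (s n k) q x y - nerf ((y + q) / sqrt (s n k))\<bar> + \<bar>x\<bar> / sqrt (s n k) \<le> \<delta> + L n k x y"
    if "1 \<le> n" "k \<le> n" for n k q x y
    using close[OF that(1) s_ge[OF that(2)], of q x y] L_ge[OF that(2), of x y] by (simp add: e_def wt_def)
  have s_pos: "0 < s n k" if "1 \<le> n" "k \<le> n" for n k
    using s_ge[OF that(2)] c that(1) by (smt (verit) mult_pos_pos of_nat_0_less_iff zero_less_one less_le_trans)
  have tpsi: "tame (psi (s n k) q)" if "1 \<le> n" "k \<le> n" for n k q by (rule tame_psi[OF s_pos[OF that]])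
  have s0: "s n 0 = v * (1 + \<delta>1) * real n" for n by (simp add: s_def)
  have sn: "s n n = v * \<delta>1 * real n" for n by (simp add: s_def algebra_simps)
  define C where "C = 2 * K * (B + B * Cw)"
  have L0: "2 * L n 0 x y \<le> C * (e n * (wt x + real n))" for n x y
  proof -
    have "B * wt x + B * Cw * real n \<le> (B + B * Cw) * (wt x + real n)"
      using B Cw wt0[of x] by (simp add: algebra_simps)
    then have "2 * (K * e n * (B * wt x + B * Cw * real n)) \<le> 2 * (K * e n * ((B + B * Cw) * (wt x + real n)))"
      using K e0[of n] by (intro mult_left_mono) auto
    then show ?thesis unfolding L_def C_def by (simp add: algebra_simps)
  qed
  have L_nonneg: "0 \<le> L n k x y" if "k \<le> n" for n k x y
    using L_ge[OF that, of x y] CE e0[of n] wt0[of x] by (smt (verit) mult_nonneg_nonneg)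
  show thesis
  proof (rule that)
    show "0 \<le> C" using K B Cw by (simp add: C_def)
  next
    fix n :: nat and x y :: real
    assume n: "1 \<le> n" "1 \<le> v * \<delta>1 * real n" and y: "0 < y"
    define T where "T = (\<lambda>k x y. psi (s n k) 0 x y - \<delta> - L n k x y)"
    have tT: "tame (T k)" if "k \<le> n" for k
      unfolding T_def by (intro tame_diff tame_const tpsi tL n that)
    have "T 0 x y \<le> (kill_op ^^ n) (T n) x y"
    proof (rule sub_solution[OF tT _ y])
      fix k :: nat and x y :: real assume k: "k < n" and y: "0 < y"
      have "T k x y \<le> trans_op (T (Suc k)) x y"
      proof -
        have "trans_op (T (Suc k)) x y = trans_op (psi (s n (Suc k)) 0) x y - \<delta> - trans_op (L n (Suc k)) x y"
          unfolding T_def using k n by (subst trans_diff, (intro tame_diff tame_const tpsi tL; simp)+)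
             (subst trans_diff, (intro tame_const tpsi; simp)+, simp add: trans_const)
        then show ?thesis
          using step'[of n k 0 x y] L_step[of n k x y] n k by (simp add: T_def c_def abs_le_iff)
      qed
      also have "\<dots> \<le> kill_op (T (Suc k)) x y"
        unfolding kill_op_def
      proof (intro trans_mono tame_killed tT)
        fix x1
        \<comment> \<open>Beyond the boundary killing replaces \<open>T\<close> by 0, which is an
          increase there: \<open>nerf\<close> is nonpositive at a nonpositive height, and the
          remaining terms of \<open>T\<close> cover the gap between \<open>psi\<close> and
          \<open>nerf\<close>.\<close>
        show "T (Suc k) x1 (y + x1) \<le> killed (T (Suc k)) x1 (y + x1)"
        proof (cases "0 < y + x1")
          case False
          have "nerf ((y + x1 + 0) / sqrt (s n (Suc k))) \<le> nerf 0"
            using False s_pos[of n "Suc k"] n k by (intro nerf_mono) (simp add: divide_le_0_iff)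
          moreover have "0 \<le> \<bar>x1\<bar> / sqrt (s n (Suc k))" using s_pos[of n "Suc k"] n k by simp
          ultimately have "T (Suc k) x1 (y + x1) \<le> 0"
            using close'[of n "Suc k" 0 x1 "y + x1"] n k unfolding T_def nerf_0 by linarith
          then show ?thesis using False by (simp add: killed_def)
        qed (simp add: killed_def)
      qed (use k in auto)
      finally show "T k x y \<le> kill_op (T (Suc k)) x y" .
    qed
    also have "\<dots> \<le> (kill_op ^^ n) (\<lambda>x y. 1) x y"
    proof (rule kill_pow_mono[OF tT tame_const _ y])
      fix x y
      have "0 \<le> \<bar>x\<bar> / sqrt (s n n)" using s_pos[of n n] n by simp
      then show "T n x y \<le> 1"
        using close'[of n n 0 x y] n nerf_le_1[of "(y + 0) / sqrt (s n n)"] unfolding T_def by linarith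
    qed simp
    finally have "T 0 x y \<le> (kill_op ^^ n) (\<lambda>x y. 1) x y" .
    moreover have "0 \<le> \<bar>x\<bar> / sqrt (s n 0)" using s_pos[of n 0] n by simp
    ultimately show "nerf (y / sqrt (v * (1 + \<delta>1) * real n)) - 2 * \<delta> - C * (real n powr (- p/2) * (wt x + real n))
         \<le> (kill_op ^^ n) (\<lambda>x y. 1) x y"
      using close'[of n 0 0 x y] n L0[of n x y] unfolding T_def e_eq s0[symmetric] by simp
  next
    fix n :: nat and x y q \<gamma> :: real
    assume n: "1 \<le> n" "1 \<le> v * \<delta>1 * real n" and y: "0 < y" and q: "0 \<le> q" and \<gamma>: "0 \<le> \<gamma>"
      and hq: "1 - \<gamma> \<le> nerf (q / sqrt (v * \<delta>1 * real n))"
    define T where "T = (\<lambda>k x y. psi (s n k) q x y + (\<delta> + \<gamma>) + L n k x y)"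
    have tT: "tame (T k)" if "k \<le> n" for k
      unfolding T_def by (intro tame_add tame_const tpsi tL n that)
    have "(kill_op ^^ n) (\<lambda>x y. 1) x y \<le> (kill_op ^^ n) (T n) x y"
    proof (rule kill_pow_mono[OF tame_const tT _ y])
      fix x y :: real assume y: "0 < y"
      have "0 \<le> \<bar>x\<bar> / sqrt (s n n)" using s_pos[of n n] n by simp
      \<comment> \<open>At the terminal time the shift is large compared with the surplus standard
        deviation, so the barrier is at least 1 at every positive height.\<close>
      moreover have "nerf (q / sqrt (s n n)) \<le> nerf ((y + q) / sqrt (s n n))"
        using y s_pos[of n n] n by (intro nerf_mono divide_right_mono) auto
      ultimately show "1 \<le> T n x y"
        using close'[of n n q x y] n hq unfolding T_def sn[symmetric] by linarith
    qed simp
    also have "\<dots> \<le> T 0 x y"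
    proof (rule super_solution[OF tT _ y])
      fix k :: nat and x y :: real assume k: "k < n" and y: "0 < y"
      have "kill_op (T (Suc k)) x y \<le> trans_op (T (Suc k)) x y"
        unfolding kill_op_def
      proof (intro trans_mono tame_killed tT)
        fix x1
        \<comment> \<open>Now the barrier must stay nonnegative beyond the boundary. The landing
          height exceeds \<open>x1\<close> because the start is positive, so \<open>nerf\<close> is
          at least minus the reserve kept in \<open>psi_close\<close>.\<close>
        show "killed (T (Suc k)) x1 (y + x1) \<le> T (Suc k) x1 (y + x1)"
        proof (cases "0 < y + x1")
          case False
          have sp: "0 < s n (Suc k)" using s_pos[of n "Suc k"] n k by simp
          have "- \<bar>x1\<bar> / sqrt (s n (Suc k)) \<le> nerf (x1 / sqrt (s n (Suc k)))"
            using nerf_abs_le[of "x1 / sqrt (s n (Suc k))"] sp by (simp add: abs_le_iff)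
          also have "\<dots> \<le> nerf ((y + x1 + q) / sqrt (s n (Suc k)))"
            using y q sp by (intro nerf_mono divide_right_mono) auto
          finally have "0 \<le> T (Suc k) x1 (y + x1)"
            using close'[of n "Suc k" q x1 "y + x1"] n k \<gamma> unfolding T_def by simp
          then show ?thesis using False by (simp add: killed_def)
        qed (simp add: killed_def)
      qed (use k in auto)
      also have "\<dots> = trans_op (psi (s n (Suc k)) q) x y + (\<delta> + \<gamma>) + trans_op (L n (Suc k)) x y"
        unfolding T_def using k n by (subst trans_add, (intro tame_add tame_const tpsi tL; simp)+)
             (subst trans_add, (intro tame_const tpsi; simp)+, simp add: trans_const)
      also have "\<dots> \<le> T k x y"
        using step'[of n k q x y] L_step[of n k x y] n k by (simp add: T_def c_def abs_le_iff)
      finally show "kill_op (T (Suc k)) x y \<le> T k x y" .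
    qed
    finally have "(kill_op ^^ n) (\<lambda>x y. 1) x y \<le> T 0 x y" .
    moreover have "0 \<le> \<bar>x\<bar> / sqrt (s n 0)" using s_pos[of n 0] n by simp
    ultimately show "(kill_op ^^ n) (\<lambda>x y. 1) x y \<le>
       nerf ((y + q) / sqrt (v * (1 + \<delta>1) * real n)) + 2 * \<delta> + \<gamma> + C * (real n powr (- p/2) * (wt x + real n))"
      using close'[of n 0 q x y] n L0[of n x y] unfolding T_def e_eq s0[symmetric] by simp
  qed
qed

text \<open>The raw estimates leave an error with a power of order \<open>p\<close> in
  \<open>x\<close>. It can be made linear in \<open>t = (1 + \<bar>x\<bar>) / sqrt n\<close>: if
  \<open>t\<close> exceeds 1 the claim is trivial, and otherwise \<open>t powr p \<le> t\<close>.
  Linear dependence is what permits taking expectations at a later time.\<close>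

theorem survival_approx:
  assumes d: "0 < \<delta>"
  obtains C where "0 \<le> C" "\<And>n x y. 1 \<le> n \<Longrightarrow> 0 < y \<Longrightarrow>
    \<bar>(kill_op ^^ n) (\<lambda>x y. 1) x y - nerf (y / sqrt (v * real n))\<bar> \<le> \<delta> + C * (1 + \<bar>x\<bar>) / sqrt (real n)"
proof -
  define \<epsilon> where "\<epsilon> = min (\<delta> / 8) (1/2)"
  have \<epsilon>: "0 < \<epsilon>" "\<epsilon> < 1" "8 * \<epsilon> \<le> \<delta>" using d by (auto simp: \<epsilon>_def)
  have "\<forall>\<^sub>F r in at_top. 1 - \<epsilon> < nerf r" using order_tendstoD(1)[OF nerf_lim, of "1 - \<epsilon>"] \<epsilon> by simp
  then obtain R where R: "\<And>r. R \<le> r \<Longrightarrow> 1 - \<epsilon> < nerf r" by (auto simp: eventually_at_top_linorder)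
  define R0 where "R0 = max R 1"
  have R0: "0 < R0" "\<And>r. R0 \<le> r \<Longrightarrow> 1 - \<epsilon> \<le> nerf r" using R by (auto simp: R0_def less_imp_le)
  \<comment> \<open>The first bound makes the change of variance from \<open>v * n\<close> to
    \<open>v * (1 + \<delta>1) * n\<close> harmless. The second makes the shift
    \<open>\<epsilon> * sqrt (v * n)\<close> at least \<open>R0\<close> standard deviations of the
    surplus variance while moving \<open>nerf\<close> by only \<epsilon>.\<close>
  define \<delta>1 where "\<delta>1 = min \<epsilon> ((\<epsilon> / R0)\<^sup>2)"
  have \<delta>1: "0 < \<delta>1" "\<delta>1 \<le> \<epsilon>" "\<delta>1 \<le> (\<epsilon> / R0)\<^sup>2" using \<epsilon> R0 by (auto simp: \<delta>1_def)
  obtain C where C: "0 \<le> C" and low: "\<And>n x y. 1 \<le> n \<Longrightarrow> 1 \<le> v * \<delta>1 * real n \<Longrightarrow> 0 < y \<Longrightarrow>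
       nerf (y / sqrt (v * (1 + \<delta>1) * real n)) - 2 * \<epsilon> - C * (real n powr (- p/2) * (wt x + real n))
         \<le> (kill_op ^^ n) (\<lambda>x y. 1) x y"
    and up: "\<And>n x y q \<gamma>. 1 \<le> n \<Longrightarrow> 1 \<le> v * \<delta>1 * real n \<Longrightarrow> 0 < y \<Longrightarrow> 0 \<le> q \<Longrightarrow> 0 \<le> \<gamma> \<Longrightarrow>
        1 - \<gamma> \<le> nerf (q / sqrt (v * \<delta>1 * real n)) \<Longrightarrow>
       (kill_op ^^ n) (\<lambda>x y. 1) x y \<le>
       nerf ((y + q) / sqrt (v * (1 + \<delta>1) * real n)) + 2 * \<epsilon> + \<gamma> + C * (real n powr (- p/2) * (wt x + real n))"
    using survival_raw[OF \<epsilon>(1,2) \<delta>1(1)] by metis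
  have main: "\<bar>(kill_op ^^ n) (\<lambda>x y. 1) x y - nerf (y / sqrt (v * real n))\<bar> \<le> 4 * \<epsilon> + C * (real n powr (- p/2) * (wt x + real n))"
    if n: "1 \<le> n" "1 \<le> v * \<delta>1 * real n" and y: "0 < y" for n x y
  proof -
    define r where "r = y / sqrt (v * real n)"
    have r: "0 \<le> r" using y v_pos by (simp add: r_def)
    define c where "c = 1 / sqrt (1 + \<delta>1)"
    have s1: "1 \<le> sqrt (1 + \<delta>1)" using \<delta>1 by simp
    have s2: "sqrt (1 + \<delta>1) \<le> 1 + \<epsilon>"
    proof -
      have "(1 + \<epsilon>)\<^sup>2 = 1 + 2 * \<epsilon> + \<epsilon>\<^sup>2" by (simp add: power2_sum)
      then have "1 + \<delta>1 \<le> (1 + \<epsilon>)\<^sup>2" using \<delta>1(2) \<epsilon>(1) zero_le_power2[of \<epsilon>] by linarith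
      then show ?thesis using \<epsilon> by (intro real_le_lsqrt) auto
    qed
    have c: "0 < c" "c \<le> 1" "(1 - c) / c \<le> \<epsilon>"
    proof -
      show "0 < c" "c \<le> 1" using s1 by (auto simp: c_def)
      have "(1 - 1 / S) / (1 / S) = S - 1" if "1 \<le> S" for S :: real using that by (simp add: field_simps)
      from this[OF s1] have "(1 - c) / c = sqrt (1 + \<delta>1) - 1" unfolding c_def .
      then show "(1 - c) / c \<le> \<epsilon>" using s2 by simp
    qed
    have cr: "y / sqrt (v * (1 + \<delta>1) * real n) = c * r"
      by (simp add: c_def r_def real_sqrt_mult)
    have 1: "nerf r - \<epsilon> \<le> nerf (y / sqrt (v * (1 + \<delta>1) * real n))"
      using nerf_scale[OF r c(1,2)] c(3) unfolding cr by linarith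
    define q where "q = \<epsilon> * sqrt (v * real n)"
    have q: "0 \<le> q" using \<epsilon> v_pos by (simp add: q_def)
    have vn: "0 < v * real n" using v_pos n by simp
    have "1 - \<epsilon> \<le> nerf (q / sqrt (v * \<delta>1 * real n))"
    proof (rule R0(2))
      have "sqrt \<delta>1 \<le> \<epsilon> / R0" using \<delta>1 R0 \<epsilon> by (intro real_le_lsqrt) auto
      then have "R0 \<le> \<epsilon> / sqrt \<delta>1" using R0 \<delta>1 by (simp add: field_simps)
      also have "\<dots> = q / sqrt (v * \<delta>1 * real n)" using vn v_pos n by (simp add: q_def real_sqrt_mult)
      finally show "R0 \<le> q / sqrt (v * \<delta>1 * real n)" .
    qed
    then have 2: "(kill_op ^^ n) (\<lambda>x y. 1) x y \<le>
       nerf ((y + q) / sqrt (v * (1 + \<delta>1) * real n)) + 2 * \<epsilon> + \<epsilon> + C * (real n powr (- p/2) * (wt x + real n))"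
      using n y q \<epsilon> by (intro up) auto
    have "nerf ((y + q) / sqrt (v * (1 + \<delta>1) * real n)) \<le> nerf ((y + q) / sqrt (v * real n))"
    proof (rule nerf_mono)
      have "v * real n * 1 \<le> v * real n * (1 + \<delta>1)" using vn \<delta>1 by (intro mult_left_mono) auto
      then show "(y + q) / sqrt (v * (1 + \<delta>1) * real n) \<le> (y + q) / sqrt (v * real n)"
        using y q vn \<delta>1 by (intro divide_left_mono) (auto simp: mult_ac intro!: mult_pos_pos)
    qed
    also have "\<dots> \<le> nerf r + \<epsilon>"
    proof -
      have "(y + q) / sqrt (v * real n) = r + \<epsilon>" using vn v_pos n by (simp add: r_def q_def add_divide_distrib)
      then show ?thesis using nerf_lip[of "r + \<epsilon>" r] \<epsilon> by simp
    qed
    finally show ?thesis using 1 2 low[OF n y, of x] \<epsilon>(1) unfolding r_def by linarith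
  qed
  have "(\<lambda>n. C * real n powr (1 - p/2)) \<longlonglongrightarrow> C * 0"
    using p_gt by (intro tendsto_intros tendsto_neg_powr filterlim_real_sequentially) auto
  then have "\<forall>\<^sub>F n in sequentially. C * real n powr (1 - p/2) < \<epsilon>"
    using \<epsilon> by (intro order_tendstoD(2)) auto
  moreover have "\<forall>\<^sub>F n in sequentially. 1 \<le> v * \<delta>1 * real n"
  proof -
    have "filterlim (\<lambda>n. v * \<delta>1 * real n) at_top sequentially"
      using v_pos \<delta>1 by (intro filterlim_tendsto_pos_mult_at_top[OF tendsto_const _ filterlim_real_sequentially]) auto
    then show ?thesis by (simp add: filterlim_at_top)
  qed
  ultimately obtain N where N: "\<And>n. N \<le> n \<Longrightarrow> C * real n powr (1 - p/2) < \<epsilon> \<and> 1 \<le> v * \<delta>1 * real n"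
    using eventually_conj eventually_sequentially by (metis (mono_tags, lifting))
  show thesis
  proof
    show "0 \<le> C + 1 + sqrt (real N)" using C by simp
    fix n :: nat and x y :: real assume n: "1 \<le> n" and y: "0 < y"
    define t where "t = (1 + \<bar>x\<bar>) / sqrt (real n)"
    have t: "0 \<le> t" by (simp add: t_def)
    have vn: "0 < v * real n" using v_pos n by simp
    have triv: "\<bar>(kill_op ^^ n) (\<lambda>x y. 1) x y - nerf (y / sqrt (v * real n))\<bar> \<le> 1"
      using kill_pow_one_le[OF y, of n x] kill_pow_one_nonneg[OF y, of n x] nerf_le_1[of "y / sqrt (v * real n)"]
        nerf_nonneg[of "y / sqrt (v * real n)"] vn y by auto
    have "\<bar>(kill_op ^^ n) (\<lambda>x y. 1) x y - nerf (y / sqrt (v * real n))\<bar> \<le> \<delta> + (C + 1 + sqrt (real N)) * t"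
    proof (cases "N \<le> n")
      case False
      \<comment> \<open>For the finitely many small times the constant \<open>sqrt N\<close> makes
        the right side at least 1.\<close>
      have "1 \<le> sqrt (real N) * (1 / sqrt (real n))" using False n by simp
      also have "\<dots> \<le> sqrt (real N) * t" unfolding t_def by (intro mult_left_mono divide_right_mono) auto
      also have "\<dots> \<le> (C + 1 + sqrt (real N)) * t" using C t by (intro mult_right_mono) auto
      finally show ?thesis using triv d by linarith
    next
      case True
      show ?thesis
      proof (cases "t \<le> 1")
        case False
        have "1 * t \<le> (C + 1 + sqrt (real N)) * t" using C t by (intro mult_right_mono) auto
        then show ?thesis using triv False d by linarith
      next
        case le: True
        have a: "real n powr (- p/2) * real n = real n powr (1 - p/2)"
          using n powr_add[of "real n" "- p/2" 1] by (simp add: add.commute)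
        have b: "real n powr (- p/2) * wt x = t powr p"
        proof -
          have "sqrt (real n) powr p = real n powr (p/2)"
            using n by (simp only: powr_half_sqrt[symmetric] of_nat_0_le_iff powr_powr) simp
          moreover have "t powr p = (1 + \<bar>x\<bar>) powr p / sqrt (real n) powr p"
            unfolding t_def by (rule powr_divide)
          moreover have "real n powr (- p/2) = 1 / real n powr (p/2)"
            using powr_minus_divide[of "real n" "p/2"] by simp
          ultimately show ?thesis by (simp add: wt_def)
        qed
        have "t powr p \<le> t"
        proof (cases "t = 0")
          case False
          then show ?thesis using powr_mono'[of 1 p t] le t p_gt by simp
        qed simp
        then have c: "C * (real n powr (- p/2) * (wt x + real n)) \<le> C * t + \<epsilon>"
          using N[OF True] C mult_left_mono[of "t powr p" t C] unfolding distrib_left a b by simp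
        have "C * t \<le> (C + 1 + sqrt (real N)) * t" using t by (intro mult_right_mono) auto
        then show ?thesis using main[OF n _ y, of x] N[OF True] c \<epsilon> by linarith
      qed
    qed
    then show "\<bar>(kill_op ^^ n) (\<lambda>x y. 1) x y - nerf (y / sqrt (v * real n))\<bar> \<le> \<delta> + (C + 1 + sqrt (real N)) * (1 + \<bar>x\<bar>) / sqrt (real n)"
      by (simp add: t_def)
  qed
qed

end

section \<open>Recursion over doubling times\<close>

text \<open>Meant for time \<open>2 ^ j\<close>: \<open>e\<close> is the modulus of the mean of the
  martingale on survival, \<open>d\<close> and \<open>f\<close> are the survival probability and the
  mean of \<open>\<bar>X\<bar>\<close> on survival, times the square root of the time. Here
  \<open>f\<close> contracts up to \<open>d\<close>, \<open>d\<close> contracts up to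
  \<open>e\<close>, and \<open>e\<close> moves by a summable amount. \<open>J\<close> and
  \<open>K\<close> are chosen before the sequences, so the bound is uniform in the starting
  point.\<close>

lemma doubling_recursion:
  fixes C r :: real
  assumes C: "1 \<le> C" and r: "0 < r" "r < 1"
  obtains J K where "J0 \<le> J" "0 \<le> K"
    "\<And>e d f j. (\<And>j. 0 \<le> e j) \<Longrightarrow> (\<And>j. 0 \<le> d j) \<Longrightarrow> (\<And>j. 0 \<le> f j) \<Longrightarrow>
      (\<And>j. J0 \<le> j \<Longrightarrow> f (Suc j) \<le> f j / 4 + C * d j) \<Longrightarrow>
      (\<And>j. J0 \<le> j \<Longrightarrow> d (Suc j) \<le> d j / 4 + C * e j + C * r ^ j * f j) \<Longrightarrow>
      (\<And>j. J0 \<le> j \<Longrightarrow> e (Suc j) \<le> e j + C * r ^ j * (d j + f j)) \<Longrightarrow> J \<le> j \<Longrightarrow>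
      d j \<le> K * (e J + d J + f J) \<and> f j \<le> K * (e J + d J + f (J::nat))"
proof -
  have "(\<lambda>j. 4 * C\<^sup>2 * r ^ j) \<longlonglongrightarrow> 4 * C\<^sup>2 * 0" using r by (intro tendsto_intros LIMSEQ_realpow_zero) auto
  then have "\<forall>\<^sub>F j in sequentially. 4 * C\<^sup>2 * r ^ j < 1 / 4" by (intro order_tendstoD(2)) auto
  then obtain J1 where J1: "\<And>j. J1 \<le> j \<Longrightarrow> 4 * C\<^sup>2 * r ^ j < 1 / 4" by (auto simp: eventually_sequentially)
  define J where "J = max J0 J1"
  define G where "G = C * (1 + 4 * C) * (2 * C)"
  have G: "0 \<le> G" using C by (simp add: G_def)
  define K1 where "K1 = exp (G * (1 / (1 - r)))"
  have K1: "0 < K1" by (simp add: K1_def)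
  show thesis
  proof
    show "J0 \<le> J" by (simp add: J_def)
    show "0 \<le> 8 * C\<^sup>2 * K1" using K1 by simp
    fix e d f :: "nat \<Rightarrow> real" and j
    assume e: "\<And>j. 0 \<le> e j" and d: "\<And>j. 0 \<le> d j" and f: "\<And>j. 0 \<le> f j"
      and fS: "\<And>j. J0 \<le> j \<Longrightarrow> f (Suc j) \<le> f j / 4 + C * d j"
      and dS: "\<And>j. J0 \<le> j \<Longrightarrow> d (Suc j) \<le> d j / 4 + C * e j + C * r ^ j * f j"
      and eS: "\<And>j. J0 \<le> j \<Longrightarrow> e (Suc j) \<le> e j + C * r ^ j * (d j + f j)" and j: "J \<le> j"
    \<comment> \<open>The weight of \<open>f\<close> is chosen so that the term \<open>C * d\<close>
      in its recursion returns as \<open>d / 4\<close>, whence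
      \<open>q (Suc j) \<le> q j / 2 + C * e j\<close> for large \<open>j\<close>. In
      \<open>M\<close> the scale \<open>2 * C\<close> is the fixed point of this inequality, so that
      only the summable growth of \<open>e\<close> can increase \<open>M\<close>.\<close>
    define q where "q = (\<lambda>j. d j + f j / (4 * C))"
    define M where "M = (\<lambda>j. max (e j) (q j / (2 * C)))"
    have q0: "0 \<le> q j" for j using d f C by (simp add: q_def)
    have M0: "0 \<le> M j" for j using e[of j] by (simp add: M_def max.coboundedI1)
    have qM: "q j \<le> 2 * C * M j" for j
    proof -
      have "q j / (2 * C) \<le> M j" by (simp add: M_def)
      then show ?thesis using C by (simp add: field_simps)
    qed
    have dq: "d j \<le> q j" for j using f[of j] C by (simp add: q_def)
    have fq: "f j \<le> 4 * C * q j" for j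
      using d[of j] C by (simp add: q_def field_simps)
    have step: "M (Suc j) \<le> (1 + G * r ^ j) * M j" if "J \<le> j" for j
    proof -
      have jj: "J0 \<le> j" "J1 \<le> j" using that by (auto simp: J_def)
      have "q (Suc j) \<le> (d j / 4 + C * e j + C * r ^ j * f j) + (f j / 4 + C * d j) / (4 * C)"
        unfolding q_def using dS[OF jj(1)] fS[OF jj(1)] C by (intro add_mono divide_right_mono) auto
      also have "\<dots> = d j / 2 + C * e j + (4 * C\<^sup>2 * r ^ j + 1 / 4) * (f j / (4 * C))"
        using C by (simp add: field_simps power2_eq_square)
      also have "\<dots> \<le> d j / 2 + C * e j + (1 / 2) * (f j / (4 * C))"
        using J1[OF jj(2)] f[of j] C by (intro add_left_mono mult_right_mono) auto
      also have "\<dots> = q j / 2 + C * e j" by (simp add: q_def field_simps)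
      also have "\<dots> \<le> C * M j + C * M j"
        using qM[of j] C by (intro add_mono mult_left_mono) (auto simp: M_def)
      finally have "q (Suc j) / (2 * C) \<le> M j" using C by (simp add: field_simps)
      also have "M j \<le> (1 + G * r ^ j) * M j" using G r M0[of j] by (simp add: distrib_right)
      finally have 1: "q (Suc j) / (2 * C) \<le> (1 + G * r ^ j) * M j" .
      have "d j + f j \<le> (1 + 4 * C) * q j" using dq[of j] fq[of j] by (simp add: distrib_right)
      also have "\<dots> \<le> (1 + 4 * C) * (2 * C * M j)" using qM C by (intro mult_left_mono) auto
      finally have "C * r ^ j * (d j + f j) \<le> C * r ^ j * ((1 + 4 * C) * (2 * C * M j))"
        using C r by (intro mult_left_mono) auto
      then have "e (Suc j) \<le> M j + C * r ^ j * ((1 + 4 * C) * (2 * C * M j))"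
        using eS[OF jj(1)] by (simp add: M_def)
      also have "\<dots> = (1 + G * r ^ j) * M j" by (simp add: G_def algebra_simps)
      finally show ?thesis using 1 by (simp add: M_def)
    qed
    have "M (J + k) \<le> exp (G * (\<Sum>i<k. r ^ i)) * M J" for k
    proof (induction k)
      case (Suc k)
      have "r ^ (J + k) \<le> r ^ k" using r by (intro power_decreasing) auto
      then have "1 + G * r ^ (J + k) \<le> 1 + G * r ^ k" using G by (intro add_left_mono mult_left_mono) auto
      also have "\<dots> \<le> exp (G * r ^ k)" by (rule exp_ge_add_one_self)
      finally have "M (J + Suc k) \<le> exp (G * r ^ k) * M (J + k)"
        using step[of "J + k"] M0[of "J + k"] by (simp, meson mult_right_mono order_trans)
      also have "\<dots> \<le> exp (G * r ^ k) * (exp (G * (\<Sum>i<k. r ^ i)) * M J)" using Suc by (intro mult_left_mono) auto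
      finally show ?case by (simp add: distrib_left exp_add mult_ac)
    qed simp
    moreover have "exp (G * (\<Sum>i<k. r ^ i)) \<le> K1" for k
    proof -
      have "(\<Sum>i<k. r ^ i) = (1 - r ^ k) / (1 - r)" using r by (simp add: sum_gp_strict)
      also have "\<dots> \<le> 1 / (1 - r)" using r by (simp add: divide_right_mono)
      finally show ?thesis unfolding K1_def using G by (intro iffD2[OF exp_le_cancel_iff] mult_left_mono)
    qed
    ultimately have MJ: "M j \<le> K1 * M J"
      using j M0[of J] by (metis le_add_diff_inverse mult_right_mono order_trans)
    have "q J / (2 * C) \<le> q J / 1" using q0[of J] C by (intro divide_left_mono) auto
    moreover have "f J / (4 * C) \<le> f J / 1" using f[of J] C by (intro divide_left_mono) auto
    ultimately have MS: "M J \<le> e J + d J + f J"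
      using e[of J] d[of J] f[of J] unfolding M_def q_def by simp
    have A: "M j \<le> K1 * (e J + d J + f J)" using MJ mult_left_mono[OF MS, of K1] K1 by linarith
    have "C * 1 \<le> C * C" using C by (intro mult_left_mono) auto
    then have C2: "2 * C \<le> 8 * C\<^sup>2" using C unfolding power2_eq_square by linarith
    have "d j \<le> 2 * C * M j" using dq qM order_trans by blast
    also have "\<dots> \<le> 8 * C\<^sup>2 * M j" using C2 M0 by (intro mult_right_mono)
    also have "\<dots> \<le> 8 * C\<^sup>2 * (K1 * (e J + d J + f J))" using A by (intro mult_left_mono) auto
    finally have 1: "d j \<le> 8 * C\<^sup>2 * K1 * (e J + d J + f J)" by simp
    have "f j \<le> 4 * C * (2 * C * M j)" using fq[of j] qM[of j] C by (meson mult_left_mono order_trans zero_le_mult_iff zero_le_numeral zero_le_one)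
    also have "\<dots> = 8 * C\<^sup>2 * M j" by (simp add: power2_eq_square)
    also have "\<dots> \<le> 8 * C\<^sup>2 * (K1 * (e J + d J + f J))" using A by (intro mult_left_mono) auto
    finally show "d j \<le> 8 * C\<^sup>2 * K1 * (e J + d J + f J) \<and> f j \<le> 8 * C\<^sup>2 * K1 * (e J + d J + f J)" using 1 by simp
  qed
qed

context affine_law begin

text \<open>With the next three functions: the expectations of 1, of \<open>\<bar>X\<bar>\<close>,
  of the height and of the martingale at time \<open>n\<close>, restricted to survival up to
  \<open>n\<close>; \<open>kill_pow_walk\<close> makes this literal.\<close>

definition Sv :: "nat \<Rightarrow> real \<Rightarrow> real \<Rightarrow> real" where "Sv n = (kill_op ^^ n) (\<lambda>x y. 1)"
definition Fx :: "nat \<Rightarrow> real \<Rightarrow> real \<Rightarrow> real" where "Fx n = (kill_op ^^ n) (\<lambda>x y. \<bar>x\<bar>)"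
definition Ty :: "nat \<Rightarrow> real \<Rightarrow> real \<Rightarrow> real" where "Ty n = (kill_op ^^ n) (\<lambda>x y. y)"
definition Ez :: "nat \<Rightarrow> real \<Rightarrow> real \<Rightarrow> real" where "Ez n = (kill_op ^^ n) (\<lambda>x y. y + \<rho> * x)"

lemma kill_pow_lin:
  "(kill_op ^^ n) (\<lambda>x y. a * y + (b + c * \<bar>x\<bar>)) x y = a * Ty n x y + (b * Sv n x y + c * Fx n x y)"
  by (subst kill_pow_add, (intro tame_cmult tame_add tame_const tame_y tame_absx)+,
      subst kill_pow_add, (intro tame_cmult tame_add tame_const tame_y tame_absx)+)
     (simp add: kill_pow_cmult kill_pow_const[of _ b] Ty_def Sv_def Fx_def)

lemma tame_lin: "tame (\<lambda>x y. a * y + (b + c * \<bar>x\<bar>))"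
  by (intro tame_cmult tame_add tame_const tame_y tame_absx)

lemma Sv_le_1: "0 < y \<Longrightarrow> Sv n x y \<le> 1" and Sv_nonneg: "0 < y \<Longrightarrow> 0 \<le> Sv n x y"
  and Fx_nonneg: "0 < y \<Longrightarrow> 0 \<le> Fx n x y" and Ty_nonneg: "0 < y \<Longrightarrow> 0 \<le> Ty n x y"
  unfolding Sv_def Fx_def Ty_def
  by (auto intro: kill_pow_one_le kill_pow_nonneg tame_absx tame_y kill_pow_one_nonneg)

lemma Sv_antimono: "n \<le> k \<Longrightarrow> 0 < y \<Longrightarrow> Sv k x y \<le> Sv n x y"
  unfolding Sv_def by (rule kill_pow_one_antimono)

lemma Fx_step: obtains C where "0 \<le> C"
  "\<And>n k x y. 0 < y \<Longrightarrow> Fx (n + k) x y \<le> a1 ^ k * Fx n x y + C * Sv n x y"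
proof -
  obtain C where C: "0 \<le> C" "\<And>x y. kill_op (\<lambda>x y. \<bar>x\<bar>) x y \<le> a1 * \<bar>x\<bar> + C" by (metis absx_drift)
  show thesis
  proof
    show "0 \<le> C / (1 - a1)" using C l1_lt by simp
    show "Fx (n + k) x y \<le> a1 ^ k * Fx n x y + C / (1 - a1) * Sv n x y" if "0 < y" for n k x y
      unfolding Fx_def Sv_def
      using that by (rule kill_pow_drift_pow[OF tame_absx l1_nonneg l1_lt C])
  qed
qed

text \<open>The approximation over the last \<open>k\<close> steps, integrated over the state at
  time \<open>n\<close>. The fixed error \<delta> comes out multiplied by \<open>Sv n\<close>, which
  is why an approximation without a rate suffices.\<close>

lemma Sv_step:
  assumes "0 < \<delta>"
  obtains C where "0 \<le> C" "\<And>n k x y. 1 \<le> k \<Longrightarrow> 0 < y \<Longrightarrow>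
    Sv (n + k) x y \<le> \<delta> * Sv n x y + C / sqrt (real k) * (Sv n x y + Fx n x y + Ty n x y)"
proof -
  obtain C where C: "0 \<le> C" and appr: "\<And>n x y. 1 \<le> n \<Longrightarrow> 0 < y \<Longrightarrow>
    \<bar>(kill_op ^^ n) (\<lambda>x y. 1) x y - nerf (y / sqrt (v * real n))\<bar> \<le> \<delta> + C * (1 + \<bar>x\<bar>) / sqrt (real n)"
    using survival_approx[OF assms] by metis
  define D where "D = C + 1 / sqrt v"
  show thesis
  proof
    show "0 \<le> D" using C v_pos by (simp add: D_def)
    fix n k :: nat and x y :: real assume k: "1 \<le> k" and y: "0 < y"
    have "Sv (n + k) x y = (kill_op ^^ n) (Sv k) x y" by (simp add: Sv_def kill_pow_pow)
    also have "\<dots> \<le> (kill_op ^^ n) (\<lambda>x y. (1 / sqrt (v * real k)) * y + ((\<delta> + C / sqrt (real k)) + (C / sqrt (real k)) * \<bar>x\<bar>)) x y"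
    proof (rule kill_pow_mono[OF _ tame_lin _ y])
      show "tame (Sv k)" unfolding Sv_def by (intro tame_kill_pow tame_const)
      fix x y :: real assume y: "0 < y"
      have "nerf (y / sqrt (v * real k)) \<le> y / sqrt (v * real k)" using y v_pos by (intro nerf_le_linear) simp
      moreover have "Sv k x y \<le> nerf (y / sqrt (v * real k)) + (\<delta> + C * (1 + \<bar>x\<bar>) / sqrt (real k))"
        using appr[OF k y, of x] unfolding Sv_def by linarith
      moreover have "C * (1 + \<bar>x\<bar>) / sqrt (real k) = C / sqrt (real k) + (C / sqrt (real k)) * \<bar>x\<bar>"
        by (simp add: distrib_left add_divide_distrib)
      ultimately show "Sv k x y \<le> (1 / sqrt (v * real k)) * y + ((\<delta> + C / sqrt (real k)) + (C / sqrt (real k)) * \<bar>x\<bar>)"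
        by simp
    qed
    also have "\<dots> = (1 / sqrt (v * real k)) * Ty n x y + ((\<delta> + C / sqrt (real k)) * Sv n x y + (C / sqrt (real k)) * Fx n x y)"
      by (rule kill_pow_lin)
    also have "\<dots> = \<delta> * Sv n x y + (1 / sqrt v * Ty n x y + C * Sv n x y + C * Fx n x y) / sqrt (real k)"
      by (simp add: real_sqrt_mult algebra_simps add_divide_distrib)
    also have "\<dots> \<le> \<delta> * Sv n x y + (D * Ty n x y + D * Sv n x y + D * Fx n x y) / sqrt (real k)"
      using Sv_nonneg[OF y] Fx_nonneg[OF y] Ty_nonneg[OF y] C v_pos
      by (intro add_left_mono divide_right_mono add_mono mult_right_mono) (auto simp: D_def)
    finally show "Sv (n + k) x y \<le> \<delta> * Sv n x y + D / sqrt (real k) * (Sv n x y + Fx n x y + Ty n x y)"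
      by (simp add: algebra_simps add_divide_distrib)
  qed
qed

text \<open>Markov property at time \<open>n\<close>: the bound for the overshoots from a fixed
  start is averaged over the surviving paths, so even its constant part gains the factor
  \<open>Sv n\<close>.\<close>

lemma exit_sum_step: obtains C where "0 \<le> C"
  "\<And>n k x y. 0 < y \<Longrightarrow> (\<Sum>j=n..<n+k. (kill_op ^^ j) exit_abs x y) \<le> C * ((real k powr (1/p) + 1) * Sv n x y + Fx n x y)"
proof -
  obtain C where C: "0 \<le> C" and b: "\<And>k x y. 0 < y \<Longrightarrow> (\<Sum>j<k. (kill_op ^^ j) exit_abs x y) \<le> C * (real k powr (1/p) + 1 + \<bar>x\<bar>)"
    by (metis exit_sum_bound)
  show thesis
  proof
    show "0 \<le> C" by fact
    fix n k :: nat and x y :: real assume y: "0 < y"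
    have sum_eq: "(kill_op ^^ n) (\<lambda>x y. \<Sum>j\<in>I. (kill_op ^^ j) exit_abs x y) x y = (\<Sum>j\<in>I. (kill_op ^^ (n + j)) exit_abs x y)" if "finite I" for I
      using that
    proof (induction I)
      case (insert j I)
      have "(kill_op ^^ n) (\<lambda>x y. (kill_op ^^ j) exit_abs x y + (\<Sum>j\<in>I. (kill_op ^^ j) exit_abs x y)) =
        (\<lambda>x y. (kill_op ^^ n) ((kill_op ^^ j) exit_abs) x y + (kill_op ^^ n) (\<lambda>x y. \<Sum>j\<in>I. (kill_op ^^ j) exit_abs x y) x y)"
        by (intro kill_pow_add tame_kill_pow tame_exit_abs tame_sum)
      with insert show ?case by (simp add: kill_pow_pow)
    qed (simp add: kill_pow_zero)
    have "(\<Sum>j=n..<n+k. (kill_op ^^ j) exit_abs x y) = (\<Sum>j<k. (kill_op ^^ (n + j)) exit_abs x y)"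
      by (simp add: sum.shift_bounds_nat_ivl[of _ 0 n k, simplified] add.commute lessThan_atLeast0)
    also have "\<dots> = (kill_op ^^ n) (\<lambda>x y. \<Sum>j<k. (kill_op ^^ j) exit_abs x y) x y"
      by (simp add: sum_eq)
    also have "\<dots> \<le> (kill_op ^^ n) (\<lambda>x y. 0 * y + (C * (real k powr (1/p) + 1) + C * \<bar>x\<bar>)) x y"
      using b by (intro kill_pow_mono[OF _ tame_lin _ y] tame_sum tame_kill_pow tame_exit_abs) (simp add: distrib_left add.assoc)
    also have "\<dots> = C * ((real k powr (1/p) + 1) * Sv n x y + Fx n x y)"
      by (subst kill_pow_lin) (simp add: algebra_simps)
    finally show "(\<Sum>j=n..<n+k. (kill_op ^^ j) exit_abs x y) \<le> C * ((real k powr (1/p) + 1) * Sv n x y + Fx n x y)" .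
  qed
qed

lemma Ez_diff:
  assumes y: "0 < y"
  shows "\<bar>Ez (n + k) x y - Ez n x y\<bar> \<le> (1 + \<bar>\<rho>\<bar>) * (\<Sum>j=n..<n+k. (kill_op ^^ j) exit_abs x y)"
proof -
  have "Ez (n + k) x y - Ez n x y = - (\<Sum>j=n..<n+k. (kill_op ^^ j) exit_z x y)"
    unfolding Ez_def kill_pow_z using sum.atLeastLessThan_concat[of 0 n "n + k" "\<lambda>j. (kill_op ^^ j) exit_z x y"]
    by (simp add: lessThan_atLeast0)
  also have "\<bar>\<dots>\<bar> \<le> (\<Sum>j=n..<n+k. \<bar>(kill_op ^^ j) exit_z x y\<bar>)" by simp
  also have "\<dots> \<le> (\<Sum>j=n..<n+k. (kill_op ^^ j) (\<lambda>x y. (1 + \<bar>\<rho>\<bar>) * exit_abs x y) x y)"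
    by (intro sum_mono kill_pow_abs_le tame_exit_z tame_cmult tame_exit_abs exit_z_abs_le y)
  finally show ?thesis by (simp add: kill_pow_cmult sum_distrib_left)
qed

lemma Ty_Ez: assumes y: "0 < y" shows "\<bar>Ty n x y - Ez n x y\<bar> \<le> \<bar>\<rho>\<bar> * Fx n x y"
proof -
  have "Ez n x y = Ty n x y + \<rho> * (kill_op ^^ n) (\<lambda>x y. x) x y"
    unfolding Ez_def Ty_def by (subst kill_pow_add) (auto simp: kill_pow_cmult tame_x tame_y)
  moreover have "\<bar>(kill_op ^^ n) (\<lambda>x y. x) x y\<bar> \<le> Fx n x y"
    unfolding Fx_def by (intro kill_pow_abs_le tame_x tame_absx y) simp
  then have "\<bar>\<rho> * (kill_op ^^ n) (\<lambda>x y. x) x y\<bar> \<le> \<bar>\<rho>\<bar> * Fx n x y"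
    unfolding abs_mult by (intro mult_left_mono) auto
  ultimately show ?thesis by simp
qed

lemma exit_pow_nonneg: "0 < y \<Longrightarrow> 0 \<le> (kill_op ^^ j) exit_abs x y"
  by (intro kill_pow_nonneg tame_exit_abs exit_abs_nonneg)

text \<open>From \<open>2 ^ j\<close> to \<open>2 ^ Suc j\<close>, survival is governed by the mean
  height at time \<open>2 ^ j\<close>, which is the mean of the martingale up to \<open>Fx\<close>;
  and that mean changes only by the overshoots of surviving paths. These are the three inequalities
  of \<open>doubling_recursion\<close>.\<close>

lemma dyadic_bound: obtains J K where "0 \<le> K" "\<And>j x y. J \<le> j \<Longrightarrow> 0 < y \<Longrightarrow>
   sqrt (2 ^ j) * Sv (2 ^ j) x y \<le> K * (1 + y + \<bar>x\<bar>) \<and> sqrt (2 ^ j) * Fx (2 ^ j) x y \<le> K * (1 + y + \<bar>x\<bar>)"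
proof -
  obtain CF where CF: "0 \<le> CF" and F: "\<And>n k x y. 0 < y \<Longrightarrow> Fx (n + k) x y \<le> a1 ^ k * Fx n x y + CF * Sv n x y"
    by (metis Fx_step)
  \<comment> \<open>The choice 1/16 leaves room: after the factor \<open>sqrt 2 \<le> 2\<close> of
    the doubling and another 1/16 from the term with \<open>CS * r ^ j\<close>, the coefficient of
    \<open>d j\<close> is 1/4.\<close>
  obtain CS where CS: "0 \<le> CS" and S: "\<And>n k x y. 1 \<le> k \<Longrightarrow> 0 < y \<Longrightarrow>
    Sv (n + k) x y \<le> 1/16 * Sv n x y + CS / sqrt (real k) * (Sv n x y + Fx n x y + Ty n x y)"
    using Sv_step[of "1/16"] by auto
  obtain CE where CE: "0 \<le> CE" and E: "\<And>n k x y. 0 < y \<Longrightarrow>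
    (\<Sum>j=n..<n+k. (kill_op ^^ j) exit_abs x y) \<le> CE * ((real k powr (1/p) + 1) * Sv n x y + Fx n x y)"
    by (metis exit_sum_step)
  \<comment> \<open>Ratio of the overshoot scale to the diffusive scale over one doubling; it is
    below 1 precisely because \<open>2 < p\<close>.\<close>
  define r where "r = 2 powr (1/p - 1/2)"
  have r: "0 < r" "r < 1"
  proof -
    have "1/p - 1/2 < 0" using p_gt by (simp add: field_simps)
    then have "2 powr (1/p - 1/2) < 2 powr 0" by (intro powr_less_mono) auto
    then show "0 < r" "r < 1" by (auto simp: r_def)
  qed
  have rj: "r ^ j = (2 ^ j) powr (1/p) / sqrt (2 ^ j)" for j
  proof -
    have "r ^ j = r powr real j" using r by (simp add: powr_realpow)
    also have "\<dots> = (2 powr real j) powr (1/p - 1/2)" by (simp add: r_def powr_powr mult.commute)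
    also have "\<dots> = (2 ^ j) powr (1/p) / (2 ^ j) powr (1/2)" by (simp add: powr_realpow powr_diff)
    finally show ?thesis by (simp add: powr_half_sqrt)
  qed
  have inv_le: "1 / sqrt (2 ^ j) \<le> r ^ j" for j
  proof -
    have "1 \<le> (2 ^ j :: real) powr (1/p)" using p_gt by (intro ge_one_powr_ge_zero) auto
    then show ?thesis unfolding rj by (intro divide_right_mono) auto
  qed
  define C where "C = 1 + 2 * CF + 2 * CS * (1 + \<bar>\<rho>\<bar>) + 2 * CE * (1 + \<bar>\<rho>\<bar>)"
  have nn: "0 \<le> CS * \<bar>\<rho>\<bar>" "0 \<le> CE * \<bar>\<rho>\<bar>" using CS CE by auto
  have C: "1 \<le> C" "2 * CF \<le> C" "2 * CS * (1 + \<bar>\<rho>\<bar>) \<le> C" "2 * CE * (1 + \<bar>\<rho>\<bar>) \<le> C" "2 * CS \<le> C"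
    using CF CS CE nn by (auto simp: C_def distrib_left)
  have sq2: "sqrt 2 \<le> 2" "0 \<le> sqrt (2::real)" by (auto intro: real_le_lsqrt)
  have "(\<lambda>j. a1 ^ (2 ^ j)) \<longlonglongrightarrow> 0"
  proof -
    have "filterlim (\<lambda>j. 2 ^ j :: nat) at_top sequentially"
      by (rule filterlim_subseq) (simp add: strict_mono_def)
    from filterlim_compose[OF LIMSEQ_realpow_zero[OF l1_nonneg l1_lt] this] show ?thesis .
  qed
  then have 1: "\<forall>\<^sub>F j in sequentially. a1 ^ (2 ^ j) < 1/8" by (intro order_tendstoD(2)) auto
  have "(\<lambda>j. CS * r ^ j) \<longlonglongrightarrow> CS * 0" using r by (intro tendsto_intros LIMSEQ_realpow_zero) auto
  then have 2: "\<forall>\<^sub>F j in sequentially. CS * r ^ j < 1/16" by (intro order_tendstoD(2)) auto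
  obtain J0 where J0: "\<And>j. J0 \<le> j \<Longrightarrow> a1 ^ (2 ^ j) < 1/8 \<and> CS * r ^ j < 1/16"
    using eventually_conj[OF 1 2] by (auto simp: eventually_sequentially)
  obtain J K where J: "J0 \<le> J" and K: "0 \<le> K" and rec:
    "\<And>e d f j. (\<And>j. 0 \<le> e j) \<Longrightarrow> (\<And>j. 0 \<le> d j) \<Longrightarrow> (\<And>j. 0 \<le> f j) \<Longrightarrow>
      (\<And>j. J0 \<le> j \<Longrightarrow> f (Suc j) \<le> f j / 4 + C * d j) \<Longrightarrow>
      (\<And>j. J0 \<le> j \<Longrightarrow> d (Suc j) \<le> d j / 4 + C * e j + C * r ^ j * f j) \<Longrightarrow>
      (\<And>j. J0 \<le> j \<Longrightarrow> e (Suc j) \<le> e j + C * r ^ j * (d j + f j)) \<Longrightarrow> J \<le> j \<Longrightarrow>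
      d j \<le> K * (e J + d J + f J) \<and> f j \<le> K * (e J + d J + f (J::nat))"
    using doubling_recursion[OF C(1) r, of J0] by metis
  define s where "s = sqrt (2 ^ J)"
  have s0: "0 \<le> s" by (simp add: s_def)
  define K2 where "K2 = (1 + \<bar>\<rho>\<bar>) + (1 + \<bar>\<rho>\<bar>) * CE * ((2 ^ J) powr (1/p) + 2) + s + s * (1 + CF)"
  show thesis
  proof
    have "0 \<le> K2" unfolding K2_def using CE CF s0 by (intro add_nonneg_nonneg mult_nonneg_nonneg) auto
    then show "0 \<le> K * K2" using K by simp
    fix j x y assume j: "J \<le> j" and y: "(0::real) < y"
    define d where "d = (\<lambda>j. sqrt (2 ^ j) * Sv (2 ^ j) x y)"
    define f where "f = (\<lambda>j. sqrt (2 ^ j) * Fx (2 ^ j) x y)"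
    define e where "e = (\<lambda>j. \<bar>Ez (2 ^ j) x y\<bar>)"
    have d0: "0 \<le> d j" for j unfolding d_def using Sv_nonneg[OF y] by simp
    have f0: "0 \<le> f j" for j unfolding f_def using Fx_nonneg[OF y] by simp
    have dbl: "(2::nat) ^ Suc j = 2 ^ j + 2 ^ j" "sqrt (2 ^ Suc j) = sqrt 2 * sqrt (2 ^ j)" for j
      by (simp_all add: real_sqrt_mult)
    have sj: "0 < sqrt (2 ^ j :: real)" for j :: nat by simp
    have Tb: "Ty (2 ^ j) x y \<le> e j + \<bar>\<rho>\<bar> * Fx (2 ^ j) x y" for j
      using Ty_Ez[OF y, of "2 ^ j" x] by (simp add: e_def)
    have Sd: "Sv (2 ^ j) x y = d j * (1 / sqrt (2 ^ j))" "Fx (2 ^ j) x y = f j * (1 / sqrt (2 ^ j))" for j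
      by (simp_all add: d_def f_def)
    have "d j \<le> K * (e J + d J + f J) \<and> f j \<le> K * (e J + d J + f J)"
    proof (rule rec)
      show "0 \<le> e j" for j by (simp add: e_def)
      show "0 \<le> d j" for j by (rule d0)
      show "0 \<le> f j" for j by (rule f0)
      show "J \<le> j" by fact
    next
      fix j assume j: "J0 \<le> j"
      have "f (Suc j) \<le> sqrt 2 * sqrt (2 ^ j) * (a1 ^ (2 ^ j) * Fx (2 ^ j) x y + CF * Sv (2 ^ j) x y)"
        unfolding f_def dbl by (intro mult_left_mono F y) auto
      also have "\<dots> = sqrt 2 * (a1 ^ (2 ^ j) * f j + CF * d j)"
        by (simp add: f_def d_def algebra_simps)
      also have "\<dots> \<le> 2 * (1/8 * f j + CF * d j)"
        using sq2 J0[OF j] f0[of j] d0[of j] CF l1_nonneg by (intro mult_mono add_mono mult_right_mono add_nonneg_nonneg mult_nonneg_nonneg) auto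
      also have "\<dots> \<le> f j / 4 + C * d j" using mult_right_mono[OF C(2) d0[of j]] by simp
      finally show "f (Suc j) \<le> f j / 4 + C * d j" .
    next
      fix j assume j: "J0 \<le> j"
      have "d (Suc j) \<le> sqrt 2 * sqrt (2 ^ j) * (1/16 * Sv (2 ^ j) x y + CS / sqrt (real (2 ^ j)) * (Sv (2 ^ j) x y + Fx (2 ^ j) x y + Ty (2 ^ j) x y))"
        unfolding d_def dbl by (intro mult_left_mono S y) auto
      also have "\<dots> \<le> sqrt 2 * sqrt (2 ^ j) * (1/16 * Sv (2 ^ j) x y + CS / sqrt (real (2 ^ j)) * (Sv (2 ^ j) x y + Fx (2 ^ j) x y + (e j + \<bar>\<rho>\<bar> * Fx (2 ^ j) x y)))"
        using CS Tb by (intro mult_left_mono add_left_mono) auto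
      also have "\<dots> = sqrt 2 * (1/16 * d j + CS * (1 / sqrt (2 ^ j)) * d j + CS * e j + CS * (1 + \<bar>\<rho>\<bar>) * (1 / sqrt (2 ^ j)) * f j)"
      proof -
        have "w * Q * (1/16 * (D * (1 / Q)) + CS / Q * (D * (1 / Q) + F * (1 / Q) + (E + R * (F * (1 / Q)))))
          = w * (1/16 * D + CS * (1 / Q) * D + CS * E + CS * (1 + R) * (1 / Q) * F)" if "0 < Q" for w Q D F E R :: real
          using that by (simp add: field_simps)
        then show ?thesis unfolding Sd of_nat_power of_nat_numeral using sj[of j] by blast
      qed
      also have "\<dots> \<le> 2 * (1/16 * d j + CS * r ^ j * d j + CS * e j + CS * (1 + \<bar>\<rho>\<bar>) * r ^ j * f j)"
        using sq2 CS f0[of j] d0[of j] inv_le[of j] r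
        by (intro mult_mono add_mono mult_right_mono mult_left_mono add_nonneg_nonneg mult_nonneg_nonneg) (auto simp: e_def)
      also have "\<dots> \<le> 2 * (1/16 * d j + 1/16 * d j + CS * e j + CS * (1 + \<bar>\<rho>\<bar>) * r ^ j * f j)"
        using J0[OF j] d0[of j] by (intro mult_left_mono add_mono mult_right_mono order_refl) auto
      also have "\<dots> = d j / 4 + 2 * CS * e j + 2 * CS * (1 + \<bar>\<rho>\<bar>) * (r ^ j * f j)" by simp
      also have "\<dots> \<le> d j / 4 + C * e j + C * (r ^ j * f j)"
        using C r f0[of j] by (intro add_mono mult_right_mono) (auto simp: e_def)
      finally show "d (Suc j) \<le> d j / 4 + C * e j + C * r ^ j * f j" by (simp add: mult.assoc)
    next
      fix j
      have "\<bar>Ez (2 ^ j + 2 ^ j) x y - Ez (2 ^ j) x y\<bar> \<le> (1 + \<bar>\<rho>\<bar>) * (CE * ((real (2 ^ j) powr (1/p) + 1) * Sv (2 ^ j) x y + Fx (2 ^ j) x y))"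
        using Ez_diff[OF y, of "2 ^ j" "2 ^ j" x] E[OF y, of x "2 ^ j" "2 ^ j"] by (meson abs_ge_zero add_nonneg_nonneg mult_left_mono order_trans zero_le_one)
      also have "\<dots> = CE * (1 + \<bar>\<rho>\<bar>) * ((r ^ j + 1 / sqrt (2 ^ j)) * d j + 1 / sqrt (2 ^ j) * f j)"
        unfolding Sd rj using sj[of j] by (simp add: field_simps)
      also have "\<dots> \<le> CE * (1 + \<bar>\<rho>\<bar>) * ((r ^ j + r ^ j) * d j + (r ^ j + r ^ j) * f j)"
      proof -
        have "0 \<le> r ^ j" using r by simp
        then have "1 / sqrt (2 ^ j) \<le> r ^ j + r ^ j" using inv_le[of j] by linarith
        then show ?thesis
          using inv_le[of j] CE d0[of j] f0[of j] by (intro mult_left_mono add_mono mult_right_mono) auto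
      qed
      also have "\<dots> = 2 * CE * (1 + \<bar>\<rho>\<bar>) * (r ^ j * (d j + f j))" by (simp add: algebra_simps)
      also have "\<dots> \<le> C * (r ^ j * (d j + f j))" using C r d0[of j] f0[of j] by (intro mult_right_mono) auto
      finally show "e (Suc j) \<le> e j + C * r ^ j * (d j + f j)" unfolding e_def dbl by (simp add: mult.assoc)
    qed
    \<comment> \<open>\<open>J\<close> is a fixed index, so crude bounds at time
      \<open>2 ^ J\<close> suffice, provided they are linear in the starting point.\<close>
    moreover have "e J + d J + f J \<le> K2 * (1 + y + \<bar>x\<bar>)"
    proof -
      let ?w = "1 + y + \<bar>x\<bar>"
      have F0: "Fx 0 x y = \<bar>x\<bar>" "Sv 0 x y = 1" "Ez 0 x y = y + \<rho> * x" by (simp_all add: Fx_def Sv_def Ez_def)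
      have w: "1 \<le> ?w" "\<bar>x\<bar> \<le> ?w" "y \<le> ?w" using y by auto
      have "\<bar>y + \<rho> * x\<bar> \<le> y + \<bar>\<rho>\<bar> * \<bar>x\<bar>" using abs_z_le[of y x] y by simp
      also have "\<dots> \<le> ?w + \<bar>\<rho>\<bar> * ?w" using w by (intro add_mono mult_left_mono) auto
      finally have a: "\<bar>y + \<rho> * x\<bar> \<le> (1 + \<bar>\<rho>\<bar>) * ?w" by (simp add: distrib_right)
      have "\<bar>Ez (0 + 2 ^ J) x y - Ez 0 x y\<bar> \<le> (1 + \<bar>\<rho>\<bar>) * (CE * ((real (2 ^ J) powr (1/p) + 1) * Sv 0 x y + Fx 0 x y))"
        using Ez_diff[OF y, of 0 "2 ^ J" x] E[OF y, of x 0 "2 ^ J"] by (meson abs_ge_zero add_nonneg_nonneg mult_left_mono order_trans zero_le_one)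
      also have "\<dots> \<le> (1 + \<bar>\<rho>\<bar>) * (CE * (((2 ^ J) powr (1/p) + 1) * ?w + ?w))"
        unfolding F0 of_nat_power of_nat_numeral using w CE by (intro mult_left_mono add_mono) auto
      also have "\<dots> = (1 + \<bar>\<rho>\<bar>) * CE * ((2 ^ J) powr (1/p) + 2) * ?w" by (simp add: algebra_simps)
      finally have "\<bar>Ez (2 ^ J) x y - (y + \<rho> * x)\<bar> \<le> (1 + \<bar>\<rho>\<bar>) * CE * ((2 ^ J) powr (1/p) + 2) * ?w"
        unfolding F0 by simp
      moreover have "e J \<le> \<bar>y + \<rho> * x\<bar> + \<bar>Ez (2 ^ J) x y - (y + \<rho> * x)\<bar>"
        unfolding e_def by linarith
      ultimately have 1: "e J \<le> (1 + \<bar>\<rho>\<bar>) * ?w + (1 + \<bar>\<rho>\<bar>) * CE * ((2 ^ J) powr (1/p) + 2) * ?w"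
        using a by (meson add_mono order_trans)
      have "Sv (2 ^ J) x y \<le> ?w" using Sv_le_1[OF y, of "2 ^ J" x] w by linarith
      then have 2: "d J \<le> s * ?w" unfolding d_def s_def by (intro mult_left_mono) auto
      have "Fx (0 + 2 ^ J) x y \<le> a1 ^ (2 ^ J) * Fx 0 x y + CF * Sv 0 x y" by (rule F[OF y])
      also have "\<dots> \<le> 1 * ?w + CF * ?w"
        unfolding F0 using w CF l1_nonneg l1_lt by (intro add_mono mult_mono power_le_one) auto
      finally have "Fx (2 ^ J) x y \<le> (1 + CF) * ?w" by (simp add: distrib_right)
      then have "f J \<le> s * ((1 + CF) * ?w)" unfolding f_def s_def by (intro mult_left_mono) auto
      then have 3: "f J \<le> s * (1 + CF) * ?w" by simp
      show ?thesis using 1 2 3 unfolding K2_def by (simp add: distrib_right)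
    qed
    then have "K * (e J + d J + f J) \<le> K * (K2 * (1 + y + \<bar>x\<bar>))" using K by (intro mult_left_mono)
    ultimately show "sqrt (2 ^ j) * Sv (2 ^ j) x y \<le> K * K2 * (1 + y + \<bar>x\<bar>) \<and> sqrt (2 ^ j) * Fx (2 ^ j) x y \<le> K * K2 * (1 + y + \<bar>x\<bar>)"
      unfolding d_def f_def by (simp add: mult.assoc)
  qed
qed

end

lemma dyadic_floor:
  assumes "1 \<le> (n::nat)" obtains j where "2 ^ j \<le> n" "n < 2 * 2 ^ j"
proof -
  have "\<exists>j. 2 ^ j \<le> n \<and> n < 2 * 2 ^ j"
    using assms
  proof (induction n rule: nat_induct_at_least)
    case base show ?case by (rule exI[of _ 0]) simp
  next
    case (Suc n)
    then obtain j where j: "2 ^ j \<le> n" "n < 2 * 2 ^ j" by blast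
    show ?case
    proof (cases "Suc n < 2 * 2 ^ j")
      case True then show ?thesis using j by (intro exI[of _ j]) auto
    next
      case False
      then have "Suc n = 2 ^ Suc j" using j by simp
      then show ?thesis by (intro exI[of _ "Suc j"]) simp
    qed
  qed
  then show thesis using that by blast
qed

lemma sum_inverse_sqrt: "(\<Sum>j=1..n. 1 / sqrt (real j)) \<le> 2 * sqrt (real n)"
proof (induction n)
  case (Suc n)
  define a where "a = sqrt (real n)"
  define b where "b = sqrt (real (Suc n))"
  have b: "0 < b" and ab: "a \<le> b" by (simp_all add: a_def b_def)
  have "b * b - a * a = 1" by (simp add: a_def b_def)
  then have "(b - a) * (b + a) = 1" by (simp add: algebra_simps)
  moreover have "(b - a) * (b + a) \<le> (b - a) * (2 * b)" using ab by (intro mult_left_mono) auto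
  moreover have "(b - a) * (2 * b) = 2 * (b - a) * b" by (simp only: mult_ac)
  ultimately have "1 \<le> 2 * (b - a) * b" by linarith
  then have "1 / b \<le> 2 * (b - a)" using b by (simp add: field_simps)
  then show ?case using Suc by (simp add: a_def b_def)
qed simp

section \<open>Bounds at all times and the limit of the killed martingale\<close>

context affine_law begin

definition \<gamma> :: real where "\<gamma> = 1/2 - 1/p"

lemma gamma_pos: "0 < \<gamma>" using p_gt by (simp add: \<gamma>_def field_simps)

lemma Fx_le: obtains C where "0 \<le> C" "\<And>n x y. 0 < y \<Longrightarrow> Fx n x y \<le> \<bar>x\<bar> + C"
proof -
  obtain C where C: "0 \<le> C" and F: "\<And>n k x y. 0 < y \<Longrightarrow> Fx (n + k) x y \<le> a1 ^ k * Fx n x y + C * Sv n x y"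
    by (metis Fx_step)
  show thesis
  proof (rule that[OF C])
    fix n x y assume y: "(0::real) < y"
    have "Fx (0 + n) x y \<le> a1 ^ n * \<bar>x\<bar> + C"
      using F[OF y, of 0 n x] by (simp add: Fx_def Sv_def)
    also have "\<dots> \<le> 1 * \<bar>x\<bar> + C" using l1_nonneg l1_lt by (intro add_mono mult_right_mono power_le_one) auto
    finally show "Fx n x y \<le> \<bar>x\<bar> + C" by simp
  qed
qed

text \<open>Between doubling times survival is monotone and \<open>Fx\<close> grows at most by a
  multiple of survival; before \<open>2 ^ J\<close> trivial bounds apply. The right side is linear
  in the starting point, stronger than the power required by the first claim.\<close>

theorem survival_bound: obtains K where "0 < K" "\<And>n x y. 1 \<le> n \<Longrightarrow> 0 < y \<Longrightarrow>
   sqrt (real n) * Sv n x y \<le> K * (1 + y + \<bar>x\<bar>) \<and> sqrt (real n) * Fx n x y \<le> K * (1 + y + \<bar>x\<bar>)"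
proof -
  obtain J K where K: "0 \<le> K" and dy: "\<And>j x y. J \<le> j \<Longrightarrow> 0 < y \<Longrightarrow>
   sqrt (2 ^ j) * Sv (2 ^ j) x y \<le> K * (1 + y + \<bar>x\<bar>) \<and> sqrt (2 ^ j) * Fx (2 ^ j) x y \<le> K * (1 + y + \<bar>x\<bar>)"
    by (metis dyadic_bound)
  obtain C where C: "0 \<le> C" and F: "\<And>n k x y. 0 < y \<Longrightarrow> Fx (n + k) x y \<le> a1 ^ k * Fx n x y + C * Sv n x y"
    by (metis Fx_step)
  obtain C' where C': "0 \<le> C'" and F': "\<And>n x y. 0 < y \<Longrightarrow> Fx n x y \<le> \<bar>x\<bar> + C'" by (metis Fx_le)
  define L where "L = 1 + 2 * K * (1 + C) + sqrt (2 ^ J) * (1 + C')"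
  have L: "1 \<le> L" "2 * K * (1 + C) \<le> L" "sqrt (2 ^ J) * (1 + C') \<le> L"
    using K C C' by (auto simp: L_def)
  show thesis
  proof
    show "0 < L" using L by simp
    fix n :: nat and x y :: real assume n: "1 \<le> n" and y: "0 < y"
    let ?w = "1 + y + \<bar>x\<bar>"
    have w: "1 \<le> ?w" "\<bar>x\<bar> \<le> ?w" using y by auto
    obtain j where j: "2 ^ j \<le> n" "n < 2 * 2 ^ j" using dyadic_floor[OF n] .
    show "sqrt (real n) * Sv n x y \<le> L * ?w \<and> sqrt (real n) * Fx n x y \<le> L * ?w"
    proof (cases "J \<le> j")
      case True
      have Sn: "Sv n x y \<le> Sv (2 ^ j) x y" by (rule Sv_antimono[OF j(1) y])
      have "Fx (2 ^ j + (n - 2 ^ j)) x y \<le> a1 ^ (n - 2 ^ j) * Fx (2 ^ j) x y + C * Sv (2 ^ j) x y" by (rule F[OF y])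
      also have "\<dots> \<le> 1 * Fx (2 ^ j) x y + C * Sv (2 ^ j) x y"
        using l1_nonneg l1_lt Fx_nonneg[OF y] by (intro add_mono mult_right_mono power_le_one order_refl) auto
      finally have Fn: "Fx n x y \<le> Fx (2 ^ j) x y + C * Sv (2 ^ j) x y" using j by simp
      have "n \<le> 4 * 2 ^ j" using j(2) by simp
      then have "real n \<le> real (4 * 2 ^ j)" by (simp only: of_nat_le_iff)
      then have "real n \<le> 4 * 2 ^ j" by simp
      then have "sqrt (real n) \<le> sqrt (4 * 2 ^ j)" by simp
      then have sn: "sqrt (real n) \<le> 2 * sqrt (2 ^ j)" by (simp add: real_sqrt_mult)
      have "sqrt (real n) * Sv n x y \<le> (2 * sqrt (2 ^ j)) * Sv (2 ^ j) x y"
        using sn Sn Sv_nonneg[OF y] by (intro mult_mono) auto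
      also have "\<dots> \<le> 2 * (K * ?w)" using dy[OF True y, of x] by simp
      also have "\<dots> \<le> 2 * K * (1 + C) * ?w"
      proof -
        have "2 * (K * ?w) * 1 \<le> 2 * (K * ?w) * (1 + C)" using K C w by (intro mult_left_mono) auto
        then show ?thesis by (simp only: mult_ac mult_1_right)
      qed
      also have "\<dots> \<le> L * ?w" using L w by (intro mult_right_mono) auto
      finally have 1: "sqrt (real n) * Sv n x y \<le> L * ?w" .
      have "sqrt (real n) * Fx n x y \<le> (2 * sqrt (2 ^ j)) * (Fx (2 ^ j) x y + C * Sv (2 ^ j) x y)"
        using sn Fn Fx_nonneg[OF y] by (intro mult_mono) auto
      also have "\<dots> = 2 * (sqrt (2 ^ j) * Fx (2 ^ j) x y + C * (sqrt (2 ^ j) * Sv (2 ^ j) x y))" by (simp add: algebra_simps)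
      also have "\<dots> \<le> 2 * (K * ?w + C * (K * ?w))"
        using dy[OF True y, of x] C by (intro mult_left_mono add_mono) auto
      also have "\<dots> = 2 * K * (1 + C) * ?w" by (simp add: algebra_simps)
      also have "\<dots> \<le> L * ?w" using L w by (intro mult_right_mono) auto
      finally show ?thesis using 1 by simp
    next
      case False
      then have "(2::nat) ^ Suc j \<le> 2 ^ J" by (intro power_increasing) auto
      then have "n \<le> 2 ^ J" using j(2) by simp
      then have "real n \<le> real (2 ^ J)" by (simp only: of_nat_le_iff)
      then have "real n \<le> 2 ^ J" by simp
      then have sn: "sqrt (real n) \<le> sqrt (2 ^ J)" by simp
      have "sqrt (real n) * Sv n x y \<le> sqrt (2 ^ J) * ((1 + C') * ?w)"
      proof (intro mult_mono sn)
        have "1 * 1 \<le> (1 + C') * ?w" using C' w by (intro mult_mono) auto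
        then show "Sv n x y \<le> (1 + C') * ?w" using Sv_le_1[OF y, of n x] by linarith
      qed (use Sv_nonneg[OF y] in auto)
      also have "\<dots> \<le> L * ?w" using L w by (simp add: mult.assoc[symmetric] mult_right_mono)
      finally have 1: "sqrt (real n) * Sv n x y \<le> L * ?w" .
      have "sqrt (real n) * Fx n x y \<le> sqrt (2 ^ J) * ((1 + C') * ?w)"
      proof (intro mult_mono sn)
        have "C' * 1 \<le> C' * ?w" using C' w by (intro mult_left_mono) auto
        then show "Fx n x y \<le> (1 + C') * ?w" using F'[OF y, of n x] w by (simp add: distrib_right)
      qed (use Fx_nonneg[OF y] in auto)
      also have "\<dots> \<le> L * ?w" using L w by (simp add: mult.assoc[symmetric] mult_right_mono)
      finally show ?thesis using 1 by simp
    qed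
  qed
qed

text \<open>Over a block from \<open>n\<close> to \<open>2 * n\<close> the overshoots are of order
  \<open>n powr (1/p)\<close>, on an event of probability of order \<open>1 / sqrt n\<close>. The
  blocks add up geometrically with ratio \<open>2 powr (- \<gamma>)\<close>.\<close>

lemma exit_tail: obtains C where "0 \<le> C" "\<And>n k x y. 1 \<le> n \<Longrightarrow> 0 < y \<Longrightarrow>
  (\<Sum>j=n..<n+k. (kill_op ^^ j) exit_abs x y) \<le> C * (1 + y + \<bar>x\<bar>) * real n powr (- \<gamma>)"
proof -
  obtain K where K: "0 < K" and sb: "\<And>n x y. 1 \<le> n \<Longrightarrow> 0 < y \<Longrightarrow>
   sqrt (real n) * Sv n x y \<le> K * (1 + y + \<bar>x\<bar>) \<and> sqrt (real n) * Fx n x y \<le> K * (1 + y + \<bar>x\<bar>)"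
    by (metis survival_bound)
  obtain CE where CE: "0 \<le> CE" and E: "\<And>n k x y. 0 < y \<Longrightarrow>
    (\<Sum>j=n..<n+k. (kill_op ^^ j) exit_abs x y) \<le> CE * ((real k powr (1/p) + 1) * Sv n x y + Fx n x y)"
    by (metis exit_sum_step)
  define C where "C = 3 * CE * K"
  have C: "0 \<le> C" using CE K by (simp add: C_def)
  have block: "(\<Sum>j=n..<n+n. (kill_op ^^ j) exit_abs x y) \<le> C * (1 + y + \<bar>x\<bar>) * real n powr (- \<gamma>)"
    if n: "1 \<le> n" and y: "0 < y" for n x y
  proof -
    let ?w = "1 + y + \<bar>x\<bar>"
    have sn: "0 < sqrt (real n)" using n by simp
    have S: "Sv n x y \<le> K * ?w / sqrt (real n)" and F: "Fx n x y \<le> K * ?w / sqrt (real n)"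
      using sb[OF n y, of x] sn by (simp_all add: pos_le_divide_eq mult.commute)
    have q: "real n powr (- \<gamma>) = real n powr (1/p) / sqrt (real n)"
    proof -
      have "real n powr (- \<gamma>) = real n powr (1/p - 1/2)" by (simp add: \<gamma>_def)
      also have "\<dots> = real n powr (1/p) / real n powr (1/2)" by (rule powr_diff)
      finally show ?thesis by (simp add: powr_half_sqrt)
    qed
    have g: "1 \<le> real n powr (1/p)" using n p_gt by (intro ge_one_powr_ge_zero) auto
    have "(\<Sum>j=n..<n+n. (kill_op ^^ j) exit_abs x y) \<le> CE * ((real n powr (1/p) + 1) * Sv n x y + Fx n x y)" by (rule E[OF y])
    also have "\<dots> \<le> CE * ((real n powr (1/p) + 1) * (K * ?w / sqrt (real n)) + 1 * (K * ?w / sqrt (real n)))"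
      using S F CE g by (intro mult_left_mono add_mono) auto
    also have "\<dots> = CE * ((real n powr (1/p) + 2) * (K * ?w / sqrt (real n)))"
    proof -
      have "(g + 1) * q + 1 * q = (g + 2) * q" for g q :: real by (simp add: algebra_simps)
      then show ?thesis by (simp only:)
    qed
    also have "\<dots> \<le> CE * ((3 * real n powr (1/p)) * (K * ?w / sqrt (real n)))"
      using CE g K y by (intro mult_left_mono mult_right_mono) auto
    also have "\<dots> = C * ?w * real n powr (- \<gamma>)" unfolding q by (simp add: C_def)
    finally show ?thesis .
  qed
  define r where "r = 2 powr (- \<gamma>)"
  have r: "0 < r" "r < 1"
    using gamma_pos powr_less_mono[of "- \<gamma>" 0 2] by (auto simp: r_def)
  have dbl: "(\<Sum>j=n..<2^i * n. (kill_op ^^ j) exit_abs x y) \<le> C * (1 + y + \<bar>x\<bar>) * real n powr (- \<gamma>) * (\<Sum>u<i. r ^ u)"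
    if n: "1 \<le> n" and y: "0 < y" for n i x y
  proof (induction i)
    case (Suc i)
    have le: "n \<le> 2 ^ i * n" by simp
    have d2: "2 ^ Suc i * n = 2 ^ i * n + 2 ^ i * n" by simp
    have "(\<Sum>j=n..<2^Suc i * n. (kill_op ^^ j) exit_abs x y)
      = (\<Sum>j=n..<2^i * n. (kill_op ^^ j) exit_abs x y) + (\<Sum>j=2^i * n..<2^i * n + 2^i * n. (kill_op ^^ j) exit_abs x y)"
      using sum.atLeastLessThan_concat[of n "2^i * n" "2 ^ i * n + 2 ^ i * n" "\<lambda>j. (kill_op ^^ j) exit_abs x y"] le
      unfolding d2 by simp
    also have "(\<Sum>j=2^i * n..<2^i * n + 2^i * n. (kill_op ^^ j) exit_abs x y) \<le> C * (1 + y + \<bar>x\<bar>) * real (2 ^ i * n) powr (- \<gamma>)"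
      using n y by (intro block) auto
    also have "real (2 ^ i * n) powr (- \<gamma>) = real n powr (- \<gamma>) * r ^ i"
    proof -
      have "real (2 ^ i * n) powr (- \<gamma>) = (2 powr real i) powr (- \<gamma>) * real n powr (- \<gamma>)"
        by (simp add: powr_mult powr_realpow)
      also have "(2 powr real i) powr (- \<gamma>) = r powr real i" by (simp add: r_def powr_powr mult.commute)
      also have "\<dots> = r ^ i" using r by (simp add: powr_realpow)
      finally show ?thesis by simp
    qed
    finally show ?case using Suc by (simp add: algebra_simps)
  qed simp
  show thesis
  proof
    show "0 \<le> C / (1 - r)" using C r by simp
    fix n k :: nat and x y :: real assume n: "1 \<le> n" and y: "0 < y"
    \<comment> \<open>Covering with \<open>k\<close> doublings is wasteful, but the geometric sum is
      bounded independently of their number.\<close>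
    have "n + k \<le> 2 ^ k * n"
    proof -
      have "k + 1 \<le> (2::nat) ^ k" using less_exp[of k] by linarith
      then have "(k + 1) * n \<le> 2 ^ k * n" by (rule mult_right_mono) simp
      moreover have "k * 1 \<le> k * n" using n by (intro mult_left_mono) auto
      ultimately show ?thesis unfolding distrib_right by linarith
    qed
    then have "(\<Sum>j=n..<n+k. (kill_op ^^ j) exit_abs x y) \<le> (\<Sum>j=n..<2^k * n. (kill_op ^^ j) exit_abs x y)"
      using exit_pow_nonneg[OF y] by (intro sum_mono2) auto
    also have "\<dots> \<le> C * (1 + y + \<bar>x\<bar>) * real n powr (- \<gamma>) * (\<Sum>u<k. r ^ u)" by (rule dbl[OF n y])
    also have "\<dots> \<le> C * (1 + y + \<bar>x\<bar>) * real n powr (- \<gamma>) * (1 / (1 - r))"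
    proof (intro mult_left_mono)
      have "(\<Sum>i<k. r ^ i) = (1 - r ^ k) / (1 - r)" using r by (simp add: sum_gp_strict)
      also have "\<dots> \<le> 1 / (1 - r)" using r by (simp add: divide_right_mono)
      finally show "(\<Sum>i<k. r ^ i) \<le> 1 / (1 - r)" .
    qed (use C y in auto)
    finally show "(\<Sum>j=n..<n+k. (kill_op ^^ j) exit_abs x y) \<le> C / (1 - r) * (1 + y + \<bar>x\<bar>) * real n powr (- \<gamma>)" by (simp add: mult_ac)
  qed
qed

lemma exit_summable: assumes y: "0 < y" shows "summable (\<lambda>j. (kill_op ^^ j) exit_abs x y)"
proof -
  obtain C where C: "0 \<le> C" and t: "\<And>n k x y. 1 \<le> n \<Longrightarrow> 0 < y \<Longrightarrow>
  (\<Sum>j=n..<n+k. (kill_op ^^ j) exit_abs x y) \<le> C * (1 + y + \<bar>x\<bar>) * real n powr (- \<gamma>)" by (metis exit_tail)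
  show ?thesis
  proof (rule summableI_nonneg_bounded)
    fix n
    show "0 \<le> (kill_op ^^ n) exit_abs x y" by (rule exit_pow_nonneg[OF y])
    have "(\<Sum>j<n. (kill_op ^^ j) exit_abs x y) \<le> (\<Sum>j<1+n. (kill_op ^^ j) exit_abs x y)"
      using exit_pow_nonneg[OF y] by (intro sum_mono2) auto
    also have "\<dots> = (\<Sum>j<1. (kill_op ^^ j) exit_abs x y) + (\<Sum>j=1..<1+n. (kill_op ^^ j) exit_abs x y)"
      using sum.atLeastLessThan_concat[of 0 1 "1+n" "\<lambda>j. (kill_op ^^ j) exit_abs x y"] by (simp add: lessThan_atLeast0)
    also have "\<dots> \<le> exit_abs x y + C * (1 + y + \<bar>x\<bar>) * real 1 powr (- \<gamma>)"
      using t[of 1 y x n] y by simp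
    finally show "(\<Sum>j<n. (kill_op ^^ j) exit_abs x y) \<le> exit_abs x y + C * (1 + y + \<bar>x\<bar>) * real 1 powr (- \<gamma>)" .
  qed
qed

text \<open>Analytic form of \<open>V\<close>. Existence of the limit from positive heights is
  \<open>Ez_tendsto\<close>; the identification with the mean at the exit time is
  \<open>V_fun_eq_Vlim\<close>.\<close>

definition Vlim :: "real \<Rightarrow> real \<Rightarrow> real" where
  "Vlim x y = lim (\<lambda>n. Ez n x y)"

lemma Ez_tendsto: assumes y: "0 < y" shows "(\<lambda>n. Ez n x y) \<longlonglongrightarrow> Vlim x y"
proof -
  have "summable (\<lambda>j. (kill_op ^^ j) exit_z x y)"
  proof (rule summable_comparison_test')
    show "summable (\<lambda>j. (1 + \<bar>\<rho>\<bar>) * (kill_op ^^ j) exit_abs x y)" by (intro summable_mult exit_summable y)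
    fix j :: nat
    have "\<bar>(kill_op ^^ j) exit_z x y\<bar> \<le> (kill_op ^^ j) (\<lambda>x y. (1 + \<bar>\<rho>\<bar>) * exit_abs x y) x y"
      by (intro kill_pow_abs_le tame_exit_z tame_cmult tame_exit_abs exit_z_abs_le y)
    then show "norm ((kill_op ^^ j) exit_z x y) \<le> (1 + \<bar>\<rho>\<bar>) * (kill_op ^^ j) exit_abs x y" by (simp add: kill_pow_cmult)
  qed
  then have "(\<lambda>n. (y + \<rho> * x) - (\<Sum>j<n. (kill_op ^^ j) exit_z x y)) \<longlonglongrightarrow> (y + \<rho> * x) - (\<Sum>j. (kill_op ^^ j) exit_z x y)"
    by (intro tendsto_diff tendsto_const summable_LIMSEQ)
  then show ?thesis unfolding Vlim_def Ez_def kill_pow_z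
    using convergent_LIMSEQ_iff convergentI by blast
qed

text \<open>Overshoots before a fixed time \<open>N\<close> cost nothing in \<open>y\<close>, by
  \<open>exit_sum_bound\<close>. Those after \<open>N\<close> are proportional to
  \<open>1 + y + \<bar>x\<bar>\<close>, with a factor that is at most 1/2 once \<open>N\<close> is
  large. So half of \<open>y\<close> survives, whatever the sign of \<rho>.\<close>

lemma Ez_lower: obtains C where "0 \<le> C" "\<And>n x y. 0 < y \<Longrightarrow> y / 2 - C * (1 + \<bar>x\<bar>) \<le> Ez n x y"
proof -
  obtain C where C: "0 \<le> C" and t: "\<And>n k x y. 1 \<le> n \<Longrightarrow> 0 < y \<Longrightarrow>
  (\<Sum>j=n..<n+k. (kill_op ^^ j) exit_abs x y) \<le> C * (1 + y + \<bar>x\<bar>) * real n powr (- \<gamma>)" by (metis exit_tail)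
  obtain D where D: "0 \<le> D" and s: "\<And>k x y. 0 < y \<Longrightarrow> (\<Sum>j<k. (kill_op ^^ j) exit_abs x y) \<le> D * (real k powr (1/p) + 1 + \<bar>x\<bar>)"
    by (metis exit_sum_bound)
  define R where "R = 1 + \<bar>\<rho>\<bar>"
  have R: "1 \<le> R" by (simp add: R_def)
  have "(\<lambda>n. R * C * real n powr (- \<gamma>)) \<longlonglongrightarrow> R * C * 0"
    using gamma_pos by (intro tendsto_intros tendsto_neg_powr filterlim_real_sequentially) auto
  then have "\<forall>\<^sub>F n in sequentially. R * C * real n powr (- \<gamma>) < 1/2" by (intro order_tendstoD(2)) auto
  then obtain N0 where N0: "\<And>n. N0 \<le> n \<Longrightarrow> R * C * real n powr (- \<gamma>) < 1/2" by (auto simp: eventually_sequentially)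
  define N where "N = max N0 1"
  have N: "1 \<le> N" "R * C * real N powr (- \<gamma>) \<le> 1/2" using N0[of N] by (auto simp: N_def)
  define E where "E = R + R * D * (real N powr (1/p) + 1) + 1/2"
  show thesis
  proof
    show "0 \<le> E" using R D by (simp add: E_def)
    fix n :: nat and x y :: real assume y: "0 < y"
    have "(\<Sum>j<n. (kill_op ^^ j) exit_abs x y) \<le> (\<Sum>j<N+n. (kill_op ^^ j) exit_abs x y)"
      using exit_pow_nonneg[OF y] by (intro sum_mono2) auto
    also have "\<dots> = (\<Sum>j<N. (kill_op ^^ j) exit_abs x y) + (\<Sum>j=N..<N+n. (kill_op ^^ j) exit_abs x y)"
      using sum.atLeastLessThan_concat[of 0 N "N+n" "\<lambda>j. (kill_op ^^ j) exit_abs x y"] by (simp add: lessThan_atLeast0)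
    also have "\<dots> \<le> D * (real N powr (1/p) + 1 + \<bar>x\<bar>) + C * (1 + y + \<bar>x\<bar>) * real N powr (- \<gamma>)"
      by (intro add_mono s t y N)
    finally have "R * (\<Sum>j<n. (kill_op ^^ j) exit_abs x y) \<le> R * (D * (real N powr (1/p) + 1 + \<bar>x\<bar>) + C * (1 + y + \<bar>x\<bar>) * real N powr (- \<gamma>))"
      using R by (intro mult_left_mono) auto
    also have "\<dots> = R * D * (real N powr (1/p) + 1 + \<bar>x\<bar>) + R * C * real N powr (- \<gamma>) * (1 + y + \<bar>x\<bar>)"
      by (simp add: algebra_simps)
    also have "\<dots> \<le> R * D * ((real N powr (1/p) + 1) * (1 + \<bar>x\<bar>)) + 1/2 * (1 + y + \<bar>x\<bar>)"
    proof (intro add_mono mult_left_mono mult_right_mono N)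
      have "0 \<le> real N powr (1/p) * \<bar>x\<bar>" by simp
      then show "real N powr (1/p) + 1 + \<bar>x\<bar> \<le> (real N powr (1/p) + 1) * (1 + \<bar>x\<bar>)" by (simp add: algebra_simps)
    qed (use R D y in auto)
    finally have 1: "R * (\<Sum>j<n. (kill_op ^^ j) exit_abs x y) \<le> R * D * ((real N powr (1/p) + 1) * (1 + \<bar>x\<bar>)) + 1/2 * (1 + y + \<bar>x\<bar>)" .
    have 2: "\<bar>\<Sum>j<n. (kill_op ^^ j) exit_z x y\<bar> \<le> R * (\<Sum>j<n. (kill_op ^^ j) exit_abs x y)"
      unfolding R_def by (rule exit_z_pow_le[OF y])
    have 3: "- (R * (1 + \<bar>x\<bar>)) \<le> \<rho> * x"
    proof -
      have "\<bar>\<rho> * x\<bar> \<le> R * (1 + \<bar>x\<bar>)" unfolding abs_mult R_def by (intro mult_mono) auto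
      then show ?thesis by linarith
    qed
    have "E * (1 + \<bar>x\<bar>) = R * (1 + \<bar>x\<bar>) + R * D * ((real N powr (1/p) + 1) * (1 + \<bar>x\<bar>)) + 1/2 * (1 + \<bar>x\<bar>)"
      unfolding E_def by (simp add: algebra_simps)
    moreover have "Ez n x y = y + \<rho> * x - (\<Sum>j<n. (kill_op ^^ j) exit_z x y)" by (simp add: Ez_def kill_pow_z)
    moreover have "y / 2 - e \<le> z" if "R' \<le> P + 1/2 * (1 + y + \<bar>x\<bar>)" "\<bar>S\<bar> \<le> R'" "- a \<le> b"
      "e = a + P + 1/2 * (1 + \<bar>x\<bar>)" "z = y + b - S" for R' P S a b e z :: real
      using that by (simp add: field_simps)
    ultimately show "y / 2 - E * (1 + \<bar>x\<bar>) \<le> Ez n x y" using 1 2 3 by blast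
  qed
qed

section \<open>Asymptotics of the survival probability\<close>

text \<open>Split the time in halves: over the second half the contribution of the first decays
  geometrically, and the drift constant is multiplied by the survival probability at half time,
  already of order \<open>1 / sqrt j\<close>.\<close>

lemma x2_decay:
  assumes y: "0 < y"
  obtains K where "0 \<le> K" "\<And>j. 1 \<le> j \<Longrightarrow> (kill_op ^^ j) (\<lambda>x y. x\<^sup>2) x y \<le> K / sqrt (real j)"
proof -
  obtain K where K: "0 < K" and sb: "\<And>n x y. 1 \<le> n \<Longrightarrow> 0 < y \<Longrightarrow>
   sqrt (real n) * Sv n x y \<le> K * (1 + y + \<bar>x\<bar>) \<and> sqrt (real n) * Fx n x y \<le> K * (1 + y + \<bar>x\<bar>)"
    by (metis survival_bound)
  obtain l C where l: "0 \<le> l" "l < 1" and C: "0 \<le> C"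
    and dr: "\<And>x y. kill_op (\<lambda>x y. x\<^sup>2) x y \<le> l * x\<^sup>2 + C" by (metis x2_drift)
  define c where "c = C / (1 - l)"
  have c: "0 \<le> c" using C l by (simp add: c_def)
  define X where "X = (\<lambda>j. (kill_op ^^ j) (\<lambda>x y. x\<^sup>2) x y)"
  have X0: "0 \<le> X j" for j unfolding X_def by (intro kill_pow_nonneg tame_x2 y) simp
  have Xstep: "X (i + k) \<le> l ^ k * X i + c * Sv i x y" for i k
    unfolding X_def Sv_def c_def by (rule kill_pow_drift_pow[OF tame_x2 l C dr y])
  define A where "A = x\<^sup>2 + c"
  have A: "0 \<le> A" using c by (simp add: A_def)
  have XA: "X j \<le> A" for j
  proof -
    have "X j \<le> l ^ j * x\<^sup>2 + c" unfolding X_def c_def by (rule kill_pow_drift[OF tame_x2 l C dr y])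
    also have "\<dots> \<le> 1 * x\<^sup>2 + c" using l by (intro add_mono mult_right_mono power_le_one) auto
    finally show ?thesis by (simp add: A_def)
  qed
  have "(\<lambda>i. real i * l ^ i) \<longlonglongrightarrow> 0" using l by (intro powser_times_n_limit_0) simp
  then have "Bseq (\<lambda>i. real i * l ^ i)" by (intro convergent_imp_Bseq) (auto simp: convergent_def)
  then obtain B where B: "0 < B" "\<And>i. norm (real i * l ^ i) \<le> B" by (auto elim: BseqE)
  define w where "w = K * (1 + y + \<bar>x\<bar>)"
  have w: "0 \<le> w" using K y by (simp add: w_def)
  define K2 where "K2 = A + 2 * (B * A + c * w)"
  have K2: "A \<le> K2" "2 * (B * A + c * w) \<le> K2" using A B c w by (auto simp: K2_def)
  show thesis
  proof
    show "0 \<le> K2" using K2 A by simp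
    fix j :: nat assume j: "1 \<le> j"
    have "sqrt (real j) * X j \<le> K2"
    proof (cases "j = 1")
      case True then show ?thesis using XA[of 1] K2 by simp
    next
      case False
      define i where "i = j div 2"
      have i: "1 \<le> i" "i \<le> j - i" "j \<le> 4 * i" using j False by (auto simp: i_def)
      have "X (i + (j - i)) \<le> l ^ (j - i) * X i + c * Sv i x y" by (rule Xstep)
      also have "\<dots> \<le> l ^ i * A + c * Sv i x y"
        using l i XA X0 by (intro add_mono[OF _ order_refl] mult_mono power_decreasing) auto
      finally have Xj: "X j \<le> l ^ i * A + c * Sv i x y" using i by simp
      have "real j \<le> real (4 * i)" using i(3) by (simp only: of_nat_le_iff)
      then have "sqrt (real j) \<le> sqrt (4 * real i)" by simp
      then have sj: "sqrt (real j) \<le> 2 * sqrt (real i)" by (simp add: real_sqrt_mult)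
      have si: "sqrt (real i) \<le> real i" using i by (intro real_le_lsqrt) (auto simp: power2_eq_square)
      have "sqrt (real j) * X j \<le> (2 * sqrt (real i)) * (l ^ i * A + c * Sv i x y)"
        using sj Xj X0 by (intro mult_mono) auto
      also have "\<dots> = 2 * ((sqrt (real i) * l ^ i) * A + c * (sqrt (real i) * Sv i x y))" by (simp add: algebra_simps)
      also have "\<dots> \<le> 2 * ((real i * l ^ i) * A + c * w)"
        using si l A c sb[OF i(1) y, of x] by (intro mult_left_mono add_mono mult_right_mono) (auto simp: w_def)
      also have "\<dots> \<le> 2 * (B * A + c * w)"
        using B(2)[of i] A by (intro mult_left_mono add_mono[OF _ order_refl] mult_right_mono) auto
      finally show ?thesis using K2 by linarith
    qed
    then show "(kill_op ^^ j) (\<lambda>x y. x\<^sup>2) x y \<le> K2 / sqrt (real j)"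
      using j unfolding X_def by (simp add: pos_le_divide_eq mult.commute)
  qed
qed

text \<open>Each step adds to the second moment of the martingale at most a multiple of the mean of
  \<open>1 + x\<^sup>2\<close> on survival. This is of order \<open>1 / sqrt j\<close>, and the sum
  is of order \<open>sqrt n\<close>: height squared of order \<open>n\<close> on an event of
  probability of order \<open>1 / sqrt n\<close>.\<close>

lemma y2_growth:
  assumes y: "0 < y"
  obtains K where "0 \<le> K" "\<And>n. 1 \<le> n \<Longrightarrow> (kill_op ^^ n) (\<lambda>x y. y\<^sup>2) x y \<le> K * sqrt (real n)"
proof -
  obtain K where K: "0 < K" and sb: "\<And>n x y. 1 \<le> n \<Longrightarrow> 0 < y \<Longrightarrow>
   sqrt (real n) * Sv n x y \<le> K * (1 + y + \<bar>x\<bar>) \<and> sqrt (real n) * Fx n x y \<le> K * (1 + y + \<bar>x\<bar>)"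
    by (metis survival_bound)
  obtain X where X: "0 \<le> X" and xd: "\<And>j. 1 \<le> j \<Longrightarrow> (kill_op ^^ j) (\<lambda>x y. x\<^sup>2) x y \<le> X / sqrt (real j)"
    using x2_decay[OF y, of x] by metis
  obtain C where C: "0 \<le> C" and kz: "\<And>x y. kill_op (\<lambda>x y. (y + \<rho> * x)\<^sup>2) x y \<le> (y + \<rho> * x)\<^sup>2 + C * (1 + x\<^sup>2)"
    by (metis kill_z2)
  define w where "w = K * (1 + y + \<bar>x\<bar>)"
  have w: "0 \<le> w" using K y by (simp add: w_def)
  define A where "A = (y + \<rho> * x)\<^sup>2 + C * (1 + x\<^sup>2)"
  have A: "0 \<le> A" using C by (simp add: A_def)
  define Z where "Z = (\<lambda>n. (kill_op ^^ n) (\<lambda>x y. (y + \<rho> * x)\<^sup>2) x y)"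
  have Zstep: "Z (Suc n) \<le> Z n + C * (Sv n x y + (kill_op ^^ n) (\<lambda>x y. x\<^sup>2) x y)" for n
  proof -
    have "Z (Suc n) \<le> (kill_op ^^ n) (\<lambda>x y. (y + \<rho> * x)\<^sup>2 + C * (1 + x\<^sup>2)) x y"
      unfolding Z_def kill_pow_Suc
      by (intro kill_pow_mono tame_kill tame_z2 tame_add tame_cmult tame_const tame_x2 kz y)
    also have "\<dots> = Z n + C * (Sv n x y + (kill_op ^^ n) (\<lambda>x y. x\<^sup>2) x y)"
      by (subst kill_pow_add, (intro tame_z2 tame_add tame_cmult tame_const tame_x2)+, subst kill_pow_cmult,
          subst kill_pow_add, (intro tame_const tame_x2)+) (simp add: Z_def Sv_def)
    finally show ?thesis .
  qed
  have Zb: "Z (Suc n) \<le> A + C * (w + X) * (\<Sum>j=1..n. 1 / sqrt (real j))" for n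
  proof (induction n)
    case 0
    show ?case using Zstep[of 0] by (simp add: Z_def A_def Sv_def)
  next
    case (Suc n)
    have "Sv (Suc n) x y \<le> w / sqrt (real (Suc n))"
      using sb[of "Suc n" y x] y by (simp add: w_def pos_le_divide_eq mult.commute)
    then have "C * (Sv (Suc n) x y + (kill_op ^^ Suc n) (\<lambda>x y. x\<^sup>2) x y) \<le> C * (w / sqrt (real (Suc n)) + X / sqrt (real (Suc n)))"
      using C xd[of "Suc n"] by (intro mult_left_mono add_mono) auto
    then have "Z (Suc (Suc n)) \<le> Z (Suc n) + C * (w / sqrt (real (Suc n)) + X / sqrt (real (Suc n)))"
      using Zstep[of "Suc n"] by linarith
    also have "C * (w / sqrt (real (Suc n)) + X / sqrt (real (Suc n))) = C * (w + X) * (1 / sqrt (real (Suc n)))"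
      by (simp add: algebra_simps add_divide_distrib)
    finally show ?case using Suc by (simp add: distrib_left)
  qed
  define L where "L = 2 * (A + C * (w + X) * 2) + 2 * \<rho>\<^sup>2 * X"
  show thesis
  proof
    show "0 \<le> L" using A C w X by (simp add: L_def)
    fix n :: nat assume n: "1 \<le> n"
    have sn: "1 \<le> sqrt (real n)" using n by simp
    have Zn: "Z n \<le> (A + C * (w + X) * 2) * sqrt (real n)"
    proof -
      obtain k where k: "n = Suc k" using n by (cases n) auto
      have "Z n \<le> A + C * (w + X) * (\<Sum>j=1..k. 1 / sqrt (real j))" unfolding k by (rule Zb)
      also have "\<dots> \<le> A + C * (w + X) * (2 * sqrt (real k))"
        using C w X sum_inverse_sqrt[of k] by (intro add_left_mono mult_left_mono) auto
      also have "\<dots> \<le> A * sqrt (real n) + C * (w + X) * (2 * sqrt (real n))"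
        using C w X A sn k mult_left_mono[OF sn A] by (intro add_mono mult_left_mono) auto
      finally show ?thesis by (simp add: algebra_simps)
    qed
    have Xn: "(kill_op ^^ n) (\<lambda>x y. x\<^sup>2) x y \<le> X * sqrt (real n)"
    proof -
      have "X / sqrt (real n) \<le> X * 1" using X sn by (simp add: divide_le_eq mult_le_cancel_left1)
      also have "\<dots> \<le> X * sqrt (real n)" using X sn by (intro mult_left_mono) auto
      finally show ?thesis using xd[OF n] by linarith
    qed
    have "(kill_op ^^ n) (\<lambda>x y. y\<^sup>2) x y \<le> (kill_op ^^ n) (\<lambda>x y. 2 * (y + \<rho> * x)\<^sup>2 + (2 * \<rho>\<^sup>2) * x\<^sup>2) x y"
    proof (rule kill_pow_mono[OF tame_y2 _ _ y])
      show "tame (\<lambda>x y. 2 * (y + \<rho> * x)\<^sup>2 + (2 * \<rho>\<^sup>2) * x\<^sup>2)" by (intro tame_add tame_cmult tame_z2 tame_x2)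
      fix x y :: real
      \<comment> \<open>This square is the difference of the two sides of the next
        inequality.\<close>
      have "0 \<le> (y + 2 * \<rho> * x)\<^sup>2" by simp
      then show "y\<^sup>2 \<le> 2 * (y + \<rho> * x)\<^sup>2 + (2 * \<rho>\<^sup>2) * x\<^sup>2"
        by (simp add: power2_eq_square algebra_simps)
    qed
    also have "\<dots> = 2 * Z n + (2 * \<rho>\<^sup>2) * (kill_op ^^ n) (\<lambda>x y. x\<^sup>2) x y"
      by (subst kill_pow_add, (intro tame_cmult tame_z2 tame_x2)+) (simp add: kill_pow_cmult Z_def)
    also have "\<dots> \<le> 2 * ((A + C * (w + X) * 2) * sqrt (real n)) + (2 * \<rho>\<^sup>2) * (X * sqrt (real n))"
      using Zn Xn by (intro add_mono mult_left_mono) auto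
    also have "\<dots> = L * sqrt (real n)" by (simp add: L_def algebra_simps)
    finally show "(kill_op ^^ n) (\<lambda>x y. y\<^sup>2) x y \<le> L * sqrt (real n)" .
  qed
qed

lemma Fx_tendsto: assumes y: "0 < y" shows "(\<lambda>n. Fx n x y) \<longlonglongrightarrow> 0" and Sv_tendsto: "(\<lambda>n. Sv n x y) \<longlonglongrightarrow> 0"
proof -
  obtain K where K: "0 < K" and sb: "\<And>n x y. 1 \<le> n \<Longrightarrow> 0 < y \<Longrightarrow>
   sqrt (real n) * Sv n x y \<le> K * (1 + y + \<bar>x\<bar>) \<and> sqrt (real n) * Fx n x y \<le> K * (1 + y + \<bar>x\<bar>)"
    by (metis survival_bound)
  have lim: "(\<lambda>n. K * (1 + y + \<bar>x\<bar>) / sqrt (real n)) \<longlonglongrightarrow> 0"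
    by (intro tendsto_divide_0[OF tendsto_const] filterlim_at_top_imp_at_infinity
        filterlim_compose[OF sqrt_at_top filterlim_real_sequentially])
  have b: "Sv n x y \<le> K * (1 + y + \<bar>x\<bar>) / sqrt (real n)" "Fx n x y \<le> K * (1 + y + \<bar>x\<bar>) / sqrt (real n)" if "1 \<le> n" for n
    using sb[OF that y, of x] that by (simp_all add: pos_le_divide_eq mult.commute)
  show "(\<lambda>n. Fx n x y) \<longlonglongrightarrow> 0"
    by (rule tendsto_sandwich[OF _ _ tendsto_const lim])
       (use Fx_nonneg[OF y] b in \<open>auto intro!: eventually_sequentiallyI[of 1]\<close>)
  show "(\<lambda>n. Sv n x y) \<longlonglongrightarrow> 0"
    by (rule tendsto_sandwich[OF _ _ tendsto_const lim])
       (use Sv_nonneg[OF y] b in \<open>auto intro!: eventually_sequentiallyI[of 1]\<close>)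
qed

lemma Ty_tendsto: assumes y: "0 < y" shows "(\<lambda>n. Ty n x y) \<longlonglongrightarrow> Vlim x y"
proof -
  have "(\<lambda>n. Ty n x y - Ez n x y) \<longlonglongrightarrow> 0"
  proof (rule Lim_null_comparison)
    show "\<forall>\<^sub>F n in sequentially. norm (Ty n x y - Ez n x y) \<le> \<bar>\<rho>\<bar> * Fx n x y"
      using Ty_Ez[OF y] by simp
    show "(\<lambda>n. \<bar>\<rho>\<bar> * Fx n x y) \<longlonglongrightarrow> 0"
      using tendsto_mult[OF tendsto_const[of "\<bar>\<rho>\<bar>"] Fx_tendsto(1)[OF y, of x]] by simp
  qed
  from tendsto_add[OF this Ez_tendsto[OF y, of x]] show ?thesis by simp
qed

text \<open>Used with \<open>k\<close> a small fraction of \<open>l\<close>: at time \<open>k\<close> the walk has height of order \<open>sqrt k\<close>,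
  small compared with \<open>sqrt l\<close>, where \<open>nerf\<close> is almost linear.\<close>

lemma survival_split:
  assumes \<delta>: "0 < \<delta>"
  obtains C where "0 \<le> C"
    "\<And>k l x y. 1 \<le> l \<Longrightarrow> 0 < y \<Longrightarrow> \<bar>Sv (k + l) x y - sqrt (2/pi) * Ty k x y / sqrt (v * real l)\<bar>
       \<le> \<delta> * Sv k x y + C / sqrt (real l) * (Sv k x y + Fx k x y) + (kill_op ^^ k) (\<lambda>x y. y\<^sup>2) x y / (v * real l)"
proof -
  obtain C where C: "0 \<le> C" and appr: "\<And>n x y. 1 \<le> n \<Longrightarrow> 0 < y \<Longrightarrow>
    \<bar>(kill_op ^^ n) (\<lambda>x y. 1) x y - nerf (y / sqrt (v * real n))\<bar> \<le> \<delta> + C * (1 + \<bar>x\<bar>) / sqrt (real n)"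
    using survival_approx[OF \<delta>] by metis
  show thesis
  proof (rule that[OF C])
    fix k l :: nat and x y :: real assume l: "1 \<le> l" and y: "0 < y"
    define c where "c = sqrt (2/pi) / sqrt (v * real l)"
    define q where "q = C / sqrt (real l)"
    define g where "g = (\<lambda>x y. 0 * y + ((\<delta> + q) + q * \<bar>x\<bar>) + 1 / (v * real l) * y\<^sup>2)"
    have tS: "tame (Sv l)" unfolding Sv_def by (intro tame_kill_pow tame_const)
    have tc: "tame (\<lambda>x y. c * y)" by (intro tame_cmult tame_y)
    have tg: "tame g" unfolding g_def by (intro tame_add[OF tame_lin] tame_cmult tame_y2)
    have vl: "0 < v * real l" using v_pos l by simp
    have "Sv (k + l) x y - c * Ty k x y = (kill_op ^^ k) (\<lambda>x y. Sv l x y - c * y) x y"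
      by (subst kill_pow_diff[OF tS tc]) (simp add: Sv_def kill_pow_pow kill_pow_cmult Ty_def)
    also have "\<bar>\<dots>\<bar> \<le> (kill_op ^^ k) g x y"
    proof (rule kill_pow_abs_le[OF tame_diff[OF tS tc] tg _ y])
      fix x y :: real assume y: "0 < y"
      have a: "\<bar>Sv l x y - nerf (y / sqrt (v * real l))\<bar> \<le> \<delta> + C * (1 + \<bar>x\<bar>) / sqrt (real l)"
        using appr[OF l y] by (simp add: Sv_def)
      have "\<bar>nerf (y / sqrt (v * real l)) - sqrt (2/pi) * (y / sqrt (v * real l))\<bar> \<le> (y / sqrt (v * real l))\<^sup>2"
        using y vl by (intro nerf_linear) simp
      then have b: "\<bar>nerf (y / sqrt (v * real l)) - c * y\<bar> \<le> 1 / (v * real l) * y\<^sup>2"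
        using vl by (simp add: c_def power_divide)
      have "C * (1 + \<bar>x\<bar>) / sqrt (real l) = q + q * \<bar>x\<bar>" by (simp add: q_def distrib_left add_divide_distrib)
      then show "\<bar>Sv l x y - c * y\<bar> \<le> g x y" using a b unfolding g_def by simp
    qed
    also have "\<dots> = ((\<delta> + q) * Sv k x y + q * Fx k x y) + 1 / (v * real l) * (kill_op ^^ k) (\<lambda>x y. y\<^sup>2) x y"
      unfolding g_def by (subst kill_pow_add[OF tame_lin tame_cmult[OF tame_y2]], subst kill_pow_lin, subst kill_pow_cmult) simp
    finally show "\<bar>Sv (k + l) x y - sqrt (2/pi) * Ty k x y / sqrt (v * real l)\<bar>
       \<le> \<delta> * Sv k x y + C / sqrt (real l) * (Sv k x y + Fx k x y) + (kill_op ^^ k) (\<lambda>x y. y\<^sup>2) x y / (v * real l)"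
      by (simp add: c_def q_def algebra_simps)
  qed
qed

text \<open>Split at \<open>k = n div N\<close>, let \<open>n\<close> tend to infinity for fixed
  \<open>N\<close>, and only then choose \<open>N\<close> large. The height at time \<open>k\<close>
  is of order \<open>sqrt k\<close>, so the quadratic remainder of the linearisation contributes a
  term of order \<open>1 / sqrt N\<close>.\<close>

theorem survival_asymp:
  assumes y: "0 < y"
  shows "(\<lambda>n. sqrt (real n) * Sv n x y) \<longlonglongrightarrow> sqrt (2/pi) * Vlim x y / sqrt v"
proof -
  obtain K1 where K1: "0 < K1" and sb: "\<And>n x y. 1 \<le> n \<Longrightarrow> 0 < y \<Longrightarrow>
   sqrt (real n) * Sv n x y \<le> K1 * (1 + y + \<bar>x\<bar>) \<and> sqrt (real n) * Fx n x y \<le> K1 * (1 + y + \<bar>x\<bar>)"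
    by (metis survival_bound)
  obtain K2 where K2: "0 \<le> K2" and y2: "\<And>n. 1 \<le> n \<Longrightarrow> (kill_op ^^ n) (\<lambda>x y. y\<^sup>2) x y \<le> K2 * sqrt (real n)"
    using y2_growth[OF y, of x] by metis
  define K where "K = K1 * (1 + y + \<bar>x\<bar>)"
  have K: "0 \<le> K" using K1 y by (simp add: K_def)
  have S: "Sv k x y \<le> K / sqrt (real k)" and F: "Fx k x y \<le> K / sqrt (real k)" if "1 \<le> k" for k
    using sb[OF that y, of x] that by (simp_all add: K_def pos_le_divide_eq mult.commute)
  define c0 where "c0 = sqrt (2/pi) / sqrt v"
  have c0: "0 < c0" using v_pos by (simp add: c0_def)
  define V where "V = Vlim x y"
  have main: "\<exists>C\<ge>0. \<forall>n\<ge>N. \<bar>sqrt (real n) * Sv n x y - c0 * V\<bar> \<le>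
      (K * (2 / sqrt (real N)) + 2 * K2 / v * (1 / sqrt (real N)) + c0 * \<bar>V\<bar> * (1 / (real N - 1)))
      + (C * (1 / sqrt (real n)) + 2 * c0 * \<bar>Ty (n div N) x y - V\<bar>)" if N: "2 \<le> N" for N :: nat
  proof -
    \<comment> \<open>The fixed error is taken as \<open>1 / N\<close>: multiplied by
      \<open>sqrt n * Sv k\<close>, which is of order \<open>sqrt N\<close>, it still vanishes as
      \<open>N\<close> grows.\<close>
    obtain C where C: "0 \<le> C" and sp: "\<And>k l x y. 1 \<le> l \<Longrightarrow> 0 < y \<Longrightarrow> \<bar>Sv (k + l) x y - sqrt (2/pi) * Ty k x y / sqrt (v * real l)\<bar>
       \<le> 1 / real N * Sv k x y + C / sqrt (real l) * (Sv k x y + Fx k x y) + (kill_op ^^ k) (\<lambda>x y. y\<^sup>2) x y / (v * real l)"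
      using survival_split[of "1 / real N"] N by auto
    show ?thesis
    proof (intro exI conjI allI impI)
      show "0 \<le> 8 * C * K * sqrt (real N)" using C K by simp
      fix n assume n: "N \<le> n"
      define k where "k = n div N"
      define l where "l = n - k"
      have k1: "1 \<le> k" using n N by (simp add: k_def Suc_le_eq div_greater_zero_iff)
      have kN: "k * N \<le> n" "n \<le> 2 * N * k"
      proof -
        show "k * N \<le> n" by (simp add: k_def)
        have "n = N * k + n mod N" by (simp add: k_def)
        moreover have "n mod N < N" using N by simp
        moreover have "N \<le> N * k" using k1 by simp
        moreover have "2 * N * k = N * k + N * k" by simp
        ultimately show "n \<le> 2 * N * k" by linarith
      qed
      have "k * 2 \<le> k * N" using N by (intro mult_left_mono) auto
      then have k2: "k * 2 \<le> n" using kN by linarith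
      then have l: "1 \<le> l" "n = k + l" "n \<le> 2 * l" using k1 by (auto simp: l_def)
      define sn where "sn = sqrt (real n)"
      define sk where "sk = sqrt (real k)"
      define sl where "sl = sqrt (real l)"
      define sN where "sN = sqrt (real N)"
      have pos: "0 < sn" "0 < sk" "0 < sl" "0 < sN" using k1 l N by (auto simp: sn_def sk_def sl_def sN_def)
      have snk: "sn \<le> 2 * sN * sk"
      proof -
        have "real n \<le> real (2 * N * k)" using kN(2) by (simp only: of_nat_le_iff)
        also have "\<dots> \<le> 4 * real N * real k" by simp
        finally have "sn \<le> sqrt (4 * real N * real k)" unfolding sn_def by (intro real_sqrt_le_mono)
        then show ?thesis by (simp add: sN_def sk_def real_sqrt_mult)
      qed
      have skn: "sk * sN \<le> sn"
      proof -
        have "real (k * N) \<le> real n" using kN(1) by (simp only: of_nat_le_iff)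
        then have "sqrt (real k * real N) \<le> sn" unfolding sn_def by (intro real_sqrt_le_mono) simp
        then show ?thesis by (simp add: sN_def sk_def real_sqrt_mult)
      qed
      have sq: "sn * sn = real n" "sk * sk = real k" "sl * sl = real l" "sN * sN = real N"
        by (simp_all add: sn_def sk_def sl_def sN_def)
      have n2l: "real n \<le> 2 * real l" using l(3) by linarith
      have snl: "sn \<le> 2 * sl"
      proof -
        have "sn \<le> sqrt (4 * real l)" unfolding sn_def using n2l by (intro real_sqrt_le_mono) simp
        then show ?thesis by (simp add: sl_def real_sqrt_mult)
      qed
      have ln: "sl \<le> sn" unfolding sl_def sn_def using l by simp
      have "\<bar>Sv n x y - sqrt (2/pi) * Ty k x y / sqrt (v * real l)\<bar> \<le> 1 / real N * Sv k x y + C / sl * (Sv k x y + Fx k x y) + (kill_op ^^ k) (\<lambda>x y. y\<^sup>2) x y / (v * real l)"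
        using sp[OF l(1) y, of k x] l(2) by (simp add: sl_def)
      also have "\<dots> \<le> 1 / real N * (K / sk) + C / sl * (K / sk + K / sk) + (K2 * sk) / (v * real l)"
        using S[OF k1] F[OF k1] y2[OF k1] C v_pos pos
        by (intro add_mono mult_left_mono divide_right_mono) (auto simp: sk_def)
      finally have "sn * \<bar>Sv n x y - sqrt (2/pi) * Ty k x y / sqrt (v * real l)\<bar> \<le>
          sn * (1 / real N * (K / sk) + C / sl * (K / sk + K / sk) + (K2 * sk) / (v * real l))"
        using pos by (intro mult_left_mono) auto
      also have "\<dots> = K * (sn / sk / real N) + 2 * C * K * (sn / sk) * (1 / sl) + K2 / v * (sn * sk / real l)"
        by (simp add: algebra_simps)
      also have "\<dots> \<le> K * (2 / sN) + 2 * C * K * (2 * sN) * (2 / sn) + K2 / v * (2 / sN)"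
      proof (intro add_mono mult_mono mult_left_mono)
        have a: "sn / sk \<le> 2 * sN" using snk pos by (simp add: divide_le_eq)
        have "sn / sk / real N \<le> 2 * sN / (sN * sN)" unfolding sq using a N by (intro divide_right_mono) auto
        also have "\<dots> = 2 / sN" using pos by simp
        finally show "sn / sk / real N \<le> 2 / sN" .
        show "sn / sk \<le> 2 * sN" by (rule a)
        show "1 / sl \<le> 2 / sn" using snl pos by (simp add: field_simps)
        have "sn * sk \<le> sn * (sn / sN)" using skn pos by (intro mult_left_mono) (auto simp: field_simps)
        also have "\<dots> = real n / sN" by (simp add: sq(1))
        also have "\<dots> \<le> 2 * real l / sN" using n2l pos by (intro divide_right_mono) auto
        finally show "sn * sk / real l \<le> 2 / sN" using l pos by (simp add: divide_le_eq mult.commute)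
      qed (use K K2 C v_pos pos in auto)
      finally have A: "sn * \<bar>Sv n x y - sqrt (2/pi) * Ty k x y / sqrt (v * real l)\<bar>
         \<le> K * (2 / sN) + 8 * C * K * sN * (1 / sn) + 2 * K2 / v * (1 / sN)" by (simp add: mult_ac)
      \<comment> \<open>The prefactor lost by running for \<open>l = n - k\<close> steps only. Its
        excess over 1 is at most that of its square, which is
        \<open>k / l \<le> 1 / (N - 1)\<close>.\<close>
      define r where "r = sn / sl"
      have r1: "1 \<le> r" using ln pos by (simp add: r_def)
      have r2: "r \<le> 2" using snl pos by (simp add: r_def divide_le_eq)
      have "r * 1 \<le> r * r" using r1 by (intro mult_left_mono) auto
      also have "r * r = real n / real l" by (simp add: r_def sq)
      also have "\<dots> \<le> 1 + 1 / (real N - 1)"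
      proof -
        have "real k * real N \<le> real k + real l" using kN(1) l(2) by (metis of_nat_add of_nat_le_iff of_nat_mult)
        then have "real k * (real N - 1) \<le> real l" by (simp add: algebra_simps)
        then have "real k / real l \<le> 1 / (real N - 1)" using l N by (simp add: field_simps)
        moreover have "real n / real l = 1 + real k / real l" using l by (simp add: add_divide_distrib)
        ultimately show ?thesis by simp
      qed
      finally have r3: "r - 1 \<le> 1 / (real N - 1)" by simp
      have "sn * (sqrt (2/pi) * Ty k x y / sqrt (v * real l)) - c0 * V = c0 * (r * (Ty k x y - V) + (r - 1) * V)"
        by (simp add: c0_def r_def sl_def real_sqrt_mult algebra_simps)
      also have "\<bar>\<dots>\<bar> \<le> c0 * (r * \<bar>Ty k x y - V\<bar> + (r - 1) * \<bar>V\<bar>)"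
      proof -
        have "\<bar>r * (Ty k x y - V) + (r - 1) * V\<bar> \<le> \<bar>r * (Ty k x y - V)\<bar> + \<bar>(r - 1) * V\<bar>" by (rule abs_triangle_ineq)
        also have "\<dots> = r * \<bar>Ty k x y - V\<bar> + (r - 1) * \<bar>V\<bar>" using r1 by (simp add: abs_mult)
        finally show ?thesis using c0 by (simp add: abs_mult)
      qed
      also have "\<dots> \<le> c0 * (2 * \<bar>Ty k x y - V\<bar> + 1 / (real N - 1) * \<bar>V\<bar>)"
        using c0 r2 r3 by (intro mult_left_mono add_mono mult_right_mono) auto
      finally have B: "\<bar>sn * (sqrt (2/pi) * Ty k x y / sqrt (v * real l)) - c0 * V\<bar> \<le> c0 * (2 * \<bar>Ty k x y - V\<bar> + 1 / (real N - 1) * \<bar>V\<bar>)" .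
      have A': "\<bar>sn * Sv n x y - sn * (sqrt (2/pi) * Ty k x y / sqrt (v * real l))\<bar>
         \<le> K * (2 / sN) + 8 * C * K * sN * (1 / sn) + 2 * K2 / v * (1 / sN)"
        using A pos by (simp only: abs_mult right_diff_distrib[symmetric] abs_of_pos)
      have "\<bar>sn * Sv n x y - c0 * V\<bar> \<le> (K * (2 / sN) + 8 * C * K * sN * (1 / sn) + 2 * K2 / v * (1 / sN))
         + c0 * (2 * \<bar>Ty k x y - V\<bar> + 1 / (real N - 1) * \<bar>V\<bar>)"
      proof -
        have "\<bar>p1 - p3\<bar> \<le> e1 + e2" if "\<bar>p1 - p2\<bar> \<le> e1" "\<bar>p2 - p3\<bar> \<le> e2" for p1 p2 p3 e1 e2 :: real
          using that by linarith
        from this[OF A' B] show ?thesis .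
      qed
      also have "\<dots> = (K * (2 / sN) + 2 * K2 / v * (1 / sN) + c0 * \<bar>V\<bar> * (1 / (real N - 1)))
      + (8 * C * K * sN * (1 / sn) + 2 * c0 * \<bar>Ty k x y - V\<bar>)" by (simp add: algebra_simps)
      finally show "\<bar>sqrt (real n) * Sv n x y - c0 * V\<bar> \<le>
      (K * (2 / sqrt (real N)) + 2 * K2 / v * (1 / sqrt (real N)) + c0 * \<bar>V\<bar> * (1 / (real N - 1)))
      + (8 * C * K * sqrt (real N) * (1 / sqrt (real n)) + 2 * c0 * \<bar>Ty (n div N) x y - V\<bar>)"
        by (simp only: sn_def sN_def k_def)
    qed
  qed
  have sq_lim: "(\<lambda>n. 1 / sqrt (real n)) \<longlonglongrightarrow> 0"
    by (intro tendsto_divide_0[OF tendsto_const] filterlim_at_top_imp_at_infinity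
        filterlim_compose[OF sqrt_at_top filterlim_real_sequentially])
  have "(\<lambda>n. sqrt (real n) * Sv n x y) \<longlonglongrightarrow> c0 * V"
  proof (rule tendstoI)
    fix \<epsilon> :: real assume \<epsilon>: "0 < \<epsilon>"
    have "(\<lambda>N. K * (2 * (1 / sqrt (real N))) + 2 * K2 / v * (1 / sqrt (real N)) + c0 * \<bar>V\<bar> * (1 / (real N - 1)))
        \<longlonglongrightarrow> K * (2 * 0) + 2 * K2 / v * 0 + c0 * \<bar>V\<bar> * 0"
    proof (intro tendsto_intros sq_lim)
      have "filterlim (\<lambda>N. - 1 + real N) at_top sequentially"
        by (rule filterlim_tendsto_add_at_top[OF tendsto_const filterlim_real_sequentially])
      then have "filterlim (\<lambda>N. real N - 1) at_infinity sequentially"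
        by (intro filterlim_at_top_imp_at_infinity) simp
      then show "(\<lambda>N. 1 / (real N - 1)) \<longlonglongrightarrow> 0" by (rule tendsto_divide_0[OF tendsto_const])
    qed
    then have "\<forall>\<^sub>F N in sequentially. K * (2 * (1 / sqrt (real N))) + 2 * K2 / v * (1 / sqrt (real N)) + c0 * \<bar>V\<bar> * (1 / (real N - 1)) < \<epsilon> / 2"
      by (rule order_tendstoD(2)) (use \<epsilon> in simp)
    then have "\<forall>\<^sub>F N in sequentially. K * (2 * (1 / sqrt (real N))) + 2 * K2 / v * (1 / sqrt (real N)) + c0 * \<bar>V\<bar> * (1 / (real N - 1)) < \<epsilon> / 2 \<and> 2 \<le> N"
      using eventually_ge_at_top[of 2] by eventually_elim simp
    then obtain N where N: "2 \<le> N" "K * (2 * (1 / sqrt (real N))) + 2 * K2 / v * (1 / sqrt (real N)) + c0 * \<bar>V\<bar> * (1 / (real N - 1)) < \<epsilon> / 2"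
      using eventually_happens[of _ sequentially] sequentially_bot by blast
    obtain C where C: "0 \<le> C" and bd: "\<And>n. N \<le> n \<Longrightarrow> \<bar>sqrt (real n) * Sv n x y - c0 * V\<bar> \<le>
      (K * (2 / sqrt (real N)) + 2 * K2 / v * (1 / sqrt (real N)) + c0 * \<bar>V\<bar> * (1 / (real N - 1)))
      + (C * (1 / sqrt (real n)) + 2 * c0 * \<bar>Ty (n div N) x y - V\<bar>)"
      using main[OF N(1)] by blast
    have "filterlim (\<lambda>n. n div N) at_top sequentially"
      unfolding filterlim_at_top
    proof
      fix Z
      show "\<forall>\<^sub>F n in sequentially. Z \<le> n div N"
        using eventually_ge_at_top[of "Z * N"]
      proof eventually_elim
        case (elim n)
        then have "Z * N div N \<le> n div N" by (rule div_le_mono)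
        then show ?case using N by simp
      qed
    qed
    from filterlim_compose[OF Ty_tendsto[OF y, of x] this]
    have "(\<lambda>n. Ty (n div N) x y) \<longlonglongrightarrow> V" by (simp add: V_def)
    then have "(\<lambda>n. C * (1 / sqrt (real n)) + 2 * c0 * \<bar>Ty (n div N) x y - V\<bar>) \<longlonglongrightarrow> C * 0 + 2 * c0 * \<bar>V - V\<bar>"
      by (intro tendsto_intros sq_lim)
    then have "\<forall>\<^sub>F n in sequentially. C * (1 / sqrt (real n)) + 2 * c0 * \<bar>Ty (n div N) x y - V\<bar> < \<epsilon> / 2"
      by (rule order_tendstoD(2)) (use \<epsilon> in simp)
    then show "\<forall>\<^sub>F n in sequentially. dist (sqrt (real n) * Sv n x y) (c0 * V) < \<epsilon>"
      using eventually_ge_at_top[of N]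
    proof eventually_elim
      case (elim n)
      have "2 * (1 / sqrt (real N)) = 2 / sqrt (real N)" by simp
      note N2 = N(2)[unfolded this]
      have "a < \<epsilon>" if "a \<le> q1 + q2" "q1 < \<epsilon> / 2" "q2 < \<epsilon> / 2" for a q1 q2 :: real using that by simp
      from this[OF bd[OF elim(2)] N2 elim(1)] show ?case by (simp only: dist_real_def)
    qed
  qed
  then show ?thesis by (simp add: c0_def V_def)
qed

end

section \<open>From the operator to the walk\<close>

text \<open>Survival as a condition on the first \<open>n\<close> steps. Unlike
  \<open>exit_time\<close> it unfolds one step at a time and can be read off a finite path, which
  measurability and independence require.\<close>

definition alive :: "(nat \<Rightarrow> 'v \<Rightarrow> real) \<Rightarrow> (nat \<Rightarrow> 'v \<Rightarrow> real) \<Rightarrow> real \<Rightarrow> real \<Rightarrow> nat \<Rightarrow> 'v \<Rightarrow> bool" where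
  "alive as bs x y n \<omega> \<longleftrightarrow> (\<forall>k\<in>{1..n}. 0 < y + walk as bs x k \<omega>)"

lemma alive_exit: "enat n < exit_time as bs x y \<omega> \<longleftrightarrow> alive as bs x y n \<omega>"
proof
  assume l: "enat n < exit_time as bs x y \<omega>"
  show "alive as bs x y n \<omega>"
    unfolding alive_def
  proof (rule ballI, rule ccontr)
    fix k assume k: "k \<in> {1..n}" and n: "\<not> 0 < y + walk as bs x k \<omega>"
    then have "exit_time as bs x y \<omega> \<le> enat k" unfolding exit_time_def by (intro INF_lower) auto
    also have "\<dots> \<le> enat n" using k by simp
    finally show False using l by simp
  qed
next
  assume a: "alive as bs x y n \<omega>"
  have "enat (Suc n) \<le> exit_time as bs x y \<omega>"
    unfolding exit_time_def
  proof (rule INF_greatest)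
    fix k assume k: "k \<in> {k. 1 \<le> k \<and> y + walk as bs x k \<omega> \<le> 0}"
    then have "\<not> k \<le> n" using a by (force simp: alive_def)
    then show "enat (Suc n) \<le> enat k" by simp
  qed
  then show "enat n < exit_time as bs x y \<omega>" by (metis enat_ord_simps(2) lessI order_less_le_trans)
qed

lemma alive_Suc: "alive as bs x y (Suc n) \<omega> \<longleftrightarrow> alive as bs x y n \<omega> \<and> 0 < y + walk as bs x (Suc n) \<omega>"
  by (auto simp: alive_def atLeastAtMostSuc_conv)

lemma walk_Suc: "walk as bs x (Suc n) \<omega> = walk as bs x n \<omega> + (as (Suc n) \<omega> * affine_chain as bs x n \<omega> + bs (Suc n) \<omega>)"
  by (simp add: walk_def)

locale affine_walk = affine_law \<mu> p + S: prob_space M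
  for \<mu> :: "(real \<times> real) measure" and p :: real and M :: "'w measure" +
  fixes as bs :: "nat \<Rightarrow> 'w \<Rightarrow> real"
  assumes indep: "S.indep_vars (\<lambda>_. borel) (\<lambda>i \<omega>. (as i \<omega>, bs i \<omega>)) {1..}"
    and law: "1 \<le> i \<Longrightarrow> distr M borel (\<lambda>\<omega>. (as i \<omega>, bs i \<omega>)) = \<mu>"
begin

abbreviation X :: "real \<Rightarrow> nat \<Rightarrow> 'w \<Rightarrow> real" where "X x n \<omega> \<equiv> affine_chain as bs x n \<omega>"
abbreviation Y :: "real \<Rightarrow> real \<Rightarrow> nat \<Rightarrow> 'w \<Rightarrow> real" where "Y x y n \<omega> \<equiv> y + walk as bs x n \<omega>"

text \<open>Coordinate processes on the space of finite paths. Running the same recursion on them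
  exhibits the chain, the walk and survival as measurable functions of the first \<open>n\<close>
  pairs, to which independence of the next pair applies.\<close>

abbreviation pa :: "nat \<Rightarrow> (nat \<Rightarrow> real \<times> real) \<Rightarrow> real" where "pa i u \<equiv> fst (u i)"
abbreviation pb :: "nat \<Rightarrow> (nat \<Rightarrow> real \<times> real) \<Rightarrow> real" where "pb i u \<equiv> snd (u i)"
abbreviation path :: "nat \<Rightarrow> 'w \<Rightarrow> nat \<Rightarrow> real \<times> real" where "path n \<omega> \<equiv> (\<lambda>i\<in>{0<..n}. (as i \<omega>, bs i \<omega>))"
abbreviation PS :: "nat \<Rightarrow> (nat \<Rightarrow> real \<times> real) measure" where "PS n \<equiv> PiM {0<..n} (\<lambda>_. borel)"

lemma chain_path: "k \<le> n \<Longrightarrow> affine_chain pa pb x k (path n \<omega>) = X x k \<omega>"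
  by (induction k) auto

lemma walk_path: "k \<le> n \<Longrightarrow> walk pa pb x k (path n \<omega>) = walk as bs x k \<omega>"
  unfolding walk_def by (intro sum.cong refl chain_path) auto

lemma alive_path: "alive pa pb x y n (path n \<omega>) = alive as bs x y n \<omega>"
  unfolding alive_def by (intro ball_cong refl) (simp add: walk_path)

lemma chain_path_measurable: "k \<le> n \<Longrightarrow> affine_chain pa pb x k \<in> borel_measurable (PS n)"
proof (induction k)
  case (Suc k)
  have [measurable]: "affine_chain pa pb x k \<in> borel_measurable (PS n)" using Suc by simp
  have [measurable]: "(\<lambda>u. u (Suc k)) \<in> measurable (PS n) borel"
    using Suc.prems by (intro measurable_component_singleton) simp
  have "(\<lambda>u. pa (Suc k) u * affine_chain pa pb x k u + pb (Suc k) u) \<in> borel_measurable (PS n)"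
    by measurable
  then show ?case by (subst measurable_cong[where g = "\<lambda>u. pa (Suc k) u * affine_chain pa pb x k u + pb (Suc k) u"]) auto
next
  case 0
  have "affine_chain pa pb x 0 = (\<lambda>u. x)" by (intro ext) simp
  then show ?case by simp
qed

lemma walk_path_measurable: "k \<le> n \<Longrightarrow> walk pa pb x k \<in> borel_measurable (PS n)"
  unfolding walk_def[abs_def] by (intro borel_measurable_sum chain_path_measurable) auto

lemma alive_path_measurable: "Measurable.pred (PS n) (alive pa pb x y n)"
proof -
  have "Measurable.pred (PS n) (\<lambda>u. \<forall>k\<in>{1..n}. 0 < y + walk pa pb x k u)"
  proof (intro pred_intros_finite)
    fix k assume "k \<in> {1..n}"
    then have [measurable]: "walk pa pb x k \<in> borel_measurable (PS n)" by (intro walk_path_measurable) auto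
    show "Measurable.pred (PS n) (\<lambda>u. 0 < y + walk pa pb x k u)" by measurable
  qed simp
  then show ?thesis by (simp add: alive_def[abs_def])
qed

lemma pair_measurable: "1 \<le> i \<Longrightarrow> (\<lambda>\<omega>. (as i \<omega>, bs i \<omega>)) \<in> measurable M borel"
  using indep by (auto simp: S.indep_vars_def)

lemma path_measurable [measurable]: "path n \<in> measurable M (PS n)"
  by (intro measurable_restrict pair_measurable) auto

lemma X_measurable [measurable]: "X x n \<in> borel_measurable M"
  using measurable_compose[OF path_measurable chain_path_measurable[of n n x]] by (simp add: chain_path)

lemma walk_measurable [measurable]: "walk as bs x n \<in> borel_measurable M"
  using measurable_compose[OF path_measurable walk_path_measurable[of n n x]] by (simp add: walk_path)

lemma alive_measurable [measurable]: "Measurable.pred M (alive as bs x y n)"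
proof -
  have "Measurable.pred M (\<lambda>\<omega>. alive pa pb x y n (path n \<omega>))"
    by (rule measurable_compose[OF path_measurable alive_path_measurable])
  then show ?thesis by (simp add: alive_path)
qed

abbreviation next_pair :: "nat \<Rightarrow> 'w \<Rightarrow> nat \<Rightarrow> real \<times> real" where
  "next_pair n \<omega> \<equiv> (\<lambda>i\<in>{Suc n}. (as i \<omega>, bs i \<omega>))"
abbreviation PN :: "nat \<Rightarrow> (nat \<Rightarrow> real \<times> real) measure" where "PN n \<equiv> PiM {Suc n} (\<lambda>_. borel)"

lemma next_pair_measurable [measurable]: "next_pair n \<in> measurable M (PN n)"
  by (intro measurable_restrict pair_measurable) auto

lemma component_measurable [measurable]: "(\<lambda>u. u (Suc n)) \<in> measurable (PN n) borel"
  by (intro measurable_component_singleton) simp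

lemma indep_next: "S.indep_var (PS n) (path n) (PN n) (next_pair n)"
  by (rule S.indep_var_restrict[OF indep]) auto

lemma integral_next: "g \<in> borel_measurable borel \<Longrightarrow> (\<integral>u. g (u (Suc n)) \<partial>distr M (PN n) (next_pair n)) = (\<integral>w. g w \<partial>\<mu>)"
  for g :: "real \<times> real \<Rightarrow> real"
proof -
  assume [measurable]: "g \<in> borel_measurable borel"
  have "(\<integral>u. g (u (Suc n)) \<partial>distr M (PN n) (next_pair n)) = (\<integral>\<omega>. g (as (Suc n) \<omega>, bs (Suc n) \<omega>) \<partial>M)"
    by (subst integral_distr) auto
  also have "\<dots> = (\<integral>w. g w \<partial>distr M borel (\<lambda>\<omega>. (as (Suc n) \<omega>, bs (Suc n) \<omega>)))"
    by (subst integral_distr) (auto intro: pair_measurable)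
  finally show ?thesis by (simp add: law)
qed

lemma weight_integrable: "integrable M (\<lambda>\<omega>. (1 + \<bar>X x n \<omega>\<bar> + \<bar>Y x y n \<omega>\<bar>) powr p)"
proof (induction n)
  case (Suc n)
  let ?W = "\<lambda>\<omega>. (as (Suc n) \<omega>, bs (Suc n) \<omega>)"
  have [measurable]: "affine_chain pa pb x n \<in> borel_measurable (PS n)" "walk pa pb x n \<in> borel_measurable (PS n)"
    by (intro chain_path_measurable walk_path_measurable order_refl)+
  have iv: "S.indep_var borel ((\<lambda>u. (1 + \<bar>affine_chain pa pb x n u\<bar> + \<bar>y + walk pa pb x n u\<bar>) powr p) \<circ> path n)
      borel ((\<lambda>u. (1 + \<bar>fst (u (Suc n))\<bar> + \<bar>snd (u (Suc n))\<bar>) powr p) \<circ> next_pair n)"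
    by (rule S.indep_var_compose[OF indep_next]) measurable
  have "integrable (distr M borel ?W) (\<lambda>w. (1 + \<bar>fst w\<bar> + \<bar>snd w\<bar>) powr p)"
    using integrable_weight law[of "Suc n"] by simp
  then have iW: "integrable M (\<lambda>\<omega>. (1 + \<bar>as (Suc n) \<omega>\<bar> + \<bar>bs (Suc n) \<omega>\<bar>) powr p)"
    by (subst (asm) integrable_distr_eq) (auto intro: pair_measurable)
  have "integrable M (\<lambda>\<omega>. (1 + \<bar>X x n \<omega>\<bar> + \<bar>Y x y n \<omega>\<bar>) powr p * (1 + \<bar>as (Suc n) \<omega>\<bar> + \<bar>bs (Suc n) \<omega>\<bar>) powr p)"
    using S.indep_var_integrable[OF iv] Suc iW by (simp add: comp_def chain_path walk_path)
  then have i2: "integrable M (\<lambda>\<omega>. 2 powr p * ((1 + \<bar>X x n \<omega>\<bar> + \<bar>Y x y n \<omega>\<bar>) powr p * (1 + \<bar>as (Suc n) \<omega>\<bar> + \<bar>bs (Suc n) \<omega>\<bar>) powr p))"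
    by simp
  show ?case
  proof (rule Bochner_Integration.integrable_bound[OF i2])
    show "AE \<omega> in M. norm ((1 + \<bar>X x (Suc n) \<omega>\<bar> + \<bar>Y x y (Suc n) \<omega>\<bar>) powr p)
      \<le> norm (2 powr p * ((1 + \<bar>X x n \<omega>\<bar> + \<bar>Y x y n \<omega>\<bar>) powr p * (1 + \<bar>as (Suc n) \<omega>\<bar> + \<bar>bs (Suc n) \<omega>\<bar>) powr p))"
    proof (rule AE_I2)
      fix \<omega>
      have "(1 + \<bar>X x (Suc n) \<omega>\<bar> + \<bar>Y x y (Suc n) \<omega>\<bar>) powr p
         \<le> (2 * (1 + \<bar>X x n \<omega>\<bar> + \<bar>Y x y n \<omega>\<bar>) * (1 + \<bar>as (Suc n) \<omega>\<bar> + \<bar>bs (Suc n) \<omega>\<bar>)) powr p"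
        using next_weight_le[of "as (Suc n) \<omega>" "X x n \<omega>" "bs (Suc n) \<omega>" "Y x y n \<omega>"] p_gt
        unfolding affine_chain.simps walk_Suc add.assoc by (intro powr_mono2) auto
      also have "\<dots> = 2 powr p * ((1 + \<bar>X x n \<omega>\<bar> + \<bar>Y x y n \<omega>\<bar>) powr p * (1 + \<bar>as (Suc n) \<omega>\<bar> + \<bar>bs (Suc n) \<omega>\<bar>) powr p)"
        by (simp only: powr_mult mult.assoc)
      finally show "norm ((1 + \<bar>X x (Suc n) \<omega>\<bar> + \<bar>Y x y (Suc n) \<omega>\<bar>) powr p)
      \<le> norm (2 powr p * ((1 + \<bar>X x n \<omega>\<bar> + \<bar>Y x y n \<omega>\<bar>) powr p * (1 + \<bar>as (Suc n) \<omega>\<bar> + \<bar>bs (Suc n) \<omega>\<bar>) powr p))"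
        by simp
    qed
  qed measurable
qed (simp add: walk_def)

lemma tame_walk_integrable: assumes "tame f" shows "integrable M (\<lambda>\<omega>. f (X x n \<omega>) (Y x y n \<omega>))"
proof -
  obtain C where C: "C \<ge> 0" "\<And>x y. \<bar>f x y\<bar> \<le> C * (1 + \<bar>x\<bar> + \<bar>y\<bar>) powr p" using tameE[OF assms] by metis
  show ?thesis
  proof (rule Bochner_Integration.integrable_bound)
    show "integrable M (\<lambda>\<omega>. C * (1 + \<bar>X x n \<omega>\<bar> + \<bar>Y x y n \<omega>\<bar>) powr p)"
      by (intro integrable_mult_right weight_integrable)
    show "(\<lambda>\<omega>. f (X x n \<omega>) (Y x y n \<omega>)) \<in> borel_measurable M"
      by (rule tame_comp[OF assms]) measurable
    show "AE \<omega> in M. norm (f (X x n \<omega>) (Y x y n \<omega>)) \<le> norm (C * (1 + \<bar>X x n \<omega>\<bar> + \<bar>Y x y n \<omega>\<bar>) powr p)"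
      using C by (intro AE_I2) (simp add: abs_mult)
  qed
qed

lemma tame_alive_integrable:
  assumes "tame f"
  shows "integrable M (\<lambda>\<omega>. if alive as bs x y k \<omega> then f (X x n \<omega>) (Y x y n \<omega>) else 0)"
proof -
  have "integrable M (\<lambda>\<omega>. indicator {\<omega> \<in> space M. alive as bs x y k \<omega>} \<omega> *\<^sub>R f (X x n \<omega>) (Y x y n \<omega>))"
    by (intro integrable_mult_indicator tame_walk_integrable assms) measurable
  then show ?thesis
    by (rule Bochner_Integration.integrable_cong[THEN iffD1, OF refl, rotated]) (auto simp: indicator_def)
qed

text \<open>The Markov property: past and next pair have a product law, so Fubini integrates out the
  next pair with the past fixed. Survival is required only up to \<open>n\<close>, so the lemma
  serves both the killed step and the exit step.\<close>

lemma one_step: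
  assumes f: "tame f"
  shows "(\<integral>\<omega>. (if alive as bs x y n \<omega> then f (X x (Suc n) \<omega>) (Y x y (Suc n) \<omega>) else 0) \<partial>M)
    = (\<integral>\<omega>. (if alive as bs x y n \<omega> then trans_op f (X x n \<omega>) (Y x y n \<omega>) else 0) \<partial>M)"
proof -
  have [measurable]: "affine_chain pa pb x n \<in> borel_measurable (PS n)" "walk pa pb x n \<in> borel_measurable (PS n)"
    "Measurable.pred (PS n) (alive pa pb x y n)"
    by (intro chain_path_measurable walk_path_measurable alive_path_measurable order_refl)+
  define F where "F = (\<lambda>q :: (nat \<Rightarrow> real \<times> real) \<times> (nat \<Rightarrow> real \<times> real). if alive pa pb x y n (fst q)
     then f (fst (snd q (Suc n)) * affine_chain pa pb x n (fst q) + snd (snd q (Suc n)))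
       ((y + walk pa pb x n (fst q)) + (fst (snd q (Suc n)) * affine_chain pa pb x n (fst q) + snd (snd q (Suc n)))) else 0)"
  have fm [measurable]: "(\<lambda>q. f (fst (snd q (Suc n)) * affine_chain pa pb x n (fst q) + snd (snd q (Suc n)))
       ((y + walk pa pb x n (fst q)) + (fst (snd q (Suc n)) * affine_chain pa pb x n (fst q) + snd (snd q (Suc n))))) \<in> borel_measurable (PS n \<Otimes>\<^sub>M PN n)"
    by (rule tame_comp[OF f]) measurable
  have Fm [measurable]: "F \<in> borel_measurable (PS n \<Otimes>\<^sub>M PN n)"
    unfolding F_def by measurable
  let ?R = "distr M (PS n) (path n)" and ?N = "distr M (PN n) (next_pair n)"
  have joint: "?R \<Otimes>\<^sub>M ?N = distr M (PS n \<Otimes>\<^sub>M PN n) (\<lambda>\<omega>. (path n \<omega>, next_pair n \<omega>))"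
    using indep_next[of n] unfolding S.indep_var_distribution_eq by simp
  have FW: "F (path n \<omega>, next_pair n \<omega>) = (if alive as bs x y n \<omega> then f (X x (Suc n) \<omega>) (Y x y (Suc n) \<omega>) else 0)" for \<omega>
    by (simp add: F_def chain_path walk_path alive_path walk_Suc add_ac)
  interpret R: prob_space ?R by (rule S.prob_space_distr) measurable
  interpret N: prob_space ?N by (rule S.prob_space_distr) measurable
  interpret PP: pair_sigma_finite ?R ?N ..
  have int: "integrable (?R \<Otimes>\<^sub>M ?N) F"
    unfolding joint by (subst integrable_distr_eq) (auto simp: FW simp del: affine_chain.simps intro: tame_alive_integrable[OF f])
  have inner: "(\<integral>w. F (u, w) \<partial>?N) = (if alive pa pb x y n u then trans_op f (affine_chain pa pb x n u) (y + walk pa pb x n u) else 0)" for u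
  proof -
    have "(\<lambda>w. f (fst w * affine_chain pa pb x n u + snd w) ((y + walk pa pb x n u) + (fst w * affine_chain pa pb x n u + snd w))) \<in> borel_measurable borel"
      by (rule tame_comp[OF f]) measurable
    from integral_next[OF this, of n] show ?thesis by (simp add: F_def trans_op_def)
  qed
  have tm [measurable]: "(\<lambda>u. trans_op f (affine_chain pa pb x n u) (y + walk pa pb x n u)) \<in> borel_measurable (PS n)"
    by (rule tame_comp[OF tame_trans[OF f]]) measurable
  have "(\<integral>\<omega>. (if alive as bs x y n \<omega> then f (X x (Suc n) \<omega>) (Y x y (Suc n) \<omega>) else 0) \<partial>M)
     = (\<integral>\<omega>. F (path n \<omega>, next_pair n \<omega>) \<partial>M)" by (simp only: FW)
  also have "\<dots> = (\<integral>q. F q \<partial>(?R \<Otimes>\<^sub>M ?N))"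
    unfolding joint by (subst integral_distr) auto
  also have "\<dots> = (\<integral>u. (\<integral>w. F (u, w) \<partial>?N) \<partial>?R)"
    by (rule PP.integral_fst'[OF int, symmetric])
  also have "\<dots> = (\<integral>\<omega>. (if alive pa pb x y n (path n \<omega>) then trans_op f (affine_chain pa pb x n (path n \<omega>)) (y + walk pa pb x n (path n \<omega>)) else 0) \<partial>M)"
    unfolding inner by (subst integral_distr) auto
  also have "\<dots> = (\<integral>\<omega>. (if alive as bs x y n \<omega> then trans_op f (X x n \<omega>) (Y x y n \<omega>) else 0) \<partial>M)"
    by (simp add: chain_path walk_path alive_path cong: if_cong)
  finally show ?thesis .
qed

text \<open>The last step is peeled off and becomes one application of \<open>kill_op\<close> to the
  test function; this is why the induction is over all \<open>f\<close>.\<close>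

lemma kill_pow_walk:
  assumes "tame f"
  shows "(\<integral>\<omega>. (if alive as bs x y n \<omega> then f (X x n \<omega>) (Y x y n \<omega>) else 0) \<partial>M) = (kill_op ^^ n) f x y"
  using assms
proof (induction n arbitrary: f)
  case 0
  then show ?case by (simp add: alive_def walk_def S.prob_space)
next
  case (Suc n)
  have "(\<integral>\<omega>. (if alive as bs x y (Suc n) \<omega> then f (X x (Suc n) \<omega>) (Y x y (Suc n) \<omega>) else 0) \<partial>M)
     = (\<integral>\<omega>. (if alive as bs x y n \<omega> then killed f (X x (Suc n) \<omega>) (Y x y (Suc n) \<omega>) else 0) \<partial>M)"
    by (intro Bochner_Integration.integral_cong refl) (auto simp: alive_Suc killed_def simp del: affine_chain.simps)
  also have "\<dots> = (\<integral>\<omega>. (if alive as bs x y n \<omega> then kill_op f (X x n \<omega>) (Y x y n \<omega>) else 0) \<partial>M)"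
    unfolding kill_op_def by (rule one_step) (use Suc in auto)
  also have "\<dots> = (kill_op ^^ n) (kill_op f) x y" by (rule Suc.IH) (use Suc in auto)
  finally show ?case by (simp add: kill_pow_Suc del: funpow.simps affine_chain.simps)
qed

lemma exit_walk:
  assumes f: "tame f"
  shows "(\<integral>\<omega>. (if alive as bs x y n \<omega> \<and> \<not> alive as bs x y (Suc n) \<omega> then f (X x (Suc n) \<omega>) (Y x y (Suc n) \<omega>) else 0) \<partial>M)
     = (kill_op ^^ n) (trans_op (\<lambda>x y. if 0 < y then 0 else f x y)) x y"
    and exit_walk_integrable: "integrable M (\<lambda>\<omega>. if alive as bs x y n \<omega> \<and> \<not> alive as bs x y (Suc n) \<omega> then f (X x (Suc n) \<omega>) (Y x y (Suc n) \<omega>) else 0)"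
proof -
  let ?g = "\<lambda>x y. if 0 < y then 0 else f x y"
  have g: "tame ?g" by (rule tame_exit_fun[OF f])
  have eq: "(if alive as bs x y n \<omega> \<and> \<not> alive as bs x y (Suc n) \<omega> then f (X x (Suc n) \<omega>) (Y x y (Suc n) \<omega>) else 0)
    = (if alive as bs x y n \<omega> then ?g (X x (Suc n) \<omega>) (Y x y (Suc n) \<omega>) else 0)" for \<omega>
    by (auto simp: alive_Suc simp del: affine_chain.simps)
  show "integrable M (\<lambda>\<omega>. if alive as bs x y n \<omega> \<and> \<not> alive as bs x y (Suc n) \<omega> then f (X x (Suc n) \<omega>) (Y x y (Suc n) \<omega>) else 0)"
    unfolding eq by (rule tame_alive_integrable[OF g])
  show "(\<integral>\<omega>. (if alive as bs x y n \<omega> \<and> \<not> alive as bs x y (Suc n) \<omega> then f (X x (Suc n) \<omega>) (Y x y (Suc n) \<omega>) else 0) \<partial>M)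
     = (kill_op ^^ n) (trans_op ?g) x y"
    unfolding eq one_step[OF g] by (rule kill_pow_walk[OF tame_trans[OF g]])
qed

lemma prob_alive:
  assumes "tame (\<lambda>x y. if A x y then 1 else 0)"
  shows "S.prob {\<omega> \<in> space M. A (X x n \<omega>) (Y x y n \<omega>) \<and> enat n < exit_time as bs x y \<omega>}
     = (kill_op ^^ n) (\<lambda>x y. if A x y then 1 else 0) x y"
proof -
  have "(kill_op ^^ n) (\<lambda>x y. if A x y then 1 else 0) x y
     = (\<integral>\<omega>. (if alive as bs x y n \<omega> then (if A (X x n \<omega>) (Y x y n \<omega>) then 1 else 0) else 0) \<partial>M)"
    by (rule kill_pow_walk[OF assms, symmetric])
  also have "\<dots> = (\<integral>\<omega>. indicator {\<omega> \<in> space M. A (X x n \<omega>) (Y x y n \<omega>) \<and> enat n < exit_time as bs x y \<omega>} \<omega> \<partial>M)"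
    by (intro Bochner_Integration.integral_cong refl) (auto simp: indicator_def alive_exit)
  also have "\<dots> = S.prob {\<omega> \<in> space M. A (X x n \<omega>) (Y x y n \<omega>) \<and> enat n < exit_time as bs x y \<omega>}"
  proof -
    have "{\<omega> \<in> space M. A (X x n \<omega>) (Y x y n \<omega>) \<and> enat n < exit_time as bs x y \<omega>} \<inter> space M = {\<omega> \<in> space M. A (X x n \<omega>) (Y x y n \<omega>) \<and> enat n < exit_time as bs x y \<omega>}" by auto
    then show ?thesis by (simp add: integral_indicator)
  qed
  finally show ?thesis by simp
qed

lemma prob_exit: "S.prob {\<omega> \<in> space M. enat n < exit_time as bs x y \<omega>} = Sv n x y"
  using prob_alive[of "\<lambda>x y. True" x n y] by (simp add: Sv_def tame_const)

text \<open>Decompose by the exit step: the integrand is a sum with at most one nonzero term. Term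
  by term integration is allowed because the terms are dominated by overshoots and exit
  probabilities, both summable. The exits carry away \<open>z0 - Vlim x y\<close> in total and have
  total probability 1.\<close>

theorem V_fun_eq_Vlim:
  assumes y: "0 < y"
  shows "V_fun M m as bs x y = Vlim x y"
proof -
  define z0 where "z0 = y + \<rho> * x"
  define G where "G = (\<lambda>j \<omega>. if alive as bs x y j \<omega> \<and> \<not> alive as bs x y (Suc j) \<omega>
      then (Y x y (Suc j) \<omega> + \<rho> * X x (Suc j) \<omega>) - z0 else 0)"
  let ?Z = "\<lambda>j \<omega>. if alive as bs x y j \<omega> \<and> \<not> alive as bs x y (Suc j) \<omega> then Y x y (Suc j) \<omega> + \<rho> * X x (Suc j) \<omega> else 0"
  let ?O = "\<lambda>j \<omega>. if alive as bs x y j \<omega> \<and> \<not> alive as bs x y (Suc j) \<omega> then 1 else (0::real)"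
  let ?A = "\<lambda>j \<omega>. if alive as bs x y j \<omega> \<and> \<not> alive as bs x y (Suc j) \<omega> then \<bar>X x (Suc j) \<omega>\<bar> else 0"
  have iZ: "integrable M (?Z j)" and vZ: "(\<integral>\<omega>. ?Z j \<omega> \<partial>M) = (kill_op ^^ j) exit_z x y" for j
    using exit_walk_integrable[OF tame_z, of x y j] exit_walk[OF tame_z, of x y j] by (simp_all add: exit_z_def del: affine_chain.simps)
  have iA: "integrable M (?A j)" and vA: "(\<integral>\<omega>. ?A j \<omega> \<partial>M) = (kill_op ^^ j) exit_abs x y" for j
    using exit_walk_integrable[OF tame_absx, of x y j] exit_walk[OF tame_absx, of x y j] by (simp_all add: exit_abs_def del: affine_chain.simps)
  have iO: "integrable M (?O j)" for j
    using exit_walk_integrable[OF tame_const[of 1], of x y j] by (simp del: affine_chain.simps)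
  have vO: "(\<integral>\<omega>. ?O j \<omega> \<partial>M) = Sv j x y - Sv (Suc j) x y" for j
  proof -
    have t: "trans_op (\<lambda>x y. if 0 < y then 0 else 1) = (\<lambda>x y. 1 - kill_op (\<lambda>x y. 1) x y)"
      by (intro ext) (use kill_eq_trans_diff[OF tame_const[of 1]] in \<open>simp add: trans_const\<close>)
    have "(\<integral>\<omega>. ?O j \<omega> \<partial>M) = (kill_op ^^ j) (\<lambda>x y. 1 - kill_op (\<lambda>x y. 1) x y) x y"
      unfolding t[symmetric] by (rule exit_walk[OF tame_const])
    also have "\<dots> = Sv j x y - Sv (Suc j) x y"
      by (subst kill_pow_diff) (auto simp: Sv_def kill_pow_Suc simp del: funpow.simps)
    finally show ?thesis .
  qed
  have G_eq: "G j \<omega> = ?Z j \<omega> - z0 * ?O j \<omega>" for j \<omega>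
    by (cases "alive as bs x y j \<omega> \<and> \<not> alive as bs x y (Suc j) \<omega>")
       (simp_all only: G_def if_True if_False mult_1_right mult_zero_right diff_zero simp_thms)
  have iG: "integrable M (G j)" for j unfolding G_eq[abs_def] by (intro Bochner_Integration.integrable_diff iZ integrable_mult_right iO)
  have vG: "(\<integral>\<omega>. G j \<omega> \<partial>M) = (kill_op ^^ j) exit_z x y - z0 * (Sv j x y - Sv (Suc j) x y)" for j
    unfolding G_eq using iZ[of j] iO[of j] by (simp add: vZ vO del: affine_chain.simps)
  have single: "G j \<omega> = 0" if "exit_time as bs x y \<omega> \<noteq> enat (Suc j)" for j \<omega>
  proof -
    have "\<not> (alive as bs x y j \<omega> \<and> \<not> alive as bs x y (Suc j) \<omega>)"
    proof
      assume "alive as bs x y j \<omega> \<and> \<not> alive as bs x y (Suc j) \<omega>"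
      then have "enat j < exit_time as bs x y \<omega>" "\<not> enat (Suc j) < exit_time as bs x y \<omega>" by (simp_all add: alive_exit)
      then show False using that by (cases "exit_time as bs x y \<omega>") auto
    qed
    then show ?thesis unfolding G_def by (rule if_not_P)
  qed
  have exit_pos: "exit_time as bs x y \<omega> \<noteq> enat 0" for \<omega>
    using alive_exit[of 0 as bs x y \<omega>] by (auto simp: alive_def zero_enat_def)
  have sums: "(\<lambda>j. G j \<omega>) sums (case exit_time as bs x y \<omega> of enat k \<Rightarrow> corrected_walk m as bs x k \<omega> | \<infinity> \<Rightarrow> 0)" for \<omega>
  proof (cases "exit_time as bs x y \<omega>")
    case (enat k)
    then obtain j where k: "k = Suc j" using exit_pos[of \<omega>] by (cases k) auto
    have e: "alive as bs x y j \<omega>" "\<not> alive as bs x y (Suc j) \<omega>"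
      using enat k by (simp_all flip: alive_exit)
    have "G i \<omega> = 0" if "i \<notin> {j}" for i
      using that enat k by (intro single) simp
    then have "(\<lambda>i. G i \<omega>) sums (\<Sum>i\<in>{j}. G i \<omega>)" by (intro sums_finite) auto
    then have "(\<lambda>i. G i \<omega>) sums G j \<omega>" by simp
    \<comment> \<open>The corrected walk is the martingale minus its starting value
      \<open>z0\<close>, so the height \<open>y\<close> cancels.\<close>
    moreover have "G j \<omega> = corrected_walk m as bs x k \<omega>"
    proof -
      have "G j \<omega> = (Y x y (Suc j) \<omega> + \<rho> * X x (Suc j) \<omega>) - z0"
        unfolding G_def using e by (simp only: simp_thms if_True)
      then show ?thesis by (simp only: corrected_walk_def k z0_def \<rho>_def right_diff_distrib)
    qed
    ultimately show ?thesis using enat by simp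
  next
    case infinity
    then have "G i \<omega> = 0" for i using single[of \<omega> i] by simp
    then show ?thesis using infinity by simp
  qed
  \<comment> \<open>Almost sure finiteness of the exit time, from the decay of \<open>Sv\<close>.
    The default value on paths that never leave thus carries no mass.\<close>
  have Sv_sums: "(\<lambda>j. Sv j x y - Sv (Suc j) x y) sums (1 - 0)"
    using telescope_sums'[OF Sv_tendsto[OF y, of x]] by (simp add: Sv_def)
  have sA: "summable (\<lambda>j. (1 + \<bar>\<rho>\<bar>) * (kill_op ^^ j) exit_abs x y + \<bar>z0\<bar> * (Sv j x y - Sv (Suc j) x y))"
    by (intro summable_add summable_mult exit_summable y sums_summable[OF Sv_sums])
  have "(\<integral>\<omega>. (\<Sum>j. G j \<omega>) \<partial>M) = (\<Sum>j. \<integral>\<omega>. G j \<omega> \<partial>M)"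
  proof (rule integral_suminf[OF iG])
    show "AE \<omega> in M. summable (\<lambda>j. norm (G j \<omega>))"
    proof (rule AE_I2)
      fix \<omega>
      obtain j0 where "\<And>j. j \<noteq> j0 \<Longrightarrow> G j \<omega> = 0"
        using single[of \<omega>] by (metis Suc_inject enat.inject)
      then show "summable (\<lambda>j. norm (G j \<omega>))" by (intro summable_finite[of "{j0}"]) auto
    qed
    show "summable (\<lambda>j. \<integral>\<omega>. norm (G j \<omega>) \<partial>M)"
    proof (rule summable_comparison_test'[OF sA])
      fix j
      have "(\<integral>\<omega>. norm (G j \<omega>) \<partial>M) \<le> (\<integral>\<omega>. (1 + \<bar>\<rho>\<bar>) * ?A j \<omega> + \<bar>z0\<bar> * ?O j \<omega> \<partial>M)"
      proof (intro integral_mono integrable_norm iG Bochner_Integration.integrable_add integrable_mult_right iA iO)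
        fix \<omega>
        show "norm (G j \<omega>) \<le> (1 + \<bar>\<rho>\<bar>) * ?A j \<omega> + \<bar>z0\<bar> * ?O j \<omega>"
        proof (cases "alive as bs x y j \<omega> \<and> \<not> alive as bs x y (Suc j) \<omega>")
          case True
          have prev: "0 < Y x y j \<omega>"
            using True y by (cases "j = 0") (auto simp: alive_def walk_def)
          have ex: "Y x y (Suc j) \<omega> \<le> 0" using True by (auto simp: alive_Suc simp del: affine_chain.simps)
          have "Y x y (Suc j) \<omega> = Y x y j \<omega> + X x (Suc j) \<omega>" by (simp add: walk_Suc)
          then have "\<bar>Y x y (Suc j) \<omega>\<bar> \<le> \<bar>X x (Suc j) \<omega>\<bar>" using prev ex by linarith
          then have "\<bar>Y x y (Suc j) \<omega> + \<rho> * X x (Suc j) \<omega>\<bar> \<le> (1 + \<bar>\<rho>\<bar>) * \<bar>X x (Suc j) \<omega>\<bar>"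
            using abs_z_le[of "Y x y (Suc j) \<omega>" "X x (Suc j) \<omega>"] unfolding distrib_right by linarith
          then have "\<bar>(Y x y (Suc j) \<omega> + \<rho> * X x (Suc j) \<omega>) - z0\<bar> \<le> (1 + \<bar>\<rho>\<bar>) * \<bar>X x (Suc j) \<omega>\<bar> + \<bar>z0\<bar>" by linarith
          then show ?thesis using True by (simp add: G_def del: affine_chain.simps)
        next
          case False
          then have "G j \<omega> = 0" "?A j \<omega> = 0" "?O j \<omega> = 0" by (simp_all only: G_def if_False)
          then show ?thesis by (simp only: norm_zero mult_zero_right add_0_left order_refl)
        qed
      qed
      also have "\<dots> = (1 + \<bar>\<rho>\<bar>) * (kill_op ^^ j) exit_abs x y + \<bar>z0\<bar> * (Sv j x y - Sv (Suc j) x y)"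
        using iA[of j] iO[of j] by (simp add: vA vO del: affine_chain.simps)
      finally show "norm (\<integral>\<omega>. norm (G j \<omega>) \<partial>M) \<le> (1 + \<bar>\<rho>\<bar>) * (kill_op ^^ j) exit_abs x y + \<bar>z0\<bar> * (Sv j x y - Sv (Suc j) x y)"
        by simp
    qed
  qed
  also have "\<dots> = - Vlim x y"
  proof (rule sums_unique[symmetric])
    have "(\<lambda>n. \<Sum>j<n. (kill_op ^^ j) exit_z x y) \<longlonglongrightarrow> z0 - Vlim x y"
    proof -
      have "(\<lambda>n. z0 - Ez n x y) \<longlonglongrightarrow> z0 - Vlim x y" by (intro tendsto_diff tendsto_const Ez_tendsto y)
      then show ?thesis by (simp add: Ez_def kill_pow_z z0_def)
    qed
    then have "(\<lambda>j. (kill_op ^^ j) exit_z x y) sums (z0 - Vlim x y)" by (simp add: sums_def)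
    from sums_diff[OF this sums_mult[OF Sv_sums, of z0]]
    show "(\<lambda>j. \<integral>\<omega>. G j \<omega> \<partial>M) sums (- Vlim x y)" unfolding vG by simp
  qed
  finally show ?thesis
    unfolding V_fun_def using sums_unique[OF sums] by simp
qed

section \<open>Positivity of \<open>V\<close>\<close>

lemma Vlim_pos:
  assumes A: "tame (\<lambda>x y. if A x y then 1 else (0::real))" and y: "0 < y" and c: "0 < c"
    and low: "\<And>n x y. 0 < y \<Longrightarrow> A x y \<Longrightarrow> c \<le> Ez n x y"
    and pos: "0 < (kill_op ^^ n0) (\<lambda>x y. if A x y then 1 else 0) x y"
  shows "0 < Vlim x y"
proof -
  define P where "P = (kill_op ^^ n0) (\<lambda>x y. if A x y then 1 else 0) x y"
  have ge: "c * P - \<bar>\<rho>\<bar> * Fx (n0 + n) x y \<le> Ez (n0 + n) x y" for n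
  proof -
    have tF: "tame (Fx n)" and tE: "tame (Ez n)"
      unfolding Fx_def Ez_def by (intro tame_kill_pow tame_absx tame_z)+
    have "(kill_op ^^ n0) (\<lambda>x y. c * (if A x y then 1 else 0) - \<bar>\<rho>\<bar> * Fx n x y) x y \<le> (kill_op ^^ n0) (Ez n) x y"
    proof (rule kill_pow_mono[OF tame_diff[OF tame_cmult[OF A] tame_cmult[OF tF]] tE _ y])
      fix x y :: real assume y: "0 < y"
      \<comment> \<open>Outside the good set the mean of the martingale may be negative, but only
        through its part in \<open>x\<close>, since surviving heights are positive. This part
        vanishes in the limit by \<open>Fx_tendsto\<close>, so the contribution \<open>c * P\<close>
        of the good set is not lost.\<close>
      have "- (\<bar>\<rho>\<bar> * Fx n x y) \<le> Ez n x y" using Ty_Ez[OF y, of n x] Ty_nonneg[OF y, of n x] by linarith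
      moreover have "0 \<le> \<bar>\<rho>\<bar> * Fx n x y" using Fx_nonneg[OF y] by simp
      ultimately show "c * (if A x y then 1 else 0) - \<bar>\<rho>\<bar> * Fx n x y \<le> Ez n x y"
        using low[OF y, of x n] by auto
    qed
    also have "(kill_op ^^ n0) (Ez n) x y = Ez (n0 + n) x y" by (simp add: Ez_def kill_pow_pow)
    also have "(kill_op ^^ n0) (\<lambda>x y. c * (if A x y then 1 else 0) - \<bar>\<rho>\<bar> * Fx n x y) x y = c * P - \<bar>\<rho>\<bar> * Fx (n0 + n) x y"
      by (subst kill_pow_diff[OF tame_cmult[OF A] tame_cmult[OF tF]], subst kill_pow_cmult, subst kill_pow_cmult)
         (simp add: P_def Fx_def kill_pow_pow)
    finally show ?thesis .
  qed
  have "(\<lambda>n. c * P - \<bar>\<rho>\<bar> * Fx (n + n0) x y) \<longlonglongrightarrow> c * P - \<bar>\<rho>\<bar> * 0"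
    by (intro tendsto_intros LIMSEQ_ignore_initial_segment Fx_tendsto y)
  moreover have "(\<lambda>n. Ez (n + n0) x y) \<longlonglongrightarrow> Vlim x y"
    by (intro LIMSEQ_ignore_initial_segment Ez_tendsto y)
  ultimately have "c * P - \<bar>\<rho>\<bar> * 0 \<le> Vlim x y"
    by (rule LIMSEQ_le) (use ge in \<open>auto simp: add.commute\<close>)
  moreover have "0 < c * P" using c pos by (simp add: P_def)
  ultimately show ?thesis by simp
qed

end

lemma (in affine_law) tame_indicator:
  assumes "Measurable.pred borel (\<lambda>z. A (fst z) (snd z))"
  shows "tame (\<lambda>x y. if A x y then 1 else (0::real))"
proof (rule tame_linear[where C = 1])
  show "(\<lambda>z. if A (fst z) (snd z) then 1 else (0::real)) \<in> borel_measurable borel"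
    using assms by measurable
qed auto

context affine_walk begin

text \<open>The lower bound \<open>kill_pow_z_ge\<close> says nothing useful when
  \<open>y + \<rho> * x\<close> is nonpositive. One step that does not go far down has positive
  probability and replaces the old \<open>x\<close> by a value near or above 0.\<close>

lemma Vlim_pos_step:
  assumes y: "0 < y" and m: "0 \<le> m"
    and pos: "\<And>y. 0 < y \<Longrightarrow> 0 < (\<integral>w. indicator {w. - y < fst w * x + snd w} w \<partial>\<mu> :: real)"
  shows "0 < Vlim x y"
proof -
  have r: "0 \<le> \<rho>" using m m_bounds by (simp add: \<rho>_def)
  define A where "A = (\<lambda>x' y'. y / 2 \<le> y' + \<rho> * x')"
  have tA: "tame (\<lambda>x y. if A x y then 1 else (0::real))"
    unfolding A_def by (rule tame_indicator) measurable
  \<comment> \<open>Chosen so that an increment above \<open>- y1\<close> leaves the martingale at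
    least \<open>y / 2\<close>: after the step it equals
    \<open>y + (1 + \<rho>) * x1\<close>.\<close>
  define y1 where "y1 = y / (2 * (1 + \<rho>))"
  have y1: "0 < y1" "(1 + \<rho>) * y1 = y / 2" using y r by (auto simp: y1_def field_simps)
  have y1y: "y1 \<le> y / 2"
  proof -
    have "1 * y1 \<le> (1 + \<rho>) * y1" using r y1(1) by (intro mult_right_mono) auto
    then show ?thesis using y1(2) by simp
  qed
  have "(\<integral>w. indicator {w. - y1 < fst w * x + snd w} w \<partial>\<mu>) \<le> (kill_op ^^ 1) (\<lambda>x y. if A x y then 1 else (0::real)) x y"
    unfolding One_nat_def funpow.simps comp_apply id_apply kill_op_def trans_op_def[of "killed _"]
  proof (rule integral_mono)
    show "integrable \<mu> (\<lambda>w. indicator {w. - y1 < fst w * x + snd w} w :: real)"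
    proof (rule dominated_by_weight[where C = 1])
      show "(\<lambda>w. indicator {w. - y1 < fst w * x + snd w} w :: real) \<in> borel_measurable \<mu>"
        by (intro borel_measurable_indicator) (simp add: borel_measurable_less)
      show "\<bar>indicator {w. - y1 < fst w * x + snd w} w :: real\<bar> \<le> 1 * (1 + \<bar>fst w\<bar> + \<bar>snd w\<bar>) powr p" for w
        using weight_ge(1)[of "fst w" "snd w"] by (simp add: indicator_def)
    qed
    show "integrable \<mu> (\<lambda>w. killed (\<lambda>x y. if A x y then 1 else (0::real)) (fst w * x + snd w) (y + (fst w * x + snd w)))"
      by (rule tame_integrable[OF tame_killed[OF tA]])
    fix w :: "real \<times> real"
    define x1 where "x1 = fst w * x + snd w"
    have "A x1 (y + x1) \<and> 0 < y + x1" if l: "- y1 < x1"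
    proof -
      have "(1 + \<rho>) * (- y1) \<le> (1 + \<rho>) * x1" using l r by (intro mult_left_mono) auto
      then have "y / 2 \<le> y + x1 + \<rho> * x1" using y1(2) by (simp add: algebra_simps)
      then show ?thesis using l y1y y by (simp add: A_def)
    qed
    then show "indicator {w. - y1 < fst w * x + snd w} w \<le> killed (\<lambda>x y. if A x y then 1 else (0::real)) (fst w * x + snd w) (y + (fst w * x + snd w))"
      unfolding x1_def[symmetric] by (auto simp: indicator_def killed_def x1_def)
  qed
  then have P: "0 < (kill_op ^^ 1) (\<lambda>x y. if A x y then 1 else (0::real)) x y"
    using pos[OF y1(1)] by linarith
  show ?thesis
  proof (rule Vlim_pos[OF tA y _ _ P])
    show "0 < y / 2" using y by simp
    show "y / 2 \<le> Ez n x' y'" if "0 < y'" "A x' y'" for n x' y'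
      using kill_pow_z_ge[OF that(1) r, of x' n] that(2) by (simp add: Ez_def A_def)
  qed
qed

lemma K_set_ge: assumes "(x, y) \<in> K_set q c" "0 < c" "1 \<le> q" shows "c * (1 + \<bar>x\<bar>) / 2 \<le> y"
proof -
  have "1 + t \<le> 2 * (1 + t powr q)" if t: "0 \<le> t" for t
  proof (cases "t \<le> 1")
    case True
    then have "1 + t \<le> 2 * (1 + 0)" by simp
    also have "\<dots> \<le> 2 * (1 + t powr q)" by (intro mult_left_mono add_left_mono) auto
    finally show ?thesis .
  next
    case False
    then have "t powr 1 \<le> t powr q" using assms by (intro powr_mono) auto
    then show ?thesis using t by simp
  qed
  from this[of "\<bar>x\<bar>"]
  have "c * (1 + \<bar>x\<bar>) \<le> c * (2 * (1 + \<bar>x\<bar> powr q))" using assms by (intro mult_left_mono) auto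
  also have "c * (2 * (1 + \<bar>x\<bar> powr q)) = 2 * (c * (1 + \<bar>x\<bar> powr q))" by simp
  also have "\<dots> \<le> 2 * y" using assms(1) by (simp add: K_set_def)
  finally show ?thesis by simp
qed

text \<open>\<open>Ez_lower\<close> is positive only at heights large compared with
  \<open>1 + \<bar>x\<bar>\<close>. Sets \<open>K_set\<close> with exponent at least 1 lie in that
  region once \<open>c\<close> is large, by \<open>K_set_ge\<close>; reaching one of them while
  alive is enough.\<close>

lemma Vlim_pos_reach:
  assumes y: "0 < y" and q: "1 \<le> q"
    and pos: "\<And>c. 0 < c \<Longrightarrow> \<exists>n. 0 < S.prob {\<omega> \<in> space M. (X x n \<omega>, Y x y n \<omega>) \<in> K_set q c \<and> enat n < exit_time as bs x y \<omega>}"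
  shows "0 < Vlim x y"
proof -
  obtain C where C: "0 \<le> C" and low: "\<And>n x y. 0 < y \<Longrightarrow> y / 2 - C * (1 + \<bar>x\<bar>) \<le> Ez n x y"
    by (metis Ez_lower)
  \<comment> \<open>Then \<open>y / 2\<close> is at least
    \<open>(C + 1) * (1 + \<bar>x\<bar>)\<close> on \<open>K_set\<close>, which leaves
    \<open>1 + \<bar>x\<bar>\<close> after subtracting the error of \<open>Ez_lower\<close>.\<close>
  define c where "c = 4 * (C + 1)"
  have c: "0 < c" using C by (simp add: c_def)
  define A where "A = (\<lambda>x y. (x, y) \<in> K_set q c)"
  have tA: "tame (\<lambda>x y. if A x y then 1 else (0::real))"
    unfolding A_def K_set_def by (rule tame_indicator) simp
  obtain n where "0 < S.prob {\<omega> \<in> space M. A (X x n \<omega>) (Y x y n \<omega>) \<and> enat n < exit_time as bs x y \<omega>}"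
    using pos[OF c] unfolding A_def by blast
  then have P: "0 < (kill_op ^^ n) (\<lambda>x y. if A x y then 1 else (0::real)) x y"
    unfolding prob_alive[OF tA] .
  show ?thesis
  proof (rule Vlim_pos[OF tA y _ _ P])
    show "0 < (1::real)" by simp
    fix n x y assume y: "(0::real) < y" and a: "A x y"
    have "c * (1 + \<bar>x\<bar>) / 2 \<le> y" by (rule K_set_ge[OF _ c q]) (use a in \<open>simp add: A_def\<close>)
    then have "(1 + \<bar>x\<bar>) \<le> y / 2 - C * (1 + \<bar>x\<bar>)" by (simp add: c_def field_simps)
    then show "1 \<le> Ez n x y" using low[OF y, of x n] by simp
  qed
qed

text \<open>The limit is rewritten with \<open>sqrt (2/pi) = 2 / sqrt (2 * pi)\<close>. Positivity
  of the limit turns convergence of the scaled sequence into asymptotic equivalence.\<close>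

lemma exit_asymp_equiv:
  assumes y: "0 < y" and V: "0 < Vlim x y" and s: "s = sqrt v"
  shows "(\<lambda>n::nat. Sv n x y) \<sim>[at_top] (\<lambda>n. 2 * Vlim x y / (sqrt (2 * pi * real n) * s))"
proof (rule asymp_equivI')
  have sv: "0 < sqrt v" using v_pos by simp
  have "(\<lambda>n. sqrt (real n) * Sv n x y * (sqrt (2 * pi) * s / (2 * Vlim x y))) \<longlonglongrightarrow>
      sqrt (2/pi) * Vlim x y / sqrt v * (sqrt (2 * pi) * s / (2 * Vlim x y))"
    by (intro tendsto_mult tendsto_const survival_asymp y)
  also have "sqrt (2/pi) * Vlim x y / sqrt v * (sqrt (2 * pi) * s / (2 * Vlim x y)) = sqrt (2/pi) * sqrt (2 * pi) / 2"
    using V sv by (simp add: s)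
  also have "sqrt (2/pi) * sqrt (2 * pi) = 2" by (simp flip: real_sqrt_mult)
  finally have "(\<lambda>n. sqrt (real n) * Sv n x y * (sqrt (2 * pi) * s / (2 * Vlim x y))) \<longlonglongrightarrow> 1" by simp
  moreover have "(\<lambda>n. sqrt (real n) * Sv n x y * (sqrt (2 * pi) * s / (2 * Vlim x y))) = (\<lambda>n. Sv n x y / (2 * Vlim x y / (sqrt (2 * pi * real n) * s)))"
    by (simp add: real_sqrt_mult fun_eq_iff)
  ultimately show "(\<lambda>n. Sv n x y / (2 * Vlim x y / (sqrt (2 * pi * real n) * s))) \<longlonglongrightarrow> 1" by (simp only:)
qed

end

theorem theorem2p2:
  fixes M :: "'w measure"
    and a b :: "'w \<Rightarrow> real"
    and as bs :: "nat \<Rightarrow> 'w \<Rightarrow> real"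
    and \<alpha> :: real
  assumes "prob_space M"
    and "a \<in> borel_measurable M" and "b \<in> borel_measurable M"
    and "prob_space.indep_vars M (\<lambda>_. borel) (\<lambda>i \<omega>. (as i \<omega>, bs i \<omega>)) {1..}"
    and "\<And>i. 1 \<le> i \<Longrightarrow>
           distr M borel (\<lambda>\<omega>. (as i \<omega>, bs i \<omega>)) = distr M borel (\<lambda>\<omega>. (a \<omega>, b \<omega>))"
    and "2 < \<alpha>"
    and "integrable M (\<lambda>\<omega>. \<bar>a \<omega>\<bar> powr \<alpha>)" and "(\<integral>\<omega>. \<bar>a \<omega>\<bar> powr \<alpha> \<partial>M) < 1"
    and "integrable M (\<lambda>\<omega>. \<bar>b \<omega>\<bar> powr \<alpha>)"
    and "0 < \<P>(\<omega> in M. b \<omega> \<noteq> 0)"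
    and "(\<integral>\<omega>. b \<omega> \<partial>M) = 0"
    and "(0 \<le> (\<integral>\<omega>. a \<omega> \<partial>M) \<and>
            (\<forall>x y. 0 < y \<longrightarrow>
               \<P>(\<omega> in M. 1 < exit_time as bs x y \<omega>) = \<P>(\<omega> in M. - y < a \<omega> * x + b \<omega>) \<and>
               0 < \<P>(\<omega> in M. - y < a \<omega> * x + b \<omega>)))
         \<or> (\<forall>x y. 0 < y \<longrightarrow>
              (\<exists>p\<^sub>0\<in>{2<..<\<alpha>}. \<forall>c>0. \<exists>n\<^sub>0\<ge>1.
                 0 < \<P>(\<omega> in M. (affine_chain as bs x n\<^sub>0 \<omega>, y + walk as bs x n\<^sub>0 \<omega>) \<in> K_set p\<^sub>0 c \<and>
                              enat n\<^sub>0 < exit_time as bs x y \<omega>)))"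
  shows "(\<forall>p\<in>{2<..<\<alpha>}. \<exists>c>0. \<forall>x y. \<forall>n::nat. 0 < y \<longrightarrow> 1 \<le> n \<longrightarrow>
            sqrt n * \<P>(\<omega> in M. enat n < exit_time as bs x y \<omega>) \<le> c * (1 + y + \<bar>x\<bar>) powr p)
       \<and> (\<forall>x y. 0 < y \<longrightarrow>
            (\<lambda>n::nat. \<P>(\<omega> in M. enat n < exit_time as bs x y \<omega>)) \<sim>[at_top]
            (\<lambda>n. 2 * V_fun M (\<integral>\<omega>. a \<omega> \<partial>M) as bs x y / (sqrt (2 * pi * n) * sigma_const M a b)))"
proof -
  interpret S: prob_space M by fact
  note a = assms(2) and b = assms(3)
  let ?ab = "\<lambda>\<omega>. (a \<omega>, b \<omega>)"
  have ab [measurable]: "?ab \<in> measurable M borel" using a b by (rule borel_measurable_Pair)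
  define \<mu> where "\<mu> = distr M borel ?ab"
  \<comment> \<open>The working exponent; it is unrelated to the exponent quantified in the first
    claim.\<close>
  define p where "p = min \<alpha> 3"
  have p: "2 < p" "p \<le> 3" "p \<le> \<alpha>" using assms(6) by (auto simp: p_def)
  have lm: "integrable M (\<lambda>\<omega>. \<bar>a \<omega>\<bar> powr p)" "(\<integral>\<omega>. \<bar>a \<omega>\<bar> powr p \<partial>M) < 1" "integrable M (\<lambda>\<omega>. \<bar>b \<omega>\<bar> powr p)"
    "integrable M (\<lambda>\<omega>. \<bar>b \<omega>\<bar> powr 2)"
    using S.lower_moment[OF a assms(7), of p] S.lower_moment[OF b assms(9), of p] S.lower_moment[OF b assms(9), of 2] assms(6,8) p
    by auto
  have mfst: "(\<lambda>w. fst w) \<in> borel_measurable (borel :: (real \<times> real) measure)"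
    and msnd: "(\<lambda>w. snd w) \<in> borel_measurable (borel :: (real \<times> real) measure)"
    by (simp_all add: borel_prod[symmetric])
  note [measurable] = mfst msnd
  have ind: "integrable \<mu> g \<longleftrightarrow> integrable M (\<lambda>\<omega>. g (a \<omega>, b \<omega>))" "(\<integral>w. g w \<partial>\<mu>) = (\<integral>\<omega>. g (a \<omega>, b \<omega>) \<partial>M)"
    if "g \<in> borel_measurable borel" for g :: "real \<times> real \<Rightarrow> real"
    unfolding \<mu>_def using that by (auto simp: integrable_distr_eq integral_distr)
  have b2: "0 < (\<integral>\<omega>. (b \<omega>)\<^sup>2 \<partial>M)"
  proof -
    have i2: "integrable M (\<lambda>\<omega>. (b \<omega>)\<^sup>2)" using lm(4) by simp
    have "(\<integral>\<omega>. (b \<omega>)\<^sup>2 \<partial>M) \<noteq> 0"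
    proof
      assume "(\<integral>\<omega>. (b \<omega>)\<^sup>2 \<partial>M) = 0"
      then have "AE \<omega> in M. (b \<omega>)\<^sup>2 = 0" using integral_nonneg_eq_0_iff_AE[OF i2] by simp
      then have "AE \<omega> in M. \<not> b \<omega> \<noteq> 0" by simp
      then have "S.prob {\<omega> \<in> space M. b \<omega> \<noteq> 0} = 0" using b by (subst S.prob_eq_0) auto
      then show False using assms(10) by simp
    qed
    moreover have "0 \<le> (\<integral>\<omega>. (b \<omega>)\<^sup>2 \<partial>M)" by simp
    ultimately show ?thesis by linarith
  qed
  have "affine_law \<mu> p"
  proof (intro affine_law.intro affine_law_axioms.intro)
    show "prob_space \<mu>" unfolding \<mu>_def by (rule S.prob_space_distr) measurable
    show "sets \<mu> = sets borel" by (simp add: \<mu>_def)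
    show "integrable \<mu> (\<lambda>w. \<bar>fst w\<bar> powr p)" "(\<integral>w. \<bar>fst w\<bar> powr p \<partial>\<mu>) < 1" "integrable \<mu> (\<lambda>w. \<bar>snd w\<bar> powr p)"
      using lm by (simp_all add: ind)
    show "(\<integral>w. snd w \<partial>\<mu>) = 0" "0 < (\<integral>w. (snd w)\<^sup>2 \<partial>\<mu>)"
      using b2 assms(11) by (simp_all add: ind)
  qed (use p in auto)
  then interpret affine_walk \<mu> p M as bs
    using assms(1,4,5) by (intro affine_walk.intro affine_walk_axioms.intro) (auto simp: \<mu>_def)
  have m_eq: "m = (\<integral>\<omega>. a \<omega> \<partial>M)" and v_eq: "sigma_const M a b = sqrt v"
    by (simp_all add: m_def v_def m2_def b2_def sigma_const_def ind)
  have Vpos: "0 < Vlim x y" if y: "0 < y" for x y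
    using assms(12)
  proof
    assume h: "0 \<le> (\<integral>\<omega>. a \<omega> \<partial>M) \<and>
            (\<forall>x y. 0 < y \<longrightarrow>
               \<P>(\<omega> in M. 1 < exit_time as bs x y \<omega>) = \<P>(\<omega> in M. - y < a \<omega> * x + b \<omega>) \<and>
               0 < \<P>(\<omega> in M. - y < a \<omega> * x + b \<omega>))"
    show ?thesis
    proof (rule Vlim_pos_step[OF y])
      show "0 \<le> m" using h by (simp add: m_eq)
      fix y :: real assume y: "0 < y"
      have [measurable]: "{w :: real \<times> real. - y < fst w * x + snd w} \<in> sets borel" by measurable
      have "(\<integral>w. indicator {w. - y < fst w * x + snd w} w \<partial>\<mu>) = (\<integral>\<omega>. indicator {\<omega> \<in> space M. - y < a \<omega> * x + b \<omega>} \<omega> \<partial>M :: real)"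
      proof (subst ind(2))
        show "(\<lambda>w. indicator {w :: real \<times> real. - y < fst w * x + snd w} w :: real) \<in> borel_measurable borel" by measurable
      qed (intro Bochner_Integration.integral_cong refl, simp add: indicator_def)
      also have "\<dots> = \<P>(\<omega> in M. - y < a \<omega> * x + b \<omega>)"
        unfolding Bochner_Integration.integral_indicator by (intro arg_cong[where f = S.prob]) auto
      finally show "0 < (\<integral>w. indicator {w. - y < fst w * x + snd w} w \<partial>\<mu> :: real)"
        using h y by simp
    qed
  next
    assume h: "\<forall>x y. 0 < y \<longrightarrow>
              (\<exists>p\<^sub>0\<in>{2<..<\<alpha>}. \<forall>c>0. \<exists>n\<^sub>0\<ge>1.
                 0 < \<P>(\<omega> in M. (affine_chain as bs x n\<^sub>0 \<omega>, y + walk as bs x n\<^sub>0 \<omega>) \<in> K_set p\<^sub>0 c \<and>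
                              enat n\<^sub>0 < exit_time as bs x y \<omega>))"
    \<comment> \<open>The exponent may depend on the starting point but not on \<open>c\<close>,
      which is needed since \<open>c\<close> is fixed later from \<open>Ez_lower\<close>.\<close>
    then obtain q where q: "2 < q" and reach: "\<And>c. 0 < c \<Longrightarrow> \<exists>n\<ge>1.
        0 < \<P>(\<omega> in M. (affine_chain as bs x n \<omega>, y + walk as bs x n \<omega>) \<in> K_set q c \<and> enat n < exit_time as bs x y \<omega>)"
      using y by (meson greaterThanLessThan_iff)
    show ?thesis
    proof (rule Vlim_pos_reach[OF y])
      show "1 \<le> q" using q by simp
      show "\<exists>n. 0 < S.prob {\<omega> \<in> space M. (X x n \<omega>, Y x y n \<omega>) \<in> K_set q c \<and> enat n < exit_time as bs x y \<omega>}"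
        if "0 < c" for c using reach[OF that] by blast
    qed
  qed
  obtain K where K: "0 < K" and sb: "\<And>n x y. 1 \<le> n \<Longrightarrow> 0 < y \<Longrightarrow>
   sqrt (real n) * Sv n x y \<le> K * (1 + y + \<bar>x\<bar>) \<and> sqrt (real n) * Fx n x y \<le> K * (1 + y + \<bar>x\<bar>)"
    by (metis survival_bound)
  show ?thesis
    unfolding prob_exit
  \<comment> \<open>The same constant serves every exponent: the bound is linear in
    \<open>1 + y + \<bar>x\<bar>\<close>, which is at least 1.\<close>
  proof (intro conjI ballI allI impI exI[of _ K] K)
    fix q x y :: real and n :: nat assume q: "q \<in> {2<..<\<alpha>}" and y: "0 < y" and n: "1 \<le> n"
    have "sqrt (real n) * Sv n x y \<le> K * (1 + y + \<bar>x\<bar>) powr 1" using sb[OF n y, of x] y by simp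
    also have "\<dots> \<le> K * (1 + y + \<bar>x\<bar>) powr q" using q K y by (intro mult_left_mono powr_mono) auto
    finally show "sqrt (real n) * Sv n x y \<le> K * (1 + y + \<bar>x\<bar>) powr q" .
  next
    fix x y :: real assume y: "0 < y"
    show "(\<lambda>n. Sv n x y) \<sim>[at_top] (\<lambda>n. 2 * V_fun M (\<integral>\<omega>. a \<omega> \<partial>M) as bs x y / (sqrt (2 * pi * real n) * sigma_const M a b))"
      unfolding m_eq[symmetric] V_fun_eq_Vlim[OF y] by (rule exit_asymp_equiv[OF y Vpos[OF y] v_eq])
  qed
qed

end
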